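(* Let $(-)^\dagger$ be the translation from $\mathrm T+\mathit{min}$ to $\mathrm W$ which replaces each occurrence of $\mathit{rec}_\sigma$, $\mathit{min}$ by the $\mathrm W$ programs $$\mathit{Rec}'_\sigma=\lambda xfn.\ \mathit{snd}\,\big(\mathit{while}_{\mathtt N\times\sigma}\,(\lambda\langle n',x'\rangle.\,n'\neq n)\,\langle\widehat 0,x\rangle\,(\lambda\langle n',x'\rangle.\,\langle\mathit{suc}\,n',f x' n'\rangle)\big),$$ $$\mathit{Min}'=\lambda fn.\ \mathit{while}_{\mathtt N}\,(\lambda n'.\,fn'\neq\widehat 0)\,n\,\mathit{suc}$$ respectively, and let $(-)^\circ$ be the translation from $\mathrm W$ and $\mathrm T+\mathit{min}$ into $\mathrm{PCF}+\mathit{byval}$ which replaces $\mathit{while}_\sigma,\mathit{rec}_\sigma,\mathit{min}$ by $\mathit{While}_\sigma,\mathit{Rec}_\sigma,\mathit{Min}$. Then: (i) $(\mathit{Rec}'_\sigma)^\circ\simeq_{\mathrm{obs}}\mathit{Rec}_\sigma$ for every type $\sigma$, and $(\mathit{Min}')^\circ\simeq_{\mathrm{obs}}\mathit{Min}$. (ii) For any closed term $M$ of $\mathrm T+\mathit{min}$, $(M^\dagger)^\circ\simeq_{\mathrm{obs}}M^\circ$. (iii) For any closed $M:\mathtt N$ of $\mathrm T+\mathit{min}$ and any $n\in\mathbb N$, $M\rightsquigarrow^*\widehat n$ iff $M^\dagger\rightsquigarrow^*\widehat n$.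
   Context: **Types** are $\sigma,\tau::=\mathtt N\mid\sigma\to\tau\mid\sigma\times\tau$. The base language $\mathrm B$ is the simply typed $\lambda$-calculus with pairing $\langle M,N\rangle$ and projections $\mathit{fst},\mathit{snd}$, over constants $\widehat n:\mathtt N$ ($n\in\mathbb N$), $\mathit{suc},\mathit{pre}:\mathtt N\to\mathtt N$, $\mathit{ifzero}:\mathtt N\to\mathtt N\to\mathtt N\to\mathtt N$. The operation $\mathit{ifzero}_\sigma:\mathtt N\to\sigma\to\sigma\to\sigma$ abbreviates the evident $\mathrm B$ term: $\mathit{ifzero}_{\mathtt N}=\mathit{ifzero}$, $\mathit{ifzero}_{\sigma\to\tau}=\lambda nxyz.\,\mathit{ifzero}_\tau\,n\,(xz)\,(yz)$, $\mathit{ifzero}_{\sigma\times\tau}=\lambda nxy.\langle\mathit{ifzero}_\sigma\,n(\mathit{fst}\,x)(\mathit{fst}\,y),\mathit{ifzero}_\tau\,n(\mathit{snd}\,x)(\mathit{snd}\,y)\rangle$. **Additional constants:** $Y_\sigma:(\sigma\to\sigma)\to\sigma$; $\mathit{while}_\sigma:(\sigma\to\mathtt N)\to\sigma\to(\sigma\to\sigma)\to\sigma$; $\mathit{rec}_\sigma:\sigma\to(\sigma\to\mathtt N\to\sigma)\to\mathtt N\to\sigma$; $\mathit{min}:(\mathtt N\to\mathtt N)\to\mathtt N\to\mathtt N$; $\mathit{byval}^{\vec\sigma}_\tau:(\vec\sigma\to\mathtt N\to\tau)\to(\vec\sigma\to\mathtt N\to\tau)$ ($\epsilon$ denotes the empty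 list of types). $\mathrm{PCF}+\mathit{byval}$ is $\mathrm B$ plus all $Y_\sigma$ and $\mathit{byval}^{\vec\sigma}_\tau$; $\mathrm W$ is $\mathrm B$ plus all $\mathit{while}_\sigma$; $\mathrm T+\mathit{min}$ is $\mathrm B$ plus all $\mathit{rec}_\sigma$ and $\mathit{min}$. **Reduction** (call-by-name, deterministic): $\mathit{fst}\langle M,N\rangle\rightsquigarrow M$; $\mathit{snd}\langle M,N\rangle\rightsquigarrow N$; $(\lambda x.M)N\rightsquigarrow M[x\mapsto N]$; $\mathit{suc}\,\widehat n\rightsquigarrow\widehat{n+1}$; $\mathit{pre}\,\widehat{n+1}\rightsquigarrow\widehat n$; $\mathit{pre}\,\widehat0\rightsquigarrow\widehat0$; $\mathit{ifzero}\,\widehat0\rightsquigarrow\lambda xy.x$; $\mathit{ifzero}\,\widehat{n+1}\rightsquigarrow\lambda xy.y$; $Y_\sigma F\rightsquigarrow F(Y_\sigma F)$; $\mathit{while}_\sigma CXF\rightsquigarrow\mathit{ifzero}_\sigma(CX)(\mathit{while}_\sigma C(FX)F)X$; $\mathit{rec}_\sigma XF\widehat0\rightsquigarrow X$; $\mathit{rec}_\sigma XF\widehat{n+1}\rightsquigarrow F(\mathit{rec}_\sigma XF\widehat n)\widehat n$; $\mathit{min}\,F\,\widehat n\rightsquigarrow\mathit{ifzero}(F\widehat n)\widehat n(\mathit{min}\,F(\mathit{suc}\,\widehat n))$; $\mathit{byval}^{\vec\sigma}_\tau F\vec X\widehat n\rightsquigarrow F\vec X\widehat n$ (with $|\vec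 X|=|\vec\sigma|$); and if $M\rightsquigarrow M'$ then $E[M]\rightsquigarrow E[M']$ for $E[-]$ one of $[-]N$, $\mathit{suc}[-]$, $\mathit{pre}[-]$, $\mathit{ifzero}[-]$, $\mathit{fst}[-]$, $\mathit{snd}[-]$, $\mathit{rec}_\sigma XF[-]$, $\mathit{min}\,F[-]$, $\mathit{byval}^{\vec\sigma}_\tau F\vec X[-]$. A closed term of type $\mathtt N$ diverges if it does not reduce to a numeral. **Observational equivalence.** For closed $\mathrm{PCF}+\mathit{byval}$ terms $M,M':\sigma$, $M\simeq_{\mathrm{obs}}M'$ iff for every $\mathrm{PCF}+\mathit{byval}$ context $C[-]:\mathtt N$ with a hole of type $\sigma$ and every $n$: $C[M]\rightsquigarrow^*\widehat n$ iff $C[M']\rightsquigarrow^*\widehat n$. **Programs used by $(-)^\circ$.** With $\rho,\mu$ the types of $\mathit{rec}_\sigma,\mathit{min}$ and $\mathit{byval}^+_\sigma=\mathit{byval}^{\sigma,(\sigma\to\mathtt N\to\sigma)}_\sigma$: $\mathit{While}_\sigma=\lambda cxf.\,Y_{\sigma\to\sigma}(\lambda w.\lambda x'.\,\mathit{ifzero}_\sigma(cx')(w(fx'))x')\,x$; $\mathit{Rec}_\sigma=\mathit{byval}^+_\sigma(Y_\rho(\lambda r.\lambda xfn.\,\mathit{ifzero}_\sigma\,n\,x\,(\mathit{byval}^\epsilon_\sigma(\lambda n'.f((\mathit{byval}^+_\sigma r)xfn')n')(\mathit{pre}\,n))))$; $\mathit{Min}=\mathit{byval}^{\mathtt N\to\mathtt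 N}_{\mathtt N}(Y_\mu(\lambda m.\lambda fn.\,\mathit{ifzero}(fn)\,n\,((\mathit{byval}^{\mathtt N\to\mathtt N}_{\mathtt N}m)f(\mathit{suc}\,n))))$. **Inequality.** $\neq$ (written infix) is a fixed closed $\mathrm W$ program of type $\mathtt N\to\mathtt N\to\mathtt N$ implementing inequality testing, with $0$ as "true": for closed $M,N:\mathtt N$ evaluating to $\widehat m,\widehat n$, $M\neq N$ evaluates to $\widehat0$ if $m\ne n$ and to a nonzero numeral if $m=n$; it diverges if $M$ or $N$ does (this holding also for $(\neq)^\circ$ on closed $\mathrm{PCF}+\mathit{byval}$ terms). $\lambda\langle a,b\rangle.M$ is pattern-matching notation for $\lambda p.M[a\mapsto\mathit{fst}\,p,b\mapsto\mathit{snd}\,p]$. *)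

theory Defs
  imports Main
begin

datatype ty =
    Nat\<^sub>t
  | Fun ty ty  (infixr "\<rightarrow>" 65)
  | Prod ty ty  (infixr "\<otimes>" 70)

definition funs :: "ty list \<Rightarrow> ty \<Rightarrow> ty" where
  "funs \<sigma>s \<tau> = foldr Fun \<sigma>s \<tau>"

datatype cst =
    Num nat | SucC | PreC | IfzeroC
  | YC ty | WhileC ty | RecC ty | MinC | ByvalC "ty list" ty

abbreviation ty_of_rec :: "ty \<Rightarrow> ty" where
  "ty_of_rec \<sigma> \<equiv> \<sigma> \<rightarrow> (\<sigma> \<rightarrow> Nat\<^sub>t \<rightarrow> \<sigma>) \<rightarrow> Nat\<^sub>t \<rightarrow> \<sigma>"

abbreviation ty_of_min :: ty where
  "ty_of_min \<equiv> (Nat\<^sub>t \<rightarrow> Nat\<^sub>t) \<rightarrow> Nat\<^sub>t \<rightarrow> Nat\<^sub>t"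

fun cst_ty :: "cst \<Rightarrow> ty" where
  "cst_ty (Num n) = Nat\<^sub>t"
| "cst_ty SucC = Nat\<^sub>t \<rightarrow> Nat\<^sub>t"
| "cst_ty PreC = Nat\<^sub>t \<rightarrow> Nat\<^sub>t"
| "cst_ty IfzeroC = Nat\<^sub>t \<rightarrow> Nat\<^sub>t \<rightarrow> Nat\<^sub>t \<rightarrow> Nat\<^sub>t"
| "cst_ty (YC \<sigma>) = (\<sigma> \<rightarrow> \<sigma>) \<rightarrow> \<sigma>"
| "cst_ty (WhileC \<sigma>) = (\<sigma> \<rightarrow> Nat\<^sub>t) \<rightarrow> \<sigma> \<rightarrow> (\<sigma> \<rightarrow> \<sigma>) \<rightarrow> \<sigma>"
| "cst_ty (RecC \<sigma>) = ty_of_rec \<sigma>"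
| "cst_ty MinC = ty_of_min"
| "cst_ty (ByvalC \<sigma>s \<tau>) = funs \<sigma>s (Nat\<^sub>t \<rightarrow> \<tau>) \<rightarrow> funs \<sigma>s (Nat\<^sub>t \<rightarrow> \<tau>)"

text \<open>Terms modulo renaming of bound variables: \<open>Var i\<close> is the de Bruijn index counting
  binders from the inside, and every abstraction carries the type of its variable.\<close>

datatype tm =
    Var nat
  | Const cst
  | Lam ty tm
  | App tm tm  (infixl "\<cdot>" 200)
  | Pair tm tm
  | Fst tm
  | Snd tm

definition apps :: "tm \<Rightarrow> tm list \<Rightarrow> tm" where
  "apps M Ns = foldl App M Ns"

abbreviation num :: "nat \<Rightarrow> tm" where
  "num n \<equiv> Const (Num n)"

inductive typing :: "ty list \<Rightarrow> tm \<Rightarrow> ty \<Rightarrow> bool"  ("_ \<turnstile> _ \<Colon> _" [50, 50, 50] 50) where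
  "i < length \<Gamma> \<Longrightarrow> \<Gamma> \<turnstile> Var i \<Colon> \<Gamma> ! i"
| "\<Gamma> \<turnstile> Const c \<Colon> cst_ty c"
| "\<sigma> # \<Gamma> \<turnstile> M \<Colon> \<tau> \<Longrightarrow> \<Gamma> \<turnstile> Lam \<sigma> M \<Colon> \<sigma> \<rightarrow> \<tau>"
| "\<Gamma> \<turnstile> M \<Colon> \<sigma> \<rightarrow> \<tau> \<Longrightarrow> \<Gamma> \<turnstile> N \<Colon> \<sigma> \<Longrightarrow> \<Gamma> \<turnstile> M \<cdot> N \<Colon> \<tau>"
| "\<Gamma> \<turnstile> M \<Colon> \<sigma> \<Longrightarrow> \<Gamma> \<turnstile> N \<Colon> \<tau> \<Longrightarrow> \<Gamma> \<turnstile> Pair M N \<Colon> \<sigma> \<otimes> \<tau>"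
| "\<Gamma> \<turnstile> M \<Colon> \<sigma> \<otimes> \<tau> \<Longrightarrow> \<Gamma> \<turnstile> Fst M \<Colon> \<sigma>"
| "\<Gamma> \<turnstile> M \<Colon> \<sigma> \<otimes> \<tau> \<Longrightarrow> \<Gamma> \<turnstile> Snd M \<Colon> \<tau>"

text \<open>A language is given by the set of constants it admits.\<close>

primrec csts_of :: "tm \<Rightarrow> cst set" where
  "csts_of (Var i) = {}"
| "csts_of (Const c) = {c}"
| "csts_of (Lam \<sigma> M) = csts_of M"
| "csts_of (M \<cdot> N) = csts_of M \<union> csts_of N"
| "csts_of (Pair M N) = csts_of M \<union> csts_of N"
| "csts_of (Fst M) = csts_of M"
| "csts_of (Snd M) = csts_of M"

definition lang_B :: "cst set" where
  "lang_B = range Num \<union> {SucC, PreC, IfzeroC}"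

definition lang_PCF_byval :: "cst set" where
  "lang_PCF_byval = lang_B \<union> range YC \<union> {ByvalC \<sigma>s \<tau> |\<sigma>s \<tau>. True}"

definition lang_W :: "cst set" where
  "lang_W = lang_B \<union> range WhileC"

definition lang_T_min :: "cst set" where
  "lang_T_min = lang_B \<union> range RecC \<union> {MinC}"

definition closed_term :: "cst set \<Rightarrow> tm \<Rightarrow> ty \<Rightarrow> bool" where
  "closed_term L M \<sigma> \<longleftrightarrow> [] \<turnstile> M \<Colon> \<sigma> \<and> csts_of M \<subseteq> L"

primrec lift :: "tm \<Rightarrow> nat \<Rightarrow> tm" where
  "lift (Var i) k = (if i < k then Var i else Var (i + 1))"
| "lift (Const c) k = Const c"
| "lift (Lam \<sigma> M) k = Lam \<sigma> (lift M (k + 1))"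
| "lift (M \<cdot> N) k = lift M k \<cdot> lift N k"
| "lift (Pair M N) k = Pair (lift M k) (lift N k)"
| "lift (Fst M) k = Fst (lift M k)"
| "lift (Snd M) k = Snd (lift M k)"

text \<open>\<open>subst M N k\<close> replaces index \<open>k\<close> by \<open>N\<close> in \<open>M\<close> and lowers the indices above \<open>k\<close>,
  since the binder of \<open>k\<close> disappears in a beta step.\<close>

primrec subst :: "tm \<Rightarrow> tm \<Rightarrow> nat \<Rightarrow> tm" where
  "subst (Var i) N k = (if k < i then Var (i - 1) else if i = k then N else Var i)"
| "subst (Const c) N k = Const c"
| "subst (Lam \<sigma> M) N k = Lam \<sigma> (subst M (lift N 0) (k + 1))"
| "subst (M \<cdot> M') N k = subst M N k \<cdot> subst M' N k"
| "subst (Pair M M') N k = Pair (subst M N k) (subst M' N k)"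
| "subst (Fst M) N k = Fst (subst M N k)"
| "subst (Snd M) N k = Snd (subst M N k)"

primrec ifzero :: "ty \<Rightarrow> tm" where
  "ifzero Nat\<^sub>t = Const IfzeroC"
| "ifzero (\<sigma> \<rightarrow> \<tau>) =
     Lam Nat\<^sub>t (Lam (\<sigma> \<rightarrow> \<tau>) (Lam (\<sigma> \<rightarrow> \<tau>) (Lam \<sigma>
       (ifzero \<tau> \<cdot> Var 3 \<cdot> (Var 2 \<cdot> Var 0) \<cdot> (Var 1 \<cdot> Var 0)))))"
| "ifzero (\<sigma> \<otimes> \<tau>) =
     Lam Nat\<^sub>t (Lam (\<sigma> \<otimes> \<tau>) (Lam (\<sigma> \<otimes> \<tau>)
       (Pair (ifzero \<sigma> \<cdot> Var 2 \<cdot> Fst (Var 1) \<cdot> Fst (Var 0))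
             (ifzero \<tau> \<cdot> Var 2 \<cdot> Snd (Var 1) \<cdot> Snd (Var 0)))))"

inductive step :: "tm \<Rightarrow> tm \<Rightarrow> bool"  (infix "\<leadsto>" 50) where
  "Fst (Pair M N) \<leadsto> M"
| "Snd (Pair M N) \<leadsto> N"
| "Lam \<sigma> M \<cdot> N \<leadsto> subst M N 0"
| "Const SucC \<cdot> num n \<leadsto> num (n + 1)"
| "Const PreC \<cdot> num (n + 1) \<leadsto> num n"
| "Const PreC \<cdot> num 0 \<leadsto> num 0"
| "Const IfzeroC \<cdot> num 0 \<leadsto> Lam Nat\<^sub>t (Lam Nat\<^sub>t (Var 1))"
| "Const IfzeroC \<cdot> num (n + 1) \<leadsto> Lam Nat\<^sub>t (Lam Nat\<^sub>t (Var 0))"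
| "Const (YC \<sigma>) \<cdot> F \<leadsto> F \<cdot> (Const (YC \<sigma>) \<cdot> F)"
| "Const (WhileC \<sigma>) \<cdot> C \<cdot> X \<cdot> F \<leadsto>
     ifzero \<sigma> \<cdot> (C \<cdot> X) \<cdot> (Const (WhileC \<sigma>) \<cdot> C \<cdot> (F \<cdot> X) \<cdot> F) \<cdot> X"
| "Const (RecC \<sigma>) \<cdot> X \<cdot> F \<cdot> num 0 \<leadsto> X"
| "Const (RecC \<sigma>) \<cdot> X \<cdot> F \<cdot> num (n + 1) \<leadsto> F \<cdot> (Const (RecC \<sigma>) \<cdot> X \<cdot> F \<cdot> num n) \<cdot> num n"
| "Const MinC \<cdot> F \<cdot> num n \<leadsto>
     Const IfzeroC \<cdot> (F \<cdot> num n) \<cdot> num n \<cdot> (Const MinC \<cdot> F \<cdot> (Const SucC \<cdot> num n))"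
| "length Xs = length \<sigma>s \<Longrightarrow>
     apps (Const (ByvalC \<sigma>s \<tau>) \<cdot> F) Xs \<cdot> num n \<leadsto> apps F Xs \<cdot> num n"
| "M \<leadsto> M' \<Longrightarrow> M \<cdot> N \<leadsto> M' \<cdot> N"
| "M \<leadsto> M' \<Longrightarrow> Const SucC \<cdot> M \<leadsto> Const SucC \<cdot> M'"
| "M \<leadsto> M' \<Longrightarrow> Const PreC \<cdot> M \<leadsto> Const PreC \<cdot> M'"
| "M \<leadsto> M' \<Longrightarrow> Const IfzeroC \<cdot> M \<leadsto> Const IfzeroC \<cdot> M'"
| "M \<leadsto> M' \<Longrightarrow> Fst M \<leadsto> Fst M'"
| "M \<leadsto> M' \<Longrightarrow> Snd M \<leadsto> Snd M'"
| "M \<leadsto> M' \<Longrightarrow> Const (RecC \<sigma>) \<cdot> X \<cdot> F \<cdot> M \<leadsto> Const (RecC \<sigma>) \<cdot> X \<cdot> F \<cdot> M'"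
| "M \<leadsto> M' \<Longrightarrow> Const MinC \<cdot> F \<cdot> M \<leadsto> Const MinC \<cdot> F \<cdot> M'"
| "M \<leadsto> M' \<Longrightarrow> length Xs = length \<sigma>s \<Longrightarrow>
     apps (Const (ByvalC \<sigma>s \<tau>) \<cdot> F) Xs \<cdot> M \<leadsto> apps (Const (ByvalC \<sigma>s \<tau>) \<cdot> F) Xs \<cdot> M'"

abbreviation steps :: "tm \<Rightarrow> tm \<Rightarrow> bool"  (infix "\<leadsto>*" 50) where
  "M \<leadsto>* M' \<equiv> step\<^sup>*\<^sup>* M M'"

definition diverges :: "tm \<Rightarrow> bool" where
  "diverges M \<longleftrightarrow> (\<nexists>n. M \<leadsto>* num n)"

datatype ctx =
    Hole
  | CLam ty ctx
  | CAppL ctx tm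
  | CAppR tm ctx
  | CPairL ctx tm
  | CPairR tm ctx
  | CFst ctx
  | CSnd ctx

text \<open>Only closed terms are plugged into contexts, so no index needs adjusting under a binder.\<close>

primrec plug :: "ctx \<Rightarrow> tm \<Rightarrow> tm" where
  "plug Hole M = M"
| "plug (CLam \<sigma> C) M = Lam \<sigma> (plug C M)"
| "plug (CAppL C N) M = plug C M \<cdot> N"
| "plug (CAppR N C) M = N \<cdot> plug C M"
| "plug (CPairL C N) M = Pair (plug C M) N"
| "plug (CPairR N C) M = Pair N (plug C M)"
| "plug (CFst C) M = Fst (plug C M)"
| "plug (CSnd C) M = Snd (plug C M)"

primrec ctx_csts_of :: "ctx \<Rightarrow> cst set" where
  "ctx_csts_of Hole = {}"
| "ctx_csts_of (CLam \<sigma> C) = ctx_csts_of C"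
| "ctx_csts_of (CAppL C N) = ctx_csts_of C \<union> csts_of N"
| "ctx_csts_of (CAppR N C) = csts_of N \<union> ctx_csts_of C"
| "ctx_csts_of (CPairL C N) = ctx_csts_of C \<union> csts_of N"
| "ctx_csts_of (CPairR N C) = csts_of N \<union> ctx_csts_of C"
| "ctx_csts_of (CFst C) = ctx_csts_of C"
| "ctx_csts_of (CSnd C) = ctx_csts_of C"

text \<open>\<open>ctx_typing \<rho> \<Gamma> C \<tau>\<close>: with a hole of type \<open>\<rho>\<close>, the context \<open>C\<close> has type \<open>\<tau>\<close> in \<open>\<Gamma>\<close>.\<close>

inductive ctx_typing :: "ty \<Rightarrow> ty list \<Rightarrow> ctx \<Rightarrow> ty \<Rightarrow> bool" for \<rho> where
  "ctx_typing \<rho> \<Gamma> Hole \<rho>"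
| "ctx_typing \<rho> (\<sigma> # \<Gamma>) C \<tau> \<Longrightarrow> ctx_typing \<rho> \<Gamma> (CLam \<sigma> C) (\<sigma> \<rightarrow> \<tau>)"
| "ctx_typing \<rho> \<Gamma> C (\<sigma> \<rightarrow> \<tau>) \<Longrightarrow> \<Gamma> \<turnstile> N \<Colon> \<sigma> \<Longrightarrow> ctx_typing \<rho> \<Gamma> (CAppL C N) \<tau>"
| "\<Gamma> \<turnstile> N \<Colon> \<sigma> \<rightarrow> \<tau> \<Longrightarrow> ctx_typing \<rho> \<Gamma> C \<sigma> \<Longrightarrow> ctx_typing \<rho> \<Gamma> (CAppR N C) \<tau>"
| "ctx_typing \<rho> \<Gamma> C \<sigma> \<Longrightarrow> \<Gamma> \<turnstile> N \<Colon> \<tau> \<Longrightarrow> ctx_typing \<rho> \<Gamma> (CPairL C N) (\<sigma> \<otimes> \<tau>)"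
| "\<Gamma> \<turnstile> N \<Colon> \<sigma> \<Longrightarrow> ctx_typing \<rho> \<Gamma> C \<tau> \<Longrightarrow> ctx_typing \<rho> \<Gamma> (CPairR N C) (\<sigma> \<otimes> \<tau>)"
| "ctx_typing \<rho> \<Gamma> C (\<sigma> \<otimes> \<tau>) \<Longrightarrow> ctx_typing \<rho> \<Gamma> (CFst C) \<sigma>"
| "ctx_typing \<rho> \<Gamma> C (\<sigma> \<otimes> \<tau>) \<Longrightarrow> ctx_typing \<rho> \<Gamma> (CSnd C) \<tau>"

definition obs_eq :: "tm \<Rightarrow> ty \<Rightarrow> tm \<Rightarrow> bool"  ("_ \<simeq>\<^bsub>_\<^esub> _" [51, 0, 51] 50) where
  "M \<simeq>\<^bsub>\<sigma>\<^esub> M' \<longleftrightarrow>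
     closed_term lang_PCF_byval M \<sigma> \<and> closed_term lang_PCF_byval M' \<sigma> \<and>
     (\<forall>C n. ctx_typing \<sigma> [] C Nat\<^sub>t \<and> ctx_csts_of C \<subseteq> lang_PCF_byval \<longrightarrow>
        (plug C M \<leadsto>* num n \<longleftrightarrow> plug C M' \<leadsto>* num n))"

text \<open>The terms substituted for constants below are closed, so they are inserted under binders
  without index adjustment.\<close>

primrec replace_csts :: "(cst \<Rightarrow> tm) \<Rightarrow> tm \<Rightarrow> tm" where
  "replace_csts \<theta> (Var i) = Var i"
| "replace_csts \<theta> (Const c) = \<theta> c"
| "replace_csts \<theta> (Lam \<sigma> M) = Lam \<sigma> (replace_csts \<theta> M)"
| "replace_csts \<theta> (M \<cdot> N) = replace_csts \<theta> M \<cdot> replace_csts \<theta> N"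
| "replace_csts \<theta> (Pair M N) = Pair (replace_csts \<theta> M) (replace_csts \<theta> N)"
| "replace_csts \<theta> (Fst M) = Fst (replace_csts \<theta> M)"
| "replace_csts \<theta> (Snd M) = Snd (replace_csts \<theta> M)"

text \<open>While is \<open>\<lambda>c x f. Y (\<lambda>w x'. ifzero (c x') (w (f x')) x') x\<close>;
  in the inner body \<open>x', w, f, x, c\<close> are the indices 0 to 4.\<close>

definition While_prog :: "ty \<Rightarrow> tm" where
  "While_prog \<sigma> =
     Lam (\<sigma> \<rightarrow> Nat\<^sub>t) (Lam \<sigma> (Lam (\<sigma> \<rightarrow> \<sigma>)
       (Const (YC (\<sigma> \<rightarrow> \<sigma>)) \<cdot>
          Lam (\<sigma> \<rightarrow> \<sigma>) (Lam \<sigma>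
            (ifzero \<sigma> \<cdot> (Var 4 \<cdot> Var 0) \<cdot> (Var 1 \<cdot> (Var 2 \<cdot> Var 0)) \<cdot> Var 0)) \<cdot>
        Var 1)))"

abbreviation byval_plus :: "ty \<Rightarrow> tm" where
  "byval_plus \<sigma> \<equiv> Const (ByvalC [\<sigma>, \<sigma> \<rightarrow> Nat\<^sub>t \<rightarrow> \<sigma>] \<sigma>)"

text \<open>Rec is \<open>byval\<^sup>+ (Y (\<lambda>r x f n. ifzero n x (byval\<^sup>\<epsilon> (\<lambda>n'. f (byval\<^sup>+ r x f n') n') (pre n))))\<close>;
  under \<open>n\<close>, the variables \<open>n, f, x, r\<close> are 0 to 3; under \<open>n'\<close>, \<open>n', n, f, x, r\<close> are 0 to 4.\<close>

definition Rec_prog :: "ty \<Rightarrow> tm" where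
  "Rec_prog \<sigma> =
     byval_plus \<sigma> \<cdot> (Const (YC (ty_of_rec \<sigma>)) \<cdot>
       Lam (ty_of_rec \<sigma>)
         (Lam \<sigma> (Lam (\<sigma> \<rightarrow> Nat\<^sub>t \<rightarrow> \<sigma>) (Lam Nat\<^sub>t
           (ifzero \<sigma> \<cdot> Var 0 \<cdot> Var 2 \<cdot>
             (Const (ByvalC [] \<sigma>) \<cdot>
                Lam Nat\<^sub>t
                  (Var 2 \<cdot> (byval_plus \<sigma> \<cdot> Var 4 \<cdot> Var 3 \<cdot> Var 2 \<cdot> Var 0) \<cdot> Var 0) \<cdot>
              (Const PreC \<cdot> Var 0)))))))"

text \<open>Min is \<open>byval (Y (\<lambda>m f n. ifzero (f n) n (byval m f (suc n))))\<close>;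
  \<open>n, f, m\<close> are 0 to 2.\<close>

definition Min_prog :: tm where
  "Min_prog =
     Const (ByvalC [Nat\<^sub>t \<rightarrow> Nat\<^sub>t] Nat\<^sub>t) \<cdot> (Const (YC ty_of_min) \<cdot>
       Lam ty_of_min (Lam (Nat\<^sub>t \<rightarrow> Nat\<^sub>t) (Lam Nat\<^sub>t
         (Const IfzeroC \<cdot> (Var 1 \<cdot> Var 0) \<cdot> Var 0 \<cdot>
           (Const (ByvalC [Nat\<^sub>t \<rightarrow> Nat\<^sub>t] Nat\<^sub>t) \<cdot> Var 2 \<cdot> Var 1 \<cdot> (Const SucC \<cdot> Var 0))))))"

fun circ_cst :: "cst \<Rightarrow> tm" where
  "circ_cst (WhileC \<sigma>) = While_prog \<sigma>"
| "circ_cst (RecC \<sigma>) = Rec_prog \<sigma>"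
| "circ_cst MinC = Min_prog"
| "circ_cst c = Const c"

definition circ :: "tm \<Rightarrow> tm"  ("_\<^sup>\<circ>" [1000] 999) where
  "M\<^sup>\<circ> = replace_csts circ_cst M"

text \<open>\<open>Rec' = \<lambda>x f n. snd (while (\<lambda>p. fst p \<noteq> n) \<langle>0, x\<rangle> (\<lambda>p. \<langle>suc (fst p), f (snd p) (fst p)\<rangle>))\<close>,
  after expanding the pair patterns, and \<open>Min' = \<lambda>f n. while (\<lambda>n'. f n' \<noteq> 0) n suc\<close>. The
  inequality program \<open>neq\<close> is a parameter; being closed, it is not lifted under binders.\<close>

definition Rec'_prog :: "tm \<Rightarrow> ty \<Rightarrow> tm" where
  "Rec'_prog neq \<sigma> =
     Lam \<sigma> (Lam (\<sigma> \<rightarrow> Nat\<^sub>t \<rightarrow> \<sigma>) (Lam Nat\<^sub>t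
       (Snd (Const (WhileC (Nat\<^sub>t \<otimes> \<sigma>)) \<cdot>
               Lam (Nat\<^sub>t \<otimes> \<sigma>) (neq \<cdot> Fst (Var 0) \<cdot> Var 1) \<cdot>
               Pair (num 0) (Var 2) \<cdot>
               Lam (Nat\<^sub>t \<otimes> \<sigma>)
                 (Pair (Const SucC \<cdot> Fst (Var 0)) (Var 2 \<cdot> Snd (Var 0) \<cdot> Fst (Var 0)))))))"

definition Min'_prog :: "tm \<Rightarrow> tm" where
  "Min'_prog neq =
     Lam (Nat\<^sub>t \<rightarrow> Nat\<^sub>t) (Lam Nat\<^sub>t
       (Const (WhileC Nat\<^sub>t) \<cdot>
          Lam Nat\<^sub>t (neq \<cdot> (Var 2 \<cdot> Var 0) \<cdot> num 0) \<cdot>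
          Var 0 \<cdot>
          Const SucC))"

fun dagger_cst :: "tm \<Rightarrow> cst \<Rightarrow> tm" where
  "dagger_cst neq (RecC \<sigma>) = Rec'_prog neq \<sigma>"
| "dagger_cst neq MinC = Min'_prog neq"
| "dagger_cst neq c = Const c"

definition dagger :: "tm \<Rightarrow> tm \<Rightarrow> tm" where
  "dagger neq M = replace_csts (dagger_cst neq) M"

text \<open>The numeral 0 stands for "true".\<close>

definition implements_neq :: "cst set \<Rightarrow> tm \<Rightarrow> bool" where
  "implements_neq L P \<longleftrightarrow>
     (\<forall>M N. closed_term L M Nat\<^sub>t \<and> closed_term L N Nat\<^sub>t \<longrightarrow>
        (\<forall>m n. M \<leadsto>* num m \<and> N \<leadsto>* num n \<longrightarrow>
           (m \<noteq> n \<longrightarrow> P \<cdot> M \<cdot> N \<leadsto>* num 0) \<and>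
           (m = n \<longrightarrow> (\<exists>k. k \<noteq> 0 \<and> P \<cdot> M \<cdot> N \<leadsto>* num k))) \<and>
        (diverges M \<or> diverges N \<longrightarrow> diverges (P \<cdot> M \<cdot> N)))"

end

theory Submission imports Defs begin

text \<open>
  All constants of the languages are treated together. Approximation is the logical relation
  that at type \<open>N\<close> compares values, indexed by the number of reduction steps allowed on the left;
  the index makes the unbounded constants \<open>Y\<close>, \<open>while\<close> and \<open>min\<close> respect it by a plain induction,
  so every term approximates itself. The induced equivalence is then a congruence that is
  extensional, contains reduction, identifies any two terms that are strict in a diverging
  numeric argument, and implies observational equivalence. It remains to check on closed arguments that
  each program for \<open>while\<close>, \<open>rec\<close> or \<open>min\<close> is equivalent to the constant itself: when the numeric
  argument converges it may be replaced by its value, and otherwise both sides are bottom. Hence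
  \<open>M\<^sup>\<dagger>\<close>, \<open>M\<^sup>\<circ>\<close> and \<open>M\<close> are all equivalent.
\<close>

text \<open>The obstacle is call-by-name. A \<open>while\<close> loop hands on its state
  unevaluated, whereas \<open>rec\<close>, \<open>min\<close> and \<open>byval\<close> force their
  number. The test of \<open>Min'\<close> can thus converge on a diverging state; this does no harm
  only because the loop then either runs forever or ends by returning that state. The state of
  \<open>Rec'\<close> need not literally be a pair of values, so its invariant holds up to
  equivalence, not up to reduction. One reduction step on the left pays for lowering the index by
  one. Therefore the lemmas that compare two loops demand a genuine first step on the left but only
  some reduction on the right. The right side carries no count, so an indexed approximation is
  composed with one that holds at every index. The relation ranges over closed terms built from all
  constants, which puts a constant and its program into one system. In return the hypothesis on the
  inequality program, which speaks of \<open>W\<close> terms, has to reach all closed terms; it does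
  because each of them is, at type \<open>Nat\<^sub>t\<close>, equivalent to a numeral or to one
  fixed diverging \<open>W\<close> term.\<close>

subsection \<open>Typing and closed terms\<close>

text \<open>Abstractions carry their type, so typing is syntax-directed and types are unique. As a
  function it lets \<open>simp\<close> type the concrete programs by evaluation.\<close>

fun infer :: "ty list \<Rightarrow> tm \<Rightarrow> ty option" where
  "infer \<Gamma> (Var i) = (if i < length \<Gamma> then Some (\<Gamma> ! i) else None)"
| "infer \<Gamma> (Const c) = Some (cst_ty c)"
| "infer \<Gamma> (Lam \<sigma> M) = (case infer (\<sigma> # \<Gamma>) M of Some \<tau> \<Rightarrow> Some (\<sigma> \<rightarrow> \<tau>) | None \<Rightarrow> None)"
| "infer \<Gamma> (M \<cdot> N) = (case infer \<Gamma> M of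
     Some (\<sigma> \<rightarrow> \<tau>) \<Rightarrow> (if infer \<Gamma> N = Some \<sigma> then Some \<tau> else None) | _ \<Rightarrow> None)"
| "infer \<Gamma> (Pair M N) = (case infer \<Gamma> M of
     Some \<sigma> \<Rightarrow> (case infer \<Gamma> N of Some \<tau> \<Rightarrow> Some (\<sigma> \<otimes> \<tau>) | None \<Rightarrow> None) | None \<Rightarrow> None)"
| "infer \<Gamma> (Fst M) = (case infer \<Gamma> M of Some (\<sigma> \<otimes> \<tau>) \<Rightarrow> Some \<sigma> | _ \<Rightarrow> None)"
| "infer \<Gamma> (Snd M) = (case infer \<Gamma> M of Some (\<sigma> \<otimes> \<tau>) \<Rightarrow> Some \<tau> | _ \<Rightarrow> None)"

lemma infer_sound: "infer \<Gamma> M = Some \<tau> \<Longrightarrow> \<Gamma> \<turnstile> M \<Colon> \<tau>"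
  by (induction \<Gamma> M arbitrary: \<tau> rule: infer.induct)
     (auto intro: typing.intros split: option.splits ty.splits if_splits)

lemma typing_iff_infer: "\<Gamma> \<turnstile> M \<Colon> \<tau> \<longleftrightarrow> infer \<Gamma> M = Some \<tau>"
proof
  show "infer \<Gamma> M = Some \<tau>" if "\<Gamma> \<turnstile> M \<Colon> \<tau>"
    using that by induction auto
qed (rule infer_sound)

lemma typing_unique: "\<Gamma> \<turnstile> M \<Colon> \<sigma> \<Longrightarrow> \<Gamma> \<turnstile> M \<Colon> \<tau> \<Longrightarrow> \<sigma> = \<tau>"
  by (simp add: typing_iff_infer)

inductive_cases typing_VarE: "\<Gamma> \<turnstile> Var i \<Colon> \<tau>"
inductive_cases typing_ConstE: "\<Gamma> \<turnstile> Const c \<Colon> \<tau>"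
inductive_cases typing_LamE: "\<Gamma> \<turnstile> Lam \<sigma> M \<Colon> \<tau>"
inductive_cases typing_AppE: "\<Gamma> \<turnstile> M \<cdot> N \<Colon> \<tau>"
inductive_cases typing_PairE: "\<Gamma> \<turnstile> Pair M N \<Colon> \<tau>"
inductive_cases typing_FstE: "\<Gamma> \<turnstile> Fst M \<Colon> \<tau>"
inductive_cases typing_SndE: "\<Gamma> \<turnstile> Snd M \<Colon> \<tau>"
lemmas typing_elims = typing_VarE typing_ConstE typing_LamE typing_AppE typing_PairE
  typing_FstE typing_SndE

lemmas typing_App = typing.intros(4)
lemmas typing_Pair = typing.intros(5)
lemmas typing_Fst = typing.intros(6)
lemmas typing_Snd = typing.intros(7)

text \<open>The extra entries go to the outer end of the context, where they shift no index.\<close>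

lemma typing_append: "\<Gamma> \<turnstile> M \<Colon> \<tau> \<Longrightarrow> \<Gamma> @ \<Delta> \<turnstile> M \<Colon> \<tau>"
proof (induction rule: typing.induct)
  case (1 i \<Gamma>)
  then show ?case by (simp add: typing_iff_infer nth_append)
qed (auto intro: typing.intros)

lemma typing_weaken: "[] \<turnstile> M \<Colon> \<tau> \<Longrightarrow> \<Gamma> \<turnstile> M \<Colon> \<tau>"
  using typing_append[of "[]" M \<tau> \<Gamma>] by simp

lemma infer_closed: "[] \<turnstile> M \<Colon> \<tau> \<Longrightarrow> infer \<Gamma> M = Some \<tau>"
  using typing_weaken by (simp flip: typing_iff_infer)

text \<open>Typability in the empty context, not mere absence of free indices, so that every typing
  fact yields closedness through \<open>closedI\<close>; on such terms \<open>lift\<close> and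
  \<open>subst\<close> act as the identity.\<close>

definition closed :: "tm \<Rightarrow> bool" where
  "closed M \<longleftrightarrow> (\<exists>\<tau>. [] \<turnstile> M \<Colon> \<tau>)"

lemma closedI: "[] \<turnstile> M \<Colon> \<tau> \<Longrightarrow> closed M"
  by (auto simp: closed_def)

lemma lift_scoped: "\<Gamma> \<turnstile> M \<Colon> \<tau> \<Longrightarrow> length \<Gamma> \<le> k \<Longrightarrow> lift M k = M"
  by (induction arbitrary: k rule: typing.induct) auto

lemma subst_scoped: "\<Gamma> \<turnstile> M \<Colon> \<tau> \<Longrightarrow> length \<Gamma> \<le> k \<Longrightarrow> subst M N k = M"
  by (induction arbitrary: k N rule: typing.induct) auto

lemma lift_closed [simp]: "closed M \<Longrightarrow> lift M k = M"
  by (auto simp: closed_def lift_scoped)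

lemma subst_closed [simp]: "closed M \<Longrightarrow> subst M N k = M"
  by (auto simp: closed_def subst_scoped)

text \<open>The replaced variable is the outermost one, so no index above it has to be lowered; only
  the prefix \<open>\<Gamma>\<close> grows under binders.\<close>

lemma typing_subst:
  assumes "[] \<turnstile> N \<Colon> \<sigma>"
  shows "\<Gamma> @ [\<sigma>] \<turnstile> M \<Colon> \<tau> \<Longrightarrow> \<Gamma> \<turnstile> subst M N (length \<Gamma>) \<Colon> \<tau>"
proof (induction "\<Gamma> @ [\<sigma>]" M \<tau> arbitrary: \<Gamma> rule: typing.induct)
  case (1 i)
  then consider "i < length \<Gamma>" | "i = length \<Gamma>"
    by fastforce
  then show ?case
    by cases (simp_all add: nth_append typing_weaken[OF assms], simp add: typing_iff_infer)
next
  case (2 c)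
  show ?case by (simp add: typing.intros)
next
  case (3 \<rho> M \<tau>)
  show ?case using 3(2)[of "\<rho> # \<Gamma>"] by (simp add: typing.intros closedI[OF assms])
next
  case (4 M \<rho> \<tau> N)
  show ?case using typing_App[OF 4(2,4)] by simp
next
  case (5 M \<rho> N \<tau>)
  show ?case using typing_Pair[OF 5(2,4)] by simp
next
  case (6 M \<rho> \<tau>)
  show ?case using typing_Fst[OF 6(2)] by simp
next
  case (7 M \<rho> \<tau>)
  show ?case using typing_Snd[OF 7(2)] by simp
qed

text \<open>Only closed terms are substituted, so they are not lifted under binders.\<close>

primrec close :: "tm list \<Rightarrow> nat \<Rightarrow> tm \<Rightarrow> tm" where
  "close Vs k (Var i) =
     (if i < k then Var i else if i < k + length Vs then Vs ! (i - k) else Var (i - length Vs))"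
| "close Vs k (Const c) = Const c"
| "close Vs k (Lam \<sigma> M) = Lam \<sigma> (close Vs (k + 1) M)"
| "close Vs k (M \<cdot> N) = close Vs k M \<cdot> close Vs k N"
| "close Vs k (Pair M N) = Pair (close Vs k M) (close Vs k N)"
| "close Vs k (Fst M) = Fst (close Vs k M)"
| "close Vs k (Snd M) = Snd (close Vs k M)"

lemma close_Nil [simp]: "close [] k M = M"
  by (induction M arbitrary: k) auto

lemma close_scoped: "\<Gamma> \<turnstile> M \<Colon> \<tau> \<Longrightarrow> length \<Gamma> \<le> k \<Longrightarrow> close Vs k M = M"
  by (induction arbitrary: k rule: typing.induct) auto

lemma close_closed [simp]: "closed M \<Longrightarrow> close Vs k M = M"
  by (auto simp: closed_def close_scoped)

text \<open>Links a beta step to simultaneous substitution: the argument joins the front of the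
  environment. The entries of \<open>Vs\<close> must be closed, or the second substitution would act
  inside them.\<close>

lemma subst_close:
  assumes "closed N" "\<forall>V \<in> set Vs. closed V"
  shows "subst (close Vs (Suc k) M) N k = close (N # Vs) k M"
proof (induction M arbitrary: k)
  case (Var i)
  consider "i < k" | "i = k" | "i > k" "i < Suc k + length Vs" | "i \<ge> Suc k + length Vs"
    by linarith
  then show ?case
  proof cases
    case 3
    then have "Vs ! (i - Suc k) \<in> set Vs" by simp
    then have "closed (Vs ! (i - Suc k))" using assms(2) by blast
    moreover have "(N # Vs) ! (i - k) = Vs ! (i - Suc k)"
      using 3 by (simp add: nth_Cons')
    ultimately show ?thesis using 3 by simp
  next
    case 4
    then show ?thesis by auto
  qed (auto simp: assms)
qed (auto simp: assms)

lemma typing_close: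
  assumes "list_all2 (\<lambda>V \<sigma>. [] \<turnstile> V \<Colon> \<sigma>) Vs \<Gamma>"
  shows "\<Delta> @ \<Gamma> \<turnstile> M \<Colon> \<tau> \<Longrightarrow> \<Delta> \<turnstile> close Vs (length \<Delta>) M \<Colon> \<tau>"
proof (induction "\<Delta> @ \<Gamma>" M \<tau> arbitrary: \<Delta> rule: typing.induct)
  case (1 i)
  show ?case
  proof (cases "i < length \<Delta>")
    case True
    then show ?thesis by (simp add: nth_append typing_iff_infer)
  next
    case False
    then have i: "i - length \<Delta> < length Vs" "i < length \<Delta> + length Vs"
      using 1 list_all2_lengthD[OF assms] by auto
    then have "[] \<turnstile> Vs ! (i - length \<Delta>) \<Colon> \<Gamma> ! (i - length \<Delta>)"
      using list_all2_nthD[OF assms] by simp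
    then show ?thesis
      using False i by (simp add: nth_append typing_weaken)
  qed
next
  case (2 c)
  show ?case by (simp add: typing.intros)
next
  case (3 \<sigma> M \<tau>)
  show ?case using 3(2)[of "\<sigma> # \<Delta>"] by (simp add: typing.intros)
next
  case (4 M \<sigma> \<tau> N)
  show ?case using typing_App[OF 4(2,4)] by simp
next
  case (5 M \<sigma> N \<tau>)
  show ?case using typing_Pair[OF 5(2,4)] by simp
next
  case (6 M \<sigma> \<tau>)
  show ?case using typing_Fst[OF 6(2)] by simp
next
  case (7 M \<sigma> \<tau>)
  show ?case using typing_Snd[OF 7(2)] by simp
qed

subsection \<open>Applicative spines\<close>

lemma apps_Nil [simp]: "apps M [] = M"
  and apps_Cons [simp]: "apps M (N # Ns) = apps (M \<cdot> N) Ns"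
  and apps_snoc: "apps M (Ns @ [N]) = apps M Ns \<cdot> N"
  by (simp_all add: apps_def)

lemma funs_Nil [simp]: "funs [] \<tau> = \<tau>"
  and funs_Cons [simp]: "funs (\<sigma> # \<sigma>s) \<tau> = \<sigma> \<rightarrow> funs \<sigma>s \<tau>"
  by (simp_all add: funs_def)

text \<open>Equal lengths make the split unique even though \<open>\<tau>\<close> may itself be an
  arrow. This is how the type of the last argument of \<open>byval\<close> is found.\<close>

lemma funs_inject:
  "length \<sigma>s = length \<rho>s \<Longrightarrow> funs \<sigma>s \<tau> = funs \<rho>s \<rho> \<longleftrightarrow> \<sigma>s = \<rho>s \<and> \<tau> = \<rho>"
  by (induction \<sigma>s \<rho>s rule: list_induct2) auto

lemma typing_apps:
  "\<Gamma> \<turnstile> apps M Ns \<Colon> \<tau> \<longleftrightarrow> (\<exists>\<sigma>s. \<Gamma> \<turnstile> M \<Colon> funs \<sigma>s \<tau> \<and> list_all2 (typing \<Gamma>) Ns \<sigma>s)"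
proof (induction Ns arbitrary: M)
  case (Cons N Ns)
  show ?case
  proof
    assume "\<Gamma> \<turnstile> apps M (N # Ns) \<Colon> \<tau>"
    then obtain \<sigma>s where "\<Gamma> \<turnstile> M \<cdot> N \<Colon> funs \<sigma>s \<tau>" "list_all2 (typing \<Gamma>) Ns \<sigma>s"
      using Cons by auto
    then show "\<exists>\<sigma>s. \<Gamma> \<turnstile> M \<Colon> funs \<sigma>s \<tau> \<and> list_all2 (typing \<Gamma>) (N # Ns) \<sigma>s"
      by (elim typing_AppE) (metis funs_Cons list.rel_intros(2))
  next
    assume "\<exists>\<sigma>s. \<Gamma> \<turnstile> M \<Colon> funs \<sigma>s \<tau> \<and> list_all2 (typing \<Gamma>) (N # Ns) \<sigma>s"
    then obtain \<sigma> \<sigma>s where "\<Gamma> \<turnstile> M \<Colon> \<sigma> \<rightarrow> funs \<sigma>s \<tau>" "\<Gamma> \<turnstile> N \<Colon> \<sigma>" "list_all2 (typing \<Gamma>) Ns \<sigma>s"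
      by (auto simp: list_all2_Cons1)
    then show "\<Gamma> \<turnstile> apps M (N # Ns) \<Colon> \<tau>"
      using Cons by (auto intro: typing_App)
  qed
qed auto

text \<open>Since \<open>byval\<close> takes a list of arguments, its redexes match no constructor
  pattern; head and argument list tell them apart instead.\<close>

fun spine :: "tm \<Rightarrow> tm \<times> tm list" where
  "spine (M \<cdot> N) = (fst (spine M), snd (spine M) @ [N])"
| "spine M = (M, [])"

lemma spine_apps [simp]: "spine (apps M Ns) = (fst (spine M), snd (spine M) @ Ns)"
  by (induction Ns arbitrary: M) auto

text \<open>How many arguments a constant needs before its rule can fire. \<open>IfzeroC\<close>
  needs only the test because its reduct is an abstraction; \<open>byval\<close> adds its function
  and the forced number to the list.\<close>

primrec arity :: "cst \<Rightarrow> nat" where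
  "arity (Num n) = 0"
| "arity SucC = 1"
| "arity PreC = 1"
| "arity IfzeroC = 1"
| "arity (YC \<sigma>) = 1"
| "arity (WhileC \<sigma>) = 3"
| "arity (RecC \<sigma>) = 3"
| "arity MinC = 2"
| "arity (ByvalC \<sigma>s \<tau>) = length \<sigma>s + 2"

subsection \<open>Reduction\<close>

lemmas step_FstPair = step.intros(1)
lemmas step_SndPair = step.intros(2)
lemmas step_beta = step.intros(3)
lemmas step_Suc = step.intros(4)
lemmas step_Pre_Suc = step.intros(5)
lemmas step_Pre_0 = step.intros(6)
lemmas step_Ifzero_0 = step.intros(7)
lemmas step_Ifzero_Suc = step.intros(8)
lemmas step_Y = step.intros(9)
lemmas step_While = step.intros(10)
lemmas step_Rec_0 = step.intros(11)
lemmas step_Rec_Suc = step.intros(12)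
lemmas step_Min = step.intros(13)
lemmas step_Byval = step.intros(14)
lemmas step_AppL = step.intros(15)
lemmas step_Fst = step.intros(19)
lemmas step_Snd = step.intros(20)

text \<open>A rule for a constant needs all its arguments, and congruence on the function position
  only adds arguments. Hence partial applications are normal, which keeps that congruence from
  competing with the rule of the constant.\<close>

lemma spine_step_saturated:
  "M \<leadsto> M' \<Longrightarrow> fst (spine M) = Const c \<Longrightarrow> arity c \<le> length (snd (spine M))"
  by (induction rule: step.induct) auto

lemma Byval_partial_normal:
  "length Xs \<le> length \<sigma>s \<Longrightarrow> \<not> apps (Const (ByvalC \<sigma>s \<tau>) \<cdot> F) Xs \<leadsto> M"
  using spine_step_saturated[of "apps (Const (ByvalC \<sigma>s \<tau>) \<cdot> F) Xs" M "ByvalC \<sigma>s \<tau>"] by auto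

lemma apps_Byval_inject:
  assumes "apps (Const (ByvalC \<sigma>s \<tau>) \<cdot> F) Xs = apps (Const (ByvalC \<sigma>s' \<tau>') \<cdot> F') Xs'"
  shows "\<sigma>s = \<sigma>s'" "\<tau> = \<tau>'" "F = F'" "Xs = Xs'"
  using arg_cong[OF assms, of spine] by auto

lemma apps_Byval_neq [simp]:
  assumes "fst (spine M) \<noteq> Const (ByvalC \<sigma>s \<tau>)"
  shows "apps (Const (ByvalC \<sigma>s \<tau>) \<cdot> F) Xs \<noteq> M" "M \<noteq> apps (Const (ByvalC \<sigma>s \<tau>) \<cdot> F) Xs"
  using assms by force+

inductive_cases step_ConstE: "Const c \<leadsto> M"
inductive_cases step_LamE: "Lam \<sigma> M \<leadsto> M'"
inductive_cases step_PairE: "Pair M N \<leadsto> M'"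
inductive_cases step_FstE: "Fst M \<leadsto> M'"
inductive_cases step_SndE: "Snd M \<leadsto> M'"
inductive_cases step_AppE: "M \<cdot> N \<leadsto> M'"

lemma Const_partial_normal: "length Ns < arity c \<Longrightarrow> \<not> apps (Const c) Ns \<leadsto> M"
  using spine_step_saturated[of "apps (Const c) Ns" M c] by auto

lemma partial_normal [simp]:
  "\<not> Const c \<leadsto> M" "\<not> Lam \<sigma> N \<leadsto> M" "\<not> Pair N N' \<leadsto> M"
  "\<not> Const (WhileC \<sigma>) \<cdot> C \<leadsto> M" "\<not> Const (WhileC \<sigma>) \<cdot> C \<cdot> X \<leadsto> M"
  "\<not> Const (RecC \<sigma>) \<cdot> X \<leadsto> M" "\<not> Const (RecC \<sigma>) \<cdot> X \<cdot> F \<leadsto> M" "\<not> Const MinC \<cdot> F \<leadsto> M"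
  using Const_partial_normal[of "[C]" "WhileC \<sigma>" M] Const_partial_normal[of "[C, X]" "WhileC \<sigma>" M]
    Const_partial_normal[of "[X]" "RecC \<sigma>" M] Const_partial_normal[of "[X, F]" "RecC \<sigma>" M]
    Const_partial_normal[of "[F]" "MinC" M]
  by (auto elim: step_ConstE step_LamE step_PairE)

text \<open>Inversion leaves at most one rule alive: the function part of a redex is a partial
  application or an abstraction and cannot step, forced numerals and pairs cannot step, and
  overlapping \<open>byval\<close> rules agree by their spines.\<close>

lemma step_deterministic: "M \<leadsto> M1 \<Longrightarrow> M \<leadsto> M2 \<Longrightarrow> M1 = M2"
proof (induction arbitrary: M2 rule: step.induct)
  case (1 M N)
  then show ?case by (rule step_FstE) simp_all
next
  case (2 M N)
  then show ?case by (rule step_SndE) simp_all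
next
  case (3 \<sigma> M N)
  then show ?case by (rule step_AppE) simp_all
next
  case (4 n)
  then show ?case by (rule step_AppE) simp_all
next
  case (5 n)
  then show ?case by (rule step_AppE) simp_all
next
  case 6
  then show ?case by (rule step_AppE) simp_all
next
  case 7
  then show ?case by (rule step_AppE) simp_all
next
  case (8 n)
  then show ?case by (rule step_AppE) simp_all
next
  case (9 \<sigma> F)
  then show ?case by (rule step_AppE) simp_all
next
  case (10 \<sigma> C X F)
  then show ?case by (rule step_AppE) simp_all
next
  case (11 \<sigma> X F)
  then show ?case by (rule step_AppE) simp_all
next
  case (12 \<sigma> X F n)
  then show ?case by (rule step_AppE) simp_all
next
  case (13 F n)
  then show ?case by (rule step_AppE) simp_all
next
  case (14 Xs \<sigma>s \<tau> F n)
  from 14(2) show ?case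
    by (rule step_AppE)
       (use 14(1) in \<open>simp_all add: Byval_partial_normal, (metis apps_Byval_inject)?\<close>)
next
  case (15 M M' N)
  show ?case
    by (rule step_AppE[OF 15(3)])
       (use 15(1) in \<open>simp_all add: Byval_partial_normal, metis 15(2)\<close>)
next
  case (16 M M' )
  show ?case
    by (rule step_AppE[OF 16(3)]) (use 16(1) in \<open>simp_all, (metis 16(2))?\<close>)
next
  case (17 M M')
  show ?case
    by (rule step_AppE[OF 17(3)]) (use 17(1) in \<open>simp_all, (metis 17(2))?\<close>)
next
  case (18 M M')
  show ?case
    by (rule step_AppE[OF 18(3)]) (use 18(1) in \<open>simp_all, (metis 18(2))?\<close>)
next
  case (19 M M')
  show ?case
    by (rule step_FstE[OF 19(3)]) (use 19(1) in \<open>simp_all, (metis 19(2))?\<close>)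
next
  case (20 M M')
  show ?case
    by (rule step_SndE[OF 20(3)]) (use 20(1) in \<open>simp_all, (metis 20(2))?\<close>)
next
  case (21 M M' \<sigma> X F)
  show ?case
    by (rule step_AppE[OF 21(3)]) (use 21(1) in \<open>simp_all, (metis 21(2))?\<close>)
next
  case (22 M M' F)
  show ?case
    by (rule step_AppE[OF 22(3)]) (use 22(1) in \<open>simp_all, (metis 22(2))?\<close>)
next
  case (23 M M' Xs \<sigma>s \<tau> F)
  show ?case
  proof (rule step_AppE[OF 23(4)])
    fix \<sigma>s' \<tau>' F' Xs' M''
    assume "apps (Const (ByvalC \<sigma>s \<tau>) \<cdot> F) Xs = apps (Const (ByvalC \<sigma>s' \<tau>') \<cdot> F') Xs'"
      and "M2 = apps (Const (ByvalC \<sigma>s' \<tau>') \<cdot> F') Xs' \<cdot> M''" and "M \<leadsto> M''"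
    then show ?thesis using 23(3) by simp
  qed (use 23(1,2) in \<open>simp_all add: Byval_partial_normal\<close>)
qed

section \<open>Subject reduction\<close>

lemma typing_simps:
  "\<Gamma> \<turnstile> Const c \<Colon> \<tau> \<longleftrightarrow> \<tau> = cst_ty c"
  "\<Gamma> \<turnstile> Lam \<sigma> M \<Colon> \<tau> \<longleftrightarrow> (\<exists>\<rho>. \<tau> = \<sigma> \<rightarrow> \<rho> \<and> \<sigma> # \<Gamma> \<turnstile> M \<Colon> \<rho>)"
  "\<Gamma> \<turnstile> M \<cdot> N \<Colon> \<tau> \<longleftrightarrow> (\<exists>\<sigma>. \<Gamma> \<turnstile> M \<Colon> \<sigma> \<rightarrow> \<tau> \<and> \<Gamma> \<turnstile> N \<Colon> \<sigma>)"
  "\<Gamma> \<turnstile> Pair M N \<Colon> \<tau> \<longleftrightarrow> (\<exists>\<sigma> \<rho>. \<tau> = \<sigma> \<otimes> \<rho> \<and> \<Gamma> \<turnstile> M \<Colon> \<sigma> \<and> \<Gamma> \<turnstile> N \<Colon> \<rho>)"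
  "\<Gamma> \<turnstile> Fst M \<Colon> \<tau> \<longleftrightarrow> (\<exists>\<rho>. \<Gamma> \<turnstile> M \<Colon> \<tau> \<otimes> \<rho>)"
  "\<Gamma> \<turnstile> Snd M \<Colon> \<tau> \<longleftrightarrow> (\<exists>\<rho>. \<Gamma> \<turnstile> M \<Colon> \<rho> \<otimes> \<tau>)"
  by (blast elim: typing_elims intro: typing.intros | (auto elim: typing_elims; fail))+

lemma infer_ifzero [simp]: "infer \<Gamma> (ifzero \<sigma>) = Some (Nat\<^sub>t \<rightarrow> \<sigma> \<rightarrow> \<sigma> \<rightarrow> \<sigma>)"
  by (induction \<sigma> arbitrary: \<Gamma>) (simp_all add: numeral_3_eq_3 numeral_2_eq_2)

lemma typing_ifzero: "\<Gamma> \<turnstile> ifzero \<sigma> \<Colon> Nat\<^sub>t \<rightarrow> \<sigma> \<rightarrow> \<sigma> \<rightarrow> \<sigma>"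
  by (simp add: typing_iff_infer)

lemma closed_ifzero [simp]: "closed (ifzero \<sigma>)"
  using typing_ifzero by (rule closedI)

lemma preservation: "M \<leadsto> M' \<Longrightarrow> [] \<turnstile> M \<Colon> \<tau> \<Longrightarrow> [] \<turnstile> M' \<Colon> \<tau>"
proof (induction arbitrary: \<tau> rule: step.induct)
  case (3 \<sigma> M N)
  then show ?case
    using typing_subst[of N \<sigma> "[]" M \<tau>] by (auto simp: typing_simps)
next
  case (7)
  then show ?case by (simp add: typing_iff_infer)
next
  case (8 n)
  then show ?case by (simp add: typing_iff_infer)
next
  case (10 \<sigma> C X F)
  then show ?case
    by (simp add: typing_iff_infer split: option.splits ty.splits if_splits)
next
  case (14 Xs \<sigma>s \<tau>' F n)
  then obtain \<rho>s where "[] \<turnstile> F \<Colon> funs \<sigma>s (Nat\<^sub>t \<rightarrow> \<tau>')" "funs \<rho>s (Nat\<^sub>t \<rightarrow> \<tau>) = funs \<sigma>s (Nat\<^sub>t \<rightarrow> \<tau>')"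
    "list_all2 (typing []) Xs \<rho>s"
    by (auto simp: typing_simps typing_apps)
  then show ?case
    using 14(1) by (auto simp: typing_simps typing_apps funs_inject list_all2_lengthD)
next
  case (23 M M' Xs \<sigma>s \<tau>' F)
  then show ?case by (auto simp: typing_simps(3))
qed (auto simp: typing_simps)

lemma preservation_steps: "M \<leadsto>* M' \<Longrightarrow> [] \<turnstile> M \<Colon> \<tau> \<Longrightarrow> [] \<turnstile> M' \<Colon> \<tau>"
  by (induction rule: rtranclp_induct) (auto intro: preservation)

section \<open>Progress\<close>

lemma funs_function_prefix:
  "funs \<sigma>s \<tau> = funs \<rho>s (\<alpha> \<rightarrow> \<beta>) \<Longrightarrow> length \<sigma>s \<le> length \<rho>s \<Longrightarrow> \<exists>\<alpha>' \<beta>'. \<tau> = \<alpha>' \<rightarrow> \<beta>'"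
proof (induction \<sigma>s arbitrary: \<rho>s)
  case Nil
  then show ?case by (cases \<rho>s) auto
next
  case (Cons \<sigma> \<sigma>s)
  then show ?case by (cases \<rho>s) auto
qed

text \<open>\<open>\<rho>s\<close> lists the types of all arguments but the one that completes a
  redex, so an application lacking arguments is seen to have an arrow type.\<close>

lemma cst_ty_arity:
  assumes "0 < arity c"
  obtains \<rho>s \<alpha> \<beta> where "cst_ty c = funs \<rho>s (\<alpha> \<rightarrow> \<beta>)" "Suc (length \<rho>s) = arity c"
proof (cases c)
  case (WhileC \<sigma>)
  then show ?thesis using that[of "[\<sigma> \<rightarrow> Nat\<^sub>t, \<sigma>]"] by simp
next
  case (RecC \<sigma>)
  then show ?thesis using that[of "[\<sigma>, \<sigma> \<rightarrow> Nat\<^sub>t \<rightarrow> \<sigma>]"] by simp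
next
  case MinC
  then show ?thesis using that[of "[Nat\<^sub>t \<rightarrow> Nat\<^sub>t]"] by simp
next
  case (ByvalC \<sigma>s \<tau>)
  then show ?thesis using that[of "funs \<sigma>s (Nat\<^sub>t \<rightarrow> \<tau>) # \<sigma>s"] by simp
qed (use assms that[of "[]"] in auto)

lemma partial_typing:
  assumes "[] \<turnstile> apps (Const c) Ns \<Colon> \<tau>" "length Ns < arity c"
  shows "\<exists>\<alpha> \<beta>. \<tau> = \<alpha> \<rightarrow> \<beta>"
proof -
  obtain \<rho>s \<alpha> \<beta> where c: "cst_ty c = funs \<rho>s (\<alpha> \<rightarrow> \<beta>)" "Suc (length \<rho>s) = arity c"
    using assms(2) by (elim cst_ty_arity[rotated]) simp
  obtain \<sigma>s where "funs \<sigma>s \<tau> = cst_ty c" "length \<sigma>s = length Ns"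
    using assms(1) by (auto simp: typing_apps typing_simps list_all2_lengthD)
  then show ?thesis
    using funs_function_prefix[of \<sigma>s \<tau> \<rho>s \<alpha> \<beta>] c assms(2) by simp
qed

primrec canonical :: "ty \<Rightarrow> tm \<Rightarrow> bool" where
  "canonical Nat\<^sub>t M \<longleftrightarrow> (\<exists>n. M = num n)"
| "canonical (\<sigma> \<rightarrow> \<tau>) M \<longleftrightarrow>
     (\<exists>\<rho> N. M = Lam \<rho> N) \<or> (\<exists>c Ns. M = apps (Const c) Ns \<and> length Ns < arity c)"
| "canonical (\<sigma> \<otimes> \<tau>) M \<longleftrightarrow> (\<exists>A B. M = Pair A B)"

text \<open>\<open>N\<close> is the argument that completes the redex. The premise on it is the
  induction hypothesis of progress, asked for only at type \<open>Nat\<^sub>t\<close>: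
  \<open>Y\<close> and \<open>while\<close> fire on any last argument, the other constants that take
  arguments force a number.\<close>

lemma progress_saturated:
  assumes "[] \<turnstile> apps (Const c) Ns \<cdot> N \<Colon> \<tau>" "Suc (length Ns) = arity c"
    and N: "[] \<turnstile> N \<Colon> Nat\<^sub>t \<Longrightarrow> (\<exists>N'. N \<leadsto> N') \<or> (\<exists>n. N = num n)"
  shows "\<exists>M'. apps (Const c) Ns \<cdot> N \<leadsto> M'"
proof (cases c)
  case SucC
  then show ?thesis using assms by (auto simp: typing_simps intro: step.intros)
next
  case PreC
  have "\<exists>M'. Const PreC \<cdot> num n \<leadsto> M'" for n
    by (cases n) (use step_Pre_Suc in \<open>auto intro: step.intros\<close>)
  then show ?thesis using PreC assms by (auto simp: typing_simps intro: step.intros)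
next
  case IfzeroC
  have "\<exists>M'. Const IfzeroC \<cdot> num n \<leadsto> M'" for n
    by (cases n) (use step_Ifzero_Suc in \<open>auto intro: step.intros\<close>)
  then show ?thesis using IfzeroC assms by (auto simp: typing_simps intro: step.intros)
next
  case (YC \<sigma>)
  then show ?thesis using assms by (auto intro: step.intros)
next
  case (WhileC \<sigma>)
  then obtain C X where "Ns = [C, X]" using assms(2) by (auto simp: length_Suc_conv numeral_3_eq_3)
  then show ?thesis using WhileC by (auto intro: step.intros)
next
  case (RecC \<sigma>)
  then obtain X F where [simp]: "Ns = [X, F]" using assms(2) by (auto simp: length_Suc_conv numeral_3_eq_3)
  have "\<exists>M'. Const (RecC \<sigma>) \<cdot> X \<cdot> F \<cdot> num n \<leadsto> M'" for n
    by (cases n) (metis step_Rec_0, metis step_Rec_Suc Suc_eq_plus1)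
  then show ?thesis using RecC assms by (auto simp: typing_simps intro: step.intros)
next
  case MinC
  then obtain F where "Ns = [F]" using assms(2) by (auto simp: length_Suc_conv numeral_2_eq_2)
  then show ?thesis using MinC assms by (auto simp: typing_simps intro: step.intros)
next
  case (ByvalC \<sigma>s \<tau>')
  then obtain F Xs where Ns: "Ns = F # Xs" and len: "length Xs = length \<sigma>s"
    using assms(2) by (auto simp: length_Suc_conv)
  \<comment> \<open>\<open>\<rho>s\<close> and \<open>\<sigma>s\<close> have equal length, so the
    two function types split at the same place and \<open>\<rho>\<close> is
    \<open>Nat\<^sub>t\<close>.\<close>
  obtain \<rho> \<rho>s where "[] \<turnstile> N \<Colon> \<rho>" "funs \<rho>s (\<rho> \<rightarrow> \<tau>) = funs \<sigma>s (Nat\<^sub>t \<rightarrow> \<tau>')"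
    "list_all2 (typing []) Xs \<rho>s"
    using assms(1) ByvalC Ns by (auto simp: typing_simps typing_apps)
  then have "[] \<turnstile> N \<Colon> Nat\<^sub>t"
    using len by (simp add: funs_inject list_all2_lengthD)
  then show ?thesis
    using N ByvalC Ns step_Byval[OF len] step.intros(23)[OF _ len] by fastforce
qed (use assms in simp)

lemma progress: "[] \<turnstile> M \<Colon> \<tau> \<Longrightarrow> (\<exists>M'. M \<leadsto> M') \<or> canonical \<tau> M"
proof (induction "[] :: ty list" M \<tau> rule: typing.induct)
  case (2 c)
  show ?case
  proof (cases "0 < arity c")
    case True
    then obtain \<alpha> \<beta> where "cst_ty c = \<alpha> \<rightarrow> \<beta>"
      using partial_typing[of c "[]"] by (auto simp: typing_simps)
    moreover have "Const c = apps (Const c) []" by simp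
    ultimately show ?thesis using True by (metis canonical.simps(2) list.size(3))
  next
    case False
    then show ?thesis by (cases c) auto
  qed
next
  case (4 M \<sigma> \<tau> N)
  show ?case
  proof (cases "\<exists>M'. M \<leadsto> M'")
    case False
    then consider \<rho> B where "M = Lam \<rho> B" | c Ns where "M = apps (Const c) Ns" "length Ns < arity c"
      using 4(2) by auto
    then show ?thesis
    proof cases
      case (2 c Ns)
      \<comment> \<open>Either \<open>N\<close> completes the redex, or the application is still
        partial and thus canonical.\<close>
      then consider "Suc (length Ns) = arity c" | "Suc (length Ns) < arity c" by linarith
      then show ?thesis
      proof cases
        case 1
        have "(\<exists>N'. N \<leadsto> N') \<or> (\<exists>n. N = num n)" if "[] \<turnstile> N \<Colon> Nat\<^sub>t"
          using 4(4) typing_unique[OF that 4(3)] by auto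
        then show ?thesis
          using progress_saturated[OF _ 1] typing_App[OF 4(1,3)] 2(1) by blast
      next
        case 3: 2
        have *: "M \<cdot> N = apps (Const c) (Ns @ [N])" using 2 by (simp add: apps_snoc)
        then obtain \<alpha> \<beta> where "\<tau> = \<alpha> \<rightarrow> \<beta>"
          using partial_typing[of c "Ns @ [N]" \<tau>] typing_App[OF 4(1,3)] 3 by auto
        then show ?thesis using * 3 by (metis canonical.simps(2) length_append_singleton)
      qed
    qed (blast intro: step_beta)
  qed (blast intro: step_AppL)
next
  case (6 M \<sigma> \<tau>)
  then show ?case by (auto intro: step.intros)
next
  case (7 M \<sigma> \<tau>)
  then show ?case by (auto intro: step.intros)
qed auto

lemma progress_Nat: "[] \<turnstile> M \<Colon> Nat\<^sub>t \<Longrightarrow> (\<exists>M'. M \<leadsto> M') \<or> (\<exists>n. M = num n)"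
  using progress by fastforce

subsection \<open>Multi-step reduction and evaluation contexts\<close>

lemma steps_AppL: "M \<leadsto>* M' \<Longrightarrow> M \<cdot> N \<leadsto>* M' \<cdot> N"
  by (induction rule: rtranclp_induct) (auto intro: step_AppL rtranclp.rtrancl_into_rtrancl)

lemma steps_Fst: "M \<leadsto>* M' \<Longrightarrow> Fst M \<leadsto>* Fst M'"
  by (induction rule: rtranclp_induct) (auto intro: step_Fst rtranclp.rtrancl_into_rtrancl)

lemma steps_Snd: "M \<leadsto>* M' \<Longrightarrow> Snd M \<leadsto>* Snd M'"
  by (induction rule: rtranclp_induct) (auto intro: step_Snd rtranclp.rtrancl_into_rtrancl)

lemma num_steps [simp]: "num n \<leadsto>* M \<longleftrightarrow> M = num n"
  by (auto elim: converse_rtranclpE)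

lemma relpowp_num [simp]: "(step ^^ j) (num n) M \<longleftrightarrow> j = 0 \<and> M = num n"
  by (cases j) (auto elim!: relpowp_Suc_E2 simp del: relpowp.simps(2))

lemma steps_relpowp: "M \<leadsto>* M' \<longleftrightarrow> (\<exists>j. (step ^^ j) M M')"
  by (rule rtranclp_power)

lemma steps_num_confluent:
  assumes "M \<leadsto>* num n" "M \<leadsto>* M'"
  shows "M' \<leadsto>* num n"
  using assms(2,1)
proof (induction rule: converse_rtranclp_induct)
  case (step M M1)
  then have "M1 \<leadsto>* num n"
    by (auto elim!: converse_rtranclpE[of step M "num n"] dest: step_deterministic)
  then show ?case by (rule step.IH)
qed

text \<open>Evaluation contexts of any depth, as functions on terms. Depth matters because the
  relation at arrow and product types surrounds the term by further arguments and
  projections.\<close>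

inductive evctx :: "(tm \<Rightarrow> tm) \<Rightarrow> bool" where
  evctx_id: "evctx (\<lambda>M. M)"
| evctx_App: "evctx E \<Longrightarrow> evctx (\<lambda>M. E M \<cdot> N)"
| evctx_Suc: "evctx E \<Longrightarrow> evctx (\<lambda>M. Const SucC \<cdot> E M)"
| evctx_Pre: "evctx E \<Longrightarrow> evctx (\<lambda>M. Const PreC \<cdot> E M)"
| evctx_Ifzero: "evctx E \<Longrightarrow> evctx (\<lambda>M. Const IfzeroC \<cdot> E M)"
| evctx_Fst: "evctx E \<Longrightarrow> evctx (\<lambda>M. Fst (E M))"
| evctx_Snd: "evctx E \<Longrightarrow> evctx (\<lambda>M. Snd (E M))"
| evctx_Rec: "evctx E \<Longrightarrow> evctx (\<lambda>M. Const (RecC \<sigma>) \<cdot> X \<cdot> F \<cdot> E M)"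
| evctx_Min: "evctx E \<Longrightarrow> evctx (\<lambda>M. Const MinC \<cdot> F \<cdot> E M)"
| evctx_Byval: "evctx E \<Longrightarrow> length Xs = length \<sigma>s \<Longrightarrow>
     evctx (\<lambda>M. apps (Const (ByvalC \<sigma>s \<tau>) \<cdot> F) Xs \<cdot> E M)"

lemma evctx_step: "evctx E \<Longrightarrow> M \<leadsto> M' \<Longrightarrow> E M \<leadsto> E M'"
  by (induction rule: evctx.induct) (auto intro: step.intros)

lemma evctx_steps: "evctx E \<Longrightarrow> M \<leadsto>* M' \<Longrightarrow> E M \<leadsto>* E M'"
  by (rotate_tac, induction rule: rtranclp_induct)
     (auto intro: evctx_step rtranclp.rtrancl_into_rtrancl)

text \<open>By determinism \<open>E M\<close> can only follow the steps of \<open>M\<close> until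
  \<open>M\<close> is a numeral, so a run to a numeral splits there. The exact counts allow the
  first part to be charged to the index later.\<close>

lemma evctx_value:
  assumes "evctx E"
  shows "[] \<turnstile> M \<Colon> Nat\<^sub>t \<Longrightarrow> (step ^^ j) (E M) (num n) \<Longrightarrow>
    \<exists>i m. i \<le> j \<and> (step ^^ i) M (num m) \<and> (step ^^ (j - i)) (E (num m)) (num n)"
proof (induction j arbitrary: M)
  case 0
  then show ?case
    using progress_Nat[OF 0(1)] evctx_step[OF assms, of M] by fastforce
next
  case (Suc j)
  from progress_Nat[OF Suc.prems(1)] show ?case
  proof (elim disjE exE)
    fix M' assume M': "M \<leadsto> M'"
    then have "(step ^^ j) (E M') (num n)"
      using Suc.prems(2) evctx_step[OF assms M'] by (metis relpowp_Suc_E2 step_deterministic)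
    then obtain i m where "i \<le> j" "(step ^^ i) M' (num m)" "(step ^^ (j - i)) (E (num m)) (num n)"
      using Suc.IH preservation[OF M' Suc.prems(1)] by blast
    then show ?thesis
      using M' by (intro exI[of _ "Suc i"] exI[of _ m]) (auto intro: relpowp_Suc_I2 simp del: relpowp.simps)
  qed (use Suc.prems in auto)
qed

subsection \<open>The step-indexed approximation relation\<close>

text \<open>Only the left run is counted; the right one may have any length. The arrow clause
  quantifies over all smaller indices, which makes the relation downward closed. Nothing is observed
  at arrow and product types beyond applying and projecting, whence extensionality.\<close>

primrec iapprox :: "ty \<Rightarrow> nat \<Rightarrow> tm \<Rightarrow> tm \<Rightarrow> bool" where
  "iapprox Nat\<^sub>t k M M' \<longleftrightarrow> (\<forall>j\<le>k. \<forall>n. (step ^^ j) M (num n) \<longrightarrow> M' \<leadsto>* num n)"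
| "iapprox (\<sigma> \<rightarrow> \<tau>) k M M' \<longleftrightarrow> (\<forall>j\<le>k. \<forall>X X'. [] \<turnstile> X \<Colon> \<sigma> \<longrightarrow> [] \<turnstile> X' \<Colon> \<sigma> \<longrightarrow>
     iapprox \<sigma> j X X' \<longrightarrow> iapprox \<tau> j (M \<cdot> X) (M' \<cdot> X'))"
| "iapprox (\<sigma> \<otimes> \<tau>) k M M' \<longleftrightarrow> iapprox \<sigma> k (Fst M) (Fst M') \<and> iapprox \<tau> k (Snd M) (Snd M')"

lemma iapprox_mono: "iapprox \<tau> k M M' \<Longrightarrow> j \<le> k \<Longrightarrow> iapprox \<tau> j M M'"
proof (induction \<tau> arbitrary: M M')
  case Nat\<^sub>t
  then show ?case by simp (meson le_trans)
next
  case (Fun \<sigma> \<tau>)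
  then show ?case by simp
qed auto

lemma iapprox_AppD:
  "iapprox (\<sigma> \<rightarrow> \<tau>) k M M' \<Longrightarrow> [] \<turnstile> X \<Colon> \<sigma> \<Longrightarrow> [] \<turnstile> X' \<Colon> \<sigma> \<Longrightarrow> iapprox \<sigma> k X X' \<Longrightarrow> iapprox \<tau> k (M \<cdot> X) (M' \<cdot> X')"
  by auto

text \<open>A run of at most \<open>Suc k\<close> steps from \<open>M\<close> to a numeral leaves at
  most \<open>k\<close> of them from \<open>M1\<close>, so one step taken on the left buys one more
  index.\<close>

lemma iapprox_step_left: "M \<leadsto> M1 \<Longrightarrow> iapprox \<tau> k M1 M' \<Longrightarrow> iapprox \<tau> (Suc k) M M'"
proof (induction \<tau> arbitrary: k M M1 M')
  case Nat\<^sub>t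
  show ?case
  proof (unfold iapprox.simps, intro allI impI)
    fix j n assume "j \<le> Suc k" "(step ^^ j) M (num n)"
    moreover from this obtain i where "j = Suc i"
      using Nat\<^sub>t(1) by (cases j) auto
    ultimately have "(step ^^ i) M1 (num n)" "i \<le> k"
      using Nat\<^sub>t(1) by (auto elim!: relpowp_Suc_E2 dest: step_deterministic simp del: relpowp.simps)
    then show "M' \<leadsto>* num n" using Nat\<^sub>t(2) by auto
  qed
next
  case (Fun \<sigma> \<tau>)
  show ?case
  proof (unfold iapprox.simps, intro allI impI)
    fix j X X' assume j: "j \<le> Suc k" and X: "[] \<turnstile> X \<Colon> \<sigma>" "[] \<turnstile> X' \<Colon> \<sigma>" "iapprox \<sigma> j X X'"
    \<comment> \<open>For \<open>j = 0\<close> truncated subtraction leaves \<open>0\<close>, and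
      the surplus index gained below is dropped by monotonicity.\<close>
    have "iapprox \<tau> (j - 1) (M1 \<cdot> X) (M' \<cdot> X')"
      using Fun.prems(2) j X iapprox_mono[of \<sigma> j X X' "j - 1"] by auto
    from Fun.IH(2)[OF step_AppL[OF Fun.prems(1)] this] show "iapprox \<tau> j (M \<cdot> X) (M' \<cdot> X')"
      by (rule iapprox_mono) simp
  qed
next
  case (Prod \<sigma> \<tau>)
  then show ?case
    using Prod.IH(1)[OF step_Fst] Prod.IH(2)[OF step_Snd] by simp
qed

lemma iapprox_steps_left: "M \<leadsto>* M1 \<Longrightarrow> iapprox \<tau> k M1 M' \<Longrightarrow> iapprox \<tau> k M M'"
  by (induction rule: converse_rtranclp_induct) (auto intro: iapprox_mono[OF iapprox_step_left])

lemma iapprox_step_steps_left: "M \<leadsto> M0 \<Longrightarrow> M0 \<leadsto>* M1 \<Longrightarrow> iapprox \<tau> k M1 M' \<Longrightarrow> iapprox \<tau> (Suc k) M M'"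
  by (rule iapprox_step_left, assumption) (rule iapprox_steps_left)

text \<open>Steps on the right are free, so no index is charged.\<close>

lemma iapprox_steps_right: "M' \<leadsto>* M1 \<Longrightarrow> iapprox \<tau> k M M1 \<Longrightarrow> iapprox \<tau> k M M'"
proof (induction \<tau> arbitrary: k M M1 M')
  case Nat\<^sub>t
  then show ?case by (auto intro: rtranclp_trans)
next
  case (Fun \<sigma> \<tau>)
  show ?case
    using Fun.prems(2) Fun.IH(2)[OF steps_AppL[OF Fun.prems(1)]] by simp
next
  case (Prod \<sigma> \<tau>)
  then show ?case
    using Prod.IH(1)[OF steps_Fst] Prod.IH(2)[OF steps_Snd] by simp
qed

text \<open>At ground type the run of \<open>E M\<close> passes through a value of \<open>M\<close>,
  and the steps up to it are charged to the index. At higher types arguments and projections are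
  absorbed into \<open>E\<close>. If \<open>M\<close> diverges the premise is vacuous, which later
  yields bottom.\<close>

lemma iapprox_strict:
  assumes "evctx E" "[] \<turnstile> M \<Colon> Nat\<^sub>t"
    and "\<And>i m. i \<le> k \<Longrightarrow> (step ^^ i) M (num m) \<Longrightarrow> iapprox \<tau> (k - i) (E (num m)) Q"
  shows "iapprox \<tau> k (E M) Q"
  using assms(1,3)
proof (induction \<tau> arbitrary: k E Q)
  case Nat\<^sub>t
  show ?case
  proof (unfold iapprox.simps, intro allI impI)
    fix j n assume "j \<le> k" "(step ^^ j) (E M) (num n)"
    moreover from evctx_value[OF Nat\<^sub>t(1) assms(2) this(2)] obtain i m
      where "i \<le> j" "(step ^^ i) M (num m)" "(step ^^ (j - i)) (E (num m)) (num n)" by blast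
    ultimately show "Q \<leadsto>* num n" using Nat\<^sub>t(2)[of i m] by (meson diff_le_mono le_trans iapprox.simps(1))
  qed
next
  case (Fun \<sigma> \<tau>)
  show ?case
  proof (unfold iapprox.simps, intro allI impI)
    fix j X X' assume j: "j \<le> k" and X: "[] \<turnstile> X \<Colon> \<sigma>" "[] \<turnstile> X' \<Colon> \<sigma>" "iapprox \<sigma> j X X'"
    show "iapprox \<tau> j (E M \<cdot> X) (Q \<cdot> X')"
    proof (rule Fun.IH(2)[OF evctx_App[OF Fun.prems(1)]])
      fix i m assume i: "i \<le> j" "(step ^^ i) M (num m)"
      then have "iapprox (\<sigma> \<rightarrow> \<tau>) (j - i) (E (num m)) Q"
        using Fun.prems(2)[of i m] j iapprox_mono[of _ "k - i" _ _ "j - i"] by force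
      then show "iapprox \<tau> (j - i) (E (num m) \<cdot> X) (Q \<cdot> X')"
        by (rule iapprox_AppD) (use X in \<open>auto intro: iapprox_mono\<close>)
    qed
  qed
next
  case (Prod \<sigma> \<tau>)
  show ?case
    using Prod.IH(1)[OF evctx_Fst[OF Prod.prems(1)]] Prod.IH(2)[OF evctx_Snd[OF Prod.prems(1)]] Prod.prems(2)
    by simp
qed

lemma iapprox_strict2:
  assumes "evctx E" "evctx E'" "[] \<turnstile> M \<Colon> Nat\<^sub>t" "iapprox Nat\<^sub>t k M M'"
    and "\<And>j m. j \<le> k \<Longrightarrow> iapprox \<tau> j (E (num m)) (E' (num m))"
  shows "iapprox \<tau> k (E M) (E' M')"
proof (rule iapprox_strict[OF assms(1,3)])
  fix i m assume "i \<le> k" "(step ^^ i) M (num m)"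
  then have "M' \<leadsto>* num m" using assms(4) by auto
  then show "iapprox \<tau> (k - i) (E (num m)) (E' M')"
    using evctx_steps[OF assms(2)] assms(5)[of "k - i" m] by (auto intro: iapprox_steps_right)
qed

lemma iapprox_funI:
  "(\<And>j X X'. j \<le> k \<Longrightarrow> [] \<turnstile> X \<Colon> \<sigma> \<Longrightarrow> [] \<turnstile> X' \<Colon> \<sigma> \<Longrightarrow> iapprox \<sigma> j X X' \<Longrightarrow> iapprox \<tau> j (M \<cdot> X) (M' \<cdot> X')) \<Longrightarrow>
   iapprox (\<sigma> \<rightarrow> \<tau>) k M M'"
  by simp

lemma iapprox_evalI: "M \<leadsto>* N \<Longrightarrow> M' \<leadsto>* N' \<Longrightarrow> iapprox \<tau> k N N' \<Longrightarrow> iapprox \<tau> k M M'"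
  by (blast intro: iapprox_steps_left iapprox_steps_right)

lemma step_steps: "M \<leadsto> M' \<Longrightarrow> M \<leadsto>* M'"
  by (rule r_into_rtranclp)

lemmas iapprox_eval_stepI = iapprox_evalI[OF step_steps step_steps]

text \<open>A term with a step is not a numeral, so index \<open>0\<close> observes nothing: the
  base case of the inductions on the index.\<close>

lemma iapprox_0: "M \<leadsto> M1 \<Longrightarrow> iapprox \<tau> 0 M M'"
proof (induction \<tau> arbitrary: M M1 M')
  case (Prod \<sigma> \<tau>)
  then show ?case
    using Prod.IH(1)[OF step_Fst] Prod.IH(2)[OF step_Snd] by simp
next
  case (Fun \<sigma> \<tau>)
  then show ?case
    using Fun.IH(2)[OF step_AppL] by simp
qed auto

section \<open>Open terms under closing substitutions\<close>

fun env :: "ty list \<Rightarrow> nat \<Rightarrow> tm list \<Rightarrow> tm list \<Rightarrow> bool" where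
  "env [] k [] [] \<longleftrightarrow> True"
| "env (\<sigma> # \<Gamma>) k (V # Vs) (V' # Vs') \<longleftrightarrow>
     [] \<turnstile> V \<Colon> \<sigma> \<and> [] \<turnstile> V' \<Colon> \<sigma> \<and> iapprox \<sigma> k V V' \<and> env \<Gamma> k Vs Vs'"
| "env _ _ _ _ \<longleftrightarrow> False"

lemma env_mono: "env \<Gamma> k Vs Vs' \<Longrightarrow> j \<le> k \<Longrightarrow> env \<Gamma> j Vs Vs'"
  by (induction \<Gamma> k Vs Vs' rule: env.induct) (auto intro: iapprox_mono)

lemma env_typing:
  assumes "env \<Gamma> k Vs Vs'"
  shows "list_all2 (typing []) Vs \<Gamma>" "list_all2 (typing []) Vs' \<Gamma>"
  using assms by (induction \<Gamma> k Vs Vs' rule: env.induct) auto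

lemma env_closed:
  assumes "env \<Gamma> k Vs Vs'"
  shows "\<forall>V \<in> set Vs. closed V" "\<forall>V \<in> set Vs'. closed V"
  using assms by (induction \<Gamma> k Vs Vs' rule: env.induct) (auto intro: closedI)

lemma env_length:
  assumes "env \<Gamma> k Vs Vs'"
  shows "length Vs = length \<Gamma>" "length Vs' = length \<Gamma>"
  using env_typing[OF assms] by (simp_all add: list_all2_lengthD)

lemma env_nth: "env \<Gamma> k Vs Vs' \<Longrightarrow> i < length \<Gamma> \<Longrightarrow> iapprox (\<Gamma> ! i) k (Vs ! i) (Vs' ! i)"
proof (induction \<Gamma> k Vs Vs' arbitrary: i rule: env.induct)
  case (2 \<sigma> \<Gamma> k V Vs V' Vs')
  then show ?case by (cases i) auto
qed auto

lemma iapprox_funsI: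
  "(\<And>j Xs Xs'. j \<le> k \<Longrightarrow> env \<sigma>s j Xs Xs' \<Longrightarrow> iapprox \<tau> j (apps M Xs) (apps M' Xs')) \<Longrightarrow>
   iapprox (funs \<sigma>s \<tau>) k M M'"
proof (induction \<sigma>s arbitrary: k M M')
  case Nil
  then show ?case using Nil[of k "[]" "[]"] by simp
next
  case (Cons \<sigma> \<sigma>s)
  show ?case
    unfolding funs_Cons
  proof (rule iapprox_funI, rule Cons.IH)
    fix j X X' i Xs Xs'
    assume "j \<le> k" "[] \<turnstile> X \<Colon> \<sigma>" "[] \<turnstile> X' \<Colon> \<sigma>" "iapprox \<sigma> j X X'" "i \<le> j" "env \<sigma>s i Xs Xs'"
    then show "iapprox \<tau> i (apps (M \<cdot> X) Xs) (apps (M' \<cdot> X') Xs')"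
      using Cons.prems[of i "X # Xs" "X' # Xs'"] by (auto intro: iapprox_mono)
  qed
qed

lemma iapprox_funsD: "iapprox (funs \<sigma>s \<tau>) k M M' \<Longrightarrow> env \<sigma>s k Xs Xs' \<Longrightarrow> iapprox \<tau> k (apps M Xs) (apps M' Xs')"
proof (induction \<sigma>s arbitrary: M M' Xs Xs')
  case Nil
  then show ?case by (cases Xs; cases Xs') auto
next
  case (Cons \<sigma> \<sigma>s)
  then show ?case by (cases Xs; cases Xs') (auto intro!: Cons.IH iapprox_AppD[OF Cons.prems(1)[unfolded funs_Cons]])
qed

definition approx :: "ty list \<Rightarrow> tm \<Rightarrow> tm \<Rightarrow> ty \<Rightarrow> bool" where
  "approx \<Gamma> M M' \<tau> \<longleftrightarrow> \<Gamma> \<turnstile> M \<Colon> \<tau> \<and> \<Gamma> \<turnstile> M' \<Colon> \<tau> \<and>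
     (\<forall>k Vs Vs'. env \<Gamma> k Vs Vs' \<longrightarrow> iapprox \<tau> k (close Vs 0 M) (close Vs' 0 M'))"

lemma approx_closed: "approx [] M M' \<tau> \<longleftrightarrow> [] \<turnstile> M \<Colon> \<tau> \<and> [] \<turnstile> M' \<Colon> \<tau> \<and> (\<forall>k. iapprox \<tau> k M M')"
proof -
  have "env [] k Vs Vs' \<longleftrightarrow> Vs = [] \<and> Vs' = []" for k Vs Vs'
    by (cases Vs; cases Vs') auto
  then show ?thesis by (simp add: approx_def)
qed

lemma approx_weaken: "approx [] M M' \<tau> \<Longrightarrow> approx \<Gamma> M M' \<tau>"
  unfolding approx_closed using closedI[of M \<tau>] closedI[of M' \<tau>] by (auto simp: approx_def typing_weaken)

lemma approx_Var: "i < length \<Gamma> \<Longrightarrow> approx \<Gamma> (Var i) (Var i) (\<Gamma> ! i)"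
  by (auto simp: approx_def env_length intro: typing.intros env_nth)

lemma approx_Lam:
  assumes "approx (\<sigma> # \<Gamma>) M M' \<tau>"
  shows "approx \<Gamma> (Lam \<sigma> M) (Lam \<sigma> M') (\<sigma> \<rightarrow> \<tau>)"
  unfolding approx_def
proof (intro conjI allI impI)
  fix k Vs Vs' assume env: "env \<Gamma> k Vs Vs'"
  show "iapprox (\<sigma> \<rightarrow> \<tau>) k (close Vs 0 (Lam \<sigma> M)) (close Vs' 0 (Lam \<sigma> M'))"
  proof (rule iapprox_funI)
    fix j X X' assume j: "j \<le> k" and X: "[] \<turnstile> X \<Colon> \<sigma>" "[] \<turnstile> X' \<Colon> \<sigma>" "iapprox \<sigma> j X X'"
    have beta: "close Vs 0 (Lam \<sigma> M) \<cdot> X \<leadsto> close (X # Vs) 0 M"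
      "close Vs' 0 (Lam \<sigma> M') \<cdot> X' \<leadsto> close (X' # Vs') 0 M'"
      using step_beta[of \<sigma> "close Vs 1 M" X] step_beta[of \<sigma> "close Vs' 1 M'" X']
        subst_close[OF closedI[OF X(1)] env_closed(1)[OF env], of 0 M]
        subst_close[OF closedI[OF X(2)] env_closed(2)[OF env], of 0 M'] by simp_all
    \<comment> \<open>The environments are related at \<open>k\<close>, the arguments only at
      \<open>j\<close>; monotonicity brings the former down.\<close>
    have "iapprox \<tau> j (close (X # Vs) 0 M) (close (X' # Vs') 0 M')"
      using assms X env_mono[OF env j] by (simp add: approx_def)
    then show "iapprox \<tau> j (close Vs 0 (Lam \<sigma> M) \<cdot> X) (close Vs' 0 (Lam \<sigma> M') \<cdot> X')"
      using beta by (meson iapprox_steps_left iapprox_steps_right r_into_rtranclp)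
  qed
qed (use assms in \<open>auto simp: approx_def intro: typing.intros\<close>)

lemma approx_App: "approx \<Gamma> M M' (\<sigma> \<rightarrow> \<tau>) \<Longrightarrow> approx \<Gamma> N N' \<sigma> \<Longrightarrow> approx \<Gamma> (M \<cdot> N) (M' \<cdot> N') \<tau>"
  unfolding approx_def
proof (elim conjE, intro conjI allI impI)
  fix k Vs Vs' assume env: "env \<Gamma> k Vs Vs'" and N: "\<Gamma> \<turnstile> N \<Colon> \<sigma>" "\<Gamma> \<turnstile> N' \<Colon> \<sigma>"
    and "\<forall>k Vs Vs'. env \<Gamma> k Vs Vs' \<longrightarrow> iapprox (\<sigma> \<rightarrow> \<tau>) k (close Vs 0 M) (close Vs' 0 M')"
    and "\<forall>k Vs Vs'. env \<Gamma> k Vs Vs' \<longrightarrow> iapprox \<sigma> k (close Vs 0 N) (close Vs' 0 N')"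
  moreover have "[] \<turnstile> close Vs 0 N \<Colon> \<sigma>" "[] \<turnstile> close Vs' 0 N' \<Colon> \<sigma>"
    using typing_close[OF env_typing(1)[OF env], of "[]" N \<sigma>]
      typing_close[OF env_typing(2)[OF env], of "[]" N' \<sigma>] N by simp_all
  ultimately show "iapprox \<tau> k (close Vs 0 (M \<cdot> N)) (close Vs' 0 (M' \<cdot> N'))"
    by (simp only: close.simps) (blast intro: iapprox_AppD)
qed (auto intro: typing_App)

lemma iapprox_Pair:
  assumes "iapprox \<sigma> k A A'" "iapprox \<tau> k B B'"
  shows "iapprox (\<sigma> \<otimes> \<tau>) k (Pair A B) (Pair A' B')"
  using assms by (simp add: iapprox_eval_stepI[OF step_FstPair step_FstPair] iapprox_eval_stepI[OF step_SndPair step_SndPair])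

lemma approx_Pair: "approx \<Gamma> M M' \<sigma> \<Longrightarrow> approx \<Gamma> N N' \<tau> \<Longrightarrow> approx \<Gamma> (Pair M N) (Pair M' N') (\<sigma> \<otimes> \<tau>)"
  by (simp add: approx_def iapprox_Pair typing_Pair del: iapprox.simps)

lemma approx_Fst: "approx \<Gamma> M M' (\<sigma> \<otimes> \<tau>) \<Longrightarrow> approx \<Gamma> (Fst M) (Fst M') \<sigma>"
  by (auto simp: approx_def intro: typing_Fst)

lemma approx_Snd: "approx \<Gamma> M M' (\<sigma> \<otimes> \<tau>) \<Longrightarrow> approx \<Gamma> (Snd M) (Snd M') \<tau>"
  by (auto simp: approx_def intro: typing_Snd)

text \<open>The fundamental lemma for two interpretations of the constants. Taken with
  \<open>Const\<close> twice it gives reflexivity; with \<open>circ_cst\<close> or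
  \<open>dagger_cst\<close> against \<open>Const\<close> it gives correctness of a whole translation
  from the constants alone.\<close>

lemma approx_replace_csts:
  "\<Gamma> \<turnstile> M \<Colon> \<tau> \<Longrightarrow> (\<And>c. c \<in> csts_of M \<Longrightarrow> approx [] (\<theta> c) (\<theta>' c) (cst_ty c)) \<Longrightarrow>
   approx \<Gamma> (replace_csts \<theta> M) (replace_csts \<theta>' M) \<tau>"
  by (induction rule: typing.induct)
     (auto intro: approx_weaken approx_Var approx_Lam approx_App approx_Pair approx_Fst approx_Snd)

lemma replace_csts_Const [simp]: "replace_csts Const M = M"
  by (induction M) auto

text \<open>Reflexivity of the surrounding terms is a premise because it becomes available only once
  the constants are known to respect approximation.\<close>

lemma approx_plug:
  "ctx_typing \<rho> \<Gamma> C \<tau> \<Longrightarrow> approx [] M M' \<rho> \<Longrightarrow> (\<And>\<Gamma> N \<sigma>. \<Gamma> \<turnstile> N \<Colon> \<sigma> \<Longrightarrow> approx \<Gamma> N N \<sigma>) \<Longrightarrow>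
   approx \<Gamma> (plug C M) (plug C M') \<tau>"
  by (induction rule: ctx_typing.induct)
     (auto intro: approx_weaken approx_Lam approx_App approx_Pair approx_Fst approx_Snd)

subsection \<open>The constants respect approximation\<close>

lemma iapprox_cst_Num: "iapprox (cst_ty (Num n)) k (num n) (num n)"
  by auto

lemma iapprox_cst_Suc: "iapprox (cst_ty SucC) k (Const SucC) (Const SucC)"
  unfolding cst_ty.simps
proof (rule iapprox_funI, rule iapprox_strict2[OF evctx_Suc[OF evctx_id] evctx_Suc[OF evctx_id]])
  show "iapprox Nat\<^sub>t j (Const SucC \<cdot> num m) (Const SucC \<cdot> num m)" for j m
    by (rule iapprox_eval_stepI[OF step_Suc step_Suc]) simp
qed

lemma iapprox_cst_Pre: "iapprox (cst_ty PreC) k (Const PreC) (Const PreC)"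
  unfolding cst_ty.simps
proof (rule iapprox_funI, rule iapprox_strict2[OF evctx_Pre[OF evctx_id] evctx_Pre[OF evctx_id]])
  show "iapprox Nat\<^sub>t j (Const PreC \<cdot> num m) (Const PreC \<cdot> num m)" for j m
  proof -
    have "\<exists>n. Const PreC \<cdot> num m \<leadsto> num n"
      using step_Pre_0 step_Pre_Suc by (cases m) auto
    then obtain n where "Const PreC \<cdot> num m \<leadsto> num n" ..
    then show ?thesis by (rule iapprox_eval_stepI) (fact | simp)+
  qed
qed

text \<open>Covers the abstractions to which \<open>IfzeroC\<close> reduces, before reflexivity is
  known for terms with constants.\<close>

lemma iapprox_const_free: "[] \<turnstile> M \<Colon> \<tau> \<Longrightarrow> csts_of M = {} \<Longrightarrow> iapprox \<tau> k M M"
  using approx_replace_csts[of "[]" M \<tau> Const Const] by (simp add: approx_closed)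

lemma iapprox_cst_Ifzero: "iapprox (cst_ty IfzeroC) k (Const IfzeroC) (Const IfzeroC)"
  unfolding cst_ty.simps
proof (rule iapprox_funI, rule iapprox_strict2[OF evctx_Ifzero[OF evctx_id] evctx_Ifzero[OF evctx_id]])
  show "iapprox (Nat\<^sub>t \<rightarrow> Nat\<^sub>t \<rightarrow> Nat\<^sub>t) j (Const IfzeroC \<cdot> num m) (Const IfzeroC \<cdot> num m)" for j m
  proof -
    have *: "iapprox (Nat\<^sub>t \<rightarrow> Nat\<^sub>t \<rightarrow> Nat\<^sub>t) j M M"
      if "M = Lam Nat\<^sub>t (Lam Nat\<^sub>t (Var 0)) \<or> M = Lam Nat\<^sub>t (Lam Nat\<^sub>t (Var 1))" for M
      by (rule iapprox_const_free) (use that in \<open>auto simp: typing_iff_infer\<close>)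
    show ?thesis
    proof (cases m)
      case 0
      have "Const IfzeroC \<cdot> num m \<leadsto>* Lam Nat\<^sub>t (Lam Nat\<^sub>t (Var 1))"
        unfolding 0 by (rule step_steps[OF step_Ifzero_0])
      then show ?thesis by (rule iapprox_evalI[OF _ _ *]) (fact | simp)+
    next
      case (Suc n)
      have "Const IfzeroC \<cdot> num m \<leadsto>* Lam Nat\<^sub>t (Lam Nat\<^sub>t (Var 0))"
        unfolding Suc using step_Ifzero_Suc[of n] by (simp add: r_into_rtranclp)
      then show ?thesis by (rule iapprox_evalI[OF _ _ *]) (fact | simp)+
    qed
  qed
qed

lemma iapprox_ifzero: "iapprox (Nat\<^sub>t \<rightarrow> \<sigma> \<rightarrow> \<sigma> \<rightarrow> \<sigma>) k (ifzero \<sigma>) (ifzero \<sigma>)"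
proof -
  have "csts_of (ifzero \<sigma>) \<subseteq> {IfzeroC}"
    by (induction \<sigma>) auto
  then have "approx [] (Const c) (Const c) (cst_ty c)" if "c \<in> csts_of (ifzero \<sigma>)" for c
    using that iapprox_cst_Ifzero by (auto simp: approx_closed typing_iff_infer)
  from approx_replace_csts[of "[]" "ifzero \<sigma>" _ Const Const, OF typing_ifzero this] show ?thesis
    by (simp add: approx_closed del: iapprox.simps)
qed

text \<open>The unfolding step on the left drops the index by one, where the induction hypothesis
  already relates the two fixed points passed to \<open>F\<close> and \<open>F'\<close>.\<close>

lemma iapprox_cst_Y: "iapprox (cst_ty (YC \<sigma>)) k (Const (YC \<sigma>)) (Const (YC \<sigma>))"
  unfolding cst_ty.simps
proof (rule iapprox_funI)
  fix j F F' assume F: "[] \<turnstile> F \<Colon> \<sigma> \<rightarrow> \<sigma>" "[] \<turnstile> F' \<Colon> \<sigma> \<rightarrow> \<sigma>" "iapprox (\<sigma> \<rightarrow> \<sigma>) j F F'"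
  have ty: "[] \<turnstile> Const (YC \<sigma>) \<cdot> F \<Colon> \<sigma>" if "[] \<turnstile> F \<Colon> \<sigma> \<rightarrow> \<sigma>" for F
    using that by (simp add: typing_simps)
  show "iapprox \<sigma> j (Const (YC \<sigma>) \<cdot> F) (Const (YC \<sigma>) \<cdot> F')"
    using F(3)
  proof (induction j)
    case 0
    show ?case by (rule iapprox_0[OF step_Y])
  next
    case (Suc j)
    from Suc.prems have "iapprox (\<sigma> \<rightarrow> \<sigma>) j F F'" by (rule iapprox_mono) simp
    from iapprox_AppD[OF this ty[OF F(1)] ty[OF F(2)] Suc.IH[OF this]]
    show ?case
      by (rule iapprox_step_left[OF step_Y iapprox_steps_right[OF step_steps[OF step_Y]]])
  qed
qed

text \<open>Only the unfolding equation of a loop matters, so \<open>A\<close> and \<open>A'\<close>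
  may each be the constant or a program for it. The state varies in the induction because the next
  round starts from \<open>F \<cdot> X\<close>.\<close>

lemma iapprox_while_unfolding:
  assumes A: "\<And>C X F. [] \<turnstile> C \<Colon> \<sigma> \<rightarrow> Nat\<^sub>t \<Longrightarrow> [] \<turnstile> X \<Colon> \<sigma> \<Longrightarrow> [] \<turnstile> F \<Colon> \<sigma> \<rightarrow> \<sigma> \<Longrightarrow> [] \<turnstile> A C X F \<Colon> \<sigma> \<and>
      (\<exists>M. A C X F \<leadsto> M \<and> M \<leadsto>* ifzero \<sigma> \<cdot> (C \<cdot> X) \<cdot> A C (F \<cdot> X) F \<cdot> X)"
    and A': "\<And>C X F. [] \<turnstile> C \<Colon> \<sigma> \<rightarrow> Nat\<^sub>t \<Longrightarrow> [] \<turnstile> X \<Colon> \<sigma> \<Longrightarrow> [] \<turnstile> F \<Colon> \<sigma> \<rightarrow> \<sigma> \<Longrightarrow> [] \<turnstile> A' C X F \<Colon> \<sigma> \<and>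
      A' C X F \<leadsto>* ifzero \<sigma> \<cdot> (C \<cdot> X) \<cdot> A' C (F \<cdot> X) F \<cdot> X"
    and C: "[] \<turnstile> C \<Colon> \<sigma> \<rightarrow> Nat\<^sub>t" "[] \<turnstile> C' \<Colon> \<sigma> \<rightarrow> Nat\<^sub>t" "iapprox (\<sigma> \<rightarrow> Nat\<^sub>t) k C C'"
    and F: "[] \<turnstile> F \<Colon> \<sigma> \<rightarrow> \<sigma>" "[] \<turnstile> F' \<Colon> \<sigma> \<rightarrow> \<sigma>" "iapprox (\<sigma> \<rightarrow> \<sigma>) k F F'"
    and X: "[] \<turnstile> X \<Colon> \<sigma>" "[] \<turnstile> X' \<Colon> \<sigma>" "iapprox \<sigma> k X X'"
  shows "iapprox \<sigma> k (A C X F) (A' C' X' F')"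
  using C(3) F(3) X
proof (induction k arbitrary: X X')
  case 0
  then show ?case using A[OF C(1) _ F(1)] iapprox_0 by blast
next
  case (Suc k)
  from Suc.prems have rel: "iapprox (\<sigma> \<rightarrow> Nat\<^sub>t) k C C'" "iapprox (\<sigma> \<rightarrow> \<sigma>) k F F'" "iapprox \<sigma> k X X'"
    by (blast intro: iapprox_mono le_SucI order_refl)+
  have FX: "[] \<turnstile> F \<cdot> X \<Colon> \<sigma>" "[] \<turnstile> F' \<cdot> X' \<Colon> \<sigma>" "iapprox \<sigma> k (F \<cdot> X) (F' \<cdot> X')"
    and CX: "[] \<turnstile> C \<cdot> X \<Colon> Nat\<^sub>t" "[] \<turnstile> C' \<cdot> X' \<Colon> Nat\<^sub>t" "iapprox Nat\<^sub>t k (C \<cdot> X) (C' \<cdot> X')"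
    using C(1,2) F(1,2) Suc.prems(3,4) rel by (blast intro: typing_App iapprox_AppD)+
  have "iapprox \<sigma> k (A C (F \<cdot> X) F) (A' C' (F' \<cdot> X') F')"
    by (rule Suc.IH[OF rel(1,2) FX])
  then have "iapprox \<sigma> k (ifzero \<sigma> \<cdot> (C \<cdot> X) \<cdot> A C (F \<cdot> X) F \<cdot> X) (ifzero \<sigma> \<cdot> (C' \<cdot> X') \<cdot> A' C' (F' \<cdot> X') F' \<cdot> X')"
    using A[OF C(1) FX(1) F(1)] A'[OF C(2) FX(2) F(2)] Suc.prems(3,4) rel(3) CX
    by (blast intro: iapprox_AppD iapprox_ifzero)
  then have "iapprox \<sigma> k (ifzero \<sigma> \<cdot> (C \<cdot> X) \<cdot> A C (F \<cdot> X) F \<cdot> X) (A' C' X' F')"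
    using A'[OF C(2) Suc.prems(4) F(2)] iapprox_steps_right by blast
  then show ?case
    using A[OF C(1) Suc.prems(3) F(1)] iapprox_step_steps_left by blast
qed

lemma iapprox_cst_While: "iapprox (cst_ty (WhileC \<sigma>)) k (Const (WhileC \<sigma>)) (Const (WhileC \<sigma>))"
  unfolding cst_ty.simps
proof (intro iapprox_funI)
  fix j1 j2 j C C' X X' F F'
  assume *: "[] \<turnstile> C \<Colon> \<sigma> \<rightarrow> Nat\<^sub>t" "[] \<turnstile> C' \<Colon> \<sigma> \<rightarrow> Nat\<^sub>t" "iapprox (\<sigma> \<rightarrow> Nat\<^sub>t) j1 C C'" "j2 \<le> j1"
    "[] \<turnstile> X \<Colon> \<sigma>" "[] \<turnstile> X' \<Colon> \<sigma>" "iapprox \<sigma> j2 X X'" "j \<le> j2"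
    "[] \<turnstile> F \<Colon> \<sigma> \<rightarrow> \<sigma>" "[] \<turnstile> F' \<Colon> \<sigma> \<rightarrow> \<sigma>" "iapprox (\<sigma> \<rightarrow> \<sigma>) j F F'"
  show "iapprox \<sigma> j (Const (WhileC \<sigma>) \<cdot> C \<cdot> X \<cdot> F) (Const (WhileC \<sigma>) \<cdot> C' \<cdot> X' \<cdot> F')"
    by (rule iapprox_while_unfolding[where A = "\<lambda>C X F. Const (WhileC \<sigma>) \<cdot> C \<cdot> X \<cdot> F" and A' = "\<lambda>C X F. Const (WhileC \<sigma>) \<cdot> C \<cdot> X \<cdot> F"])
       (use * in \<open>auto simp: typing_simps simp del: iapprox.simps intro: step_While iapprox_mono\<close>)
qed

lemma iapprox_min_unfolding:
  assumes A: "\<And>F. evctx (A F)" "\<And>F n. [] \<turnstile> F \<Colon> Nat\<^sub>t \<rightarrow> Nat\<^sub>t \<Longrightarrow> 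
      [] \<turnstile> A F (Const SucC \<cdot> num n) \<Colon> Nat\<^sub>t \<and>
      (\<exists>M. A F (num n) \<leadsto> M \<and> M \<leadsto>* Const IfzeroC \<cdot> (F \<cdot> num n) \<cdot> num n \<cdot> A F (Const SucC \<cdot> num n))"
    and A': "\<And>F. evctx (A' F)" "\<And>F n. [] \<turnstile> F \<Colon> Nat\<^sub>t \<rightarrow> Nat\<^sub>t \<Longrightarrow> 
      [] \<turnstile> A' F (Const SucC \<cdot> num n) \<Colon> Nat\<^sub>t \<and>
      A' F (num n) \<leadsto>* Const IfzeroC \<cdot> (F \<cdot> num n) \<cdot> num n \<cdot> A' F (Const SucC \<cdot> num n)"
    and F: "[] \<turnstile> F \<Colon> Nat\<^sub>t \<rightarrow> Nat\<^sub>t" "[] \<turnstile> F' \<Colon> Nat\<^sub>t \<rightarrow> Nat\<^sub>t" "iapprox (Nat\<^sub>t \<rightarrow> Nat\<^sub>t) k F F'"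
    and N: "[] \<turnstile> N \<Colon> Nat\<^sub>t" "[] \<turnstile> N' \<Colon> Nat\<^sub>t" "iapprox Nat\<^sub>t k N N'"
  shows "iapprox Nat\<^sub>t k (A F N) (A' F' N')"
  using F(3) N
proof (induction k arbitrary: N N' rule: less_induct)
  case (less k)
  show ?case
  \<comment> \<open>Forcing \<open>N\<close> may spend any part of the index before the unfolding
    spends one more, hence the induction over all smaller indices.\<close>
  proof (rule iapprox_strict2[OF A(1) A'(1) less.prems(2) less.prems(4)])
    fix j m assume "j \<le> k"
    show "iapprox Nat\<^sub>t j (A F (num m)) (A' F' (num m))"
    proof (cases j)
      case 0
      then show ?thesis using A(2)[OF F(1), of m] iapprox_0 by blast
    next
      case (Suc i)
      then have rel: "iapprox (Nat\<^sub>t \<rightarrow> Nat\<^sub>t) i F F'" and "i < k"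
        using less.prems(1) \<open>j \<le> k\<close> by (auto intro: iapprox_mono simp del: iapprox.simps)
      have ty: "[] \<turnstile> num m \<Colon> Nat\<^sub>t" "[] \<turnstile> Const SucC \<cdot> num m \<Colon> Nat\<^sub>t"
        by (simp_all add: typing_simps)
      have num: "iapprox Nat\<^sub>t i (num m) (num m)" by simp
      then have "iapprox Nat\<^sub>t i (Const SucC \<cdot> num m) (Const SucC \<cdot> num m)"
        using iapprox_cst_Suc ty by (auto intro: iapprox_AppD simp del: iapprox.simps)
      then have "iapprox Nat\<^sub>t i (A F (Const SucC \<cdot> num m)) (A' F' (Const SucC \<cdot> num m))"
        using less.IH[OF \<open>i < k\<close> rel] ty by blast
      then have "iapprox Nat\<^sub>t i (Const IfzeroC \<cdot> (F \<cdot> num m) \<cdot> num m \<cdot> A F (Const SucC \<cdot> num m))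
          (Const IfzeroC \<cdot> (F' \<cdot> num m) \<cdot> num m \<cdot> A' F' (Const SucC \<cdot> num m))"
        using rel num ty F(1,2) A(2)[OF F(1), of m] A'(2)[OF F(2), of m] iapprox_cst_Ifzero[unfolded cst_ty.simps]
        by (blast intro: iapprox_AppD typing_App)
      then have "iapprox Nat\<^sub>t i (Const IfzeroC \<cdot> (F \<cdot> num m) \<cdot> num m \<cdot> A F (Const SucC \<cdot> num m)) (A' F' (num m))"
        using A'(2)[OF F(2), of m] iapprox_steps_right by blast
      then show ?thesis
        unfolding Suc using A(2)[OF F(1), of m] iapprox_step_steps_left by blast
    qed
  qed
qed

lemma iapprox_cst_Min: "iapprox (cst_ty MinC) k (Const MinC) (Const MinC)"
  unfolding cst_ty.simps
proof (intro iapprox_funI)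
  fix j1 j F F' N N'
  assume *: "[] \<turnstile> F \<Colon> Nat\<^sub>t \<rightarrow> Nat\<^sub>t" "[] \<turnstile> F' \<Colon> Nat\<^sub>t \<rightarrow> Nat\<^sub>t" "iapprox (Nat\<^sub>t \<rightarrow> Nat\<^sub>t) j1 F F'" "j \<le> j1"
    "[] \<turnstile> N \<Colon> Nat\<^sub>t" "[] \<turnstile> N' \<Colon> Nat\<^sub>t" "iapprox Nat\<^sub>t j N N'"
  show "iapprox Nat\<^sub>t j (Const MinC \<cdot> F \<cdot> N) (Const MinC \<cdot> F' \<cdot> N')"
    by (rule iapprox_min_unfolding[where A = "\<lambda>F N. Const MinC \<cdot> F \<cdot> N" and A' = "\<lambda>F N. Const MinC \<cdot> F \<cdot> N"])
       (use * in \<open>auto simp: typing_simps simp del: iapprox.simps intro: step_Min iapprox_mono evctx_Min[OF evctx_id]\<close>)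
qed

text \<open>\<open>rec\<close> is bounded by its number: once that is forced, the induction runs
  over the numeral at a fixed index, and no unfolding step has to be charged.\<close>

lemma iapprox_cst_Rec: "iapprox (cst_ty (RecC \<sigma>)) k (Const (RecC \<sigma>)) (Const (RecC \<sigma>))"
  unfolding cst_ty.simps
proof (intro iapprox_funI)
  fix j1 j2 j X X' F F' N N'
  assume *: "[] \<turnstile> X \<Colon> \<sigma>" "[] \<turnstile> X' \<Colon> \<sigma>" "iapprox \<sigma> j1 X X'" "j2 \<le> j1"
    "[] \<turnstile> F \<Colon> \<sigma> \<rightarrow> Nat\<^sub>t \<rightarrow> \<sigma>" "[] \<turnstile> F' \<Colon> \<sigma> \<rightarrow> Nat\<^sub>t \<rightarrow> \<sigma>" "iapprox (\<sigma> \<rightarrow> Nat\<^sub>t \<rightarrow> \<sigma>) j2 F F'" "j \<le> j2"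
    "[] \<turnstile> N \<Colon> Nat\<^sub>t" "[] \<turnstile> N' \<Colon> Nat\<^sub>t" "iapprox Nat\<^sub>t j N N'"
  show "iapprox \<sigma> j (Const (RecC \<sigma>) \<cdot> X \<cdot> F \<cdot> N) (Const (RecC \<sigma>) \<cdot> X' \<cdot> F' \<cdot> N')"
  proof (rule iapprox_strict2[OF evctx_Rec[OF evctx_id] evctx_Rec[OF evctx_id] *(9,11)])
    fix i m assume "i \<le> j"
    then have rel: "iapprox \<sigma> i X X'" "iapprox (\<sigma> \<rightarrow> Nat\<^sub>t \<rightarrow> \<sigma>) i F F'"
      using * by (auto intro: iapprox_mono simp del: iapprox.simps)
    have ty: "[] \<turnstile> Const (RecC \<sigma>) \<cdot> X \<cdot> F \<cdot> num n \<Colon> \<sigma>"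
      "[] \<turnstile> Const (RecC \<sigma>) \<cdot> X' \<cdot> F' \<cdot> num n \<Colon> \<sigma>" "[] \<turnstile> num n \<Colon> Nat\<^sub>t" for n
      using * by (simp_all add: typing_simps)
    show "iapprox \<sigma> i (Const (RecC \<sigma>) \<cdot> X \<cdot> F \<cdot> num m) (Const (RecC \<sigma>) \<cdot> X' \<cdot> F' \<cdot> num m)"
    proof (induction m)
      case 0
      show ?case
        by (rule iapprox_eval_stepI[OF step_Rec_0 step_Rec_0 rel(1)])
    next
      case (Suc m)
      have "iapprox \<sigma> i (F \<cdot> (Const (RecC \<sigma>) \<cdot> X \<cdot> F \<cdot> num m) \<cdot> num m)
          (F' \<cdot> (Const (RecC \<sigma>) \<cdot> X' \<cdot> F' \<cdot> num m) \<cdot> num m)"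
        using Suc ty rel(2) iapprox_cst_Num[of m i, unfolded cst_ty.simps] by (blast intro: iapprox_AppD)
      from iapprox_eval_stepI[OF step_Rec_Suc step_Rec_Suc this]
      show ?case by simp
    qed
  qed
qed

lemma iapprox_cst_Byval: "iapprox (cst_ty (ByvalC \<sigma>s \<tau>)) k (Const (ByvalC \<sigma>s \<tau>)) (Const (ByvalC \<sigma>s \<tau>))"
  unfolding cst_ty.simps
proof (rule iapprox_funI, rule iapprox_funsI, rule iapprox_funI)
  fix j1 j2 j F F' Xs Xs' N N'
  assume *: "[] \<turnstile> F \<Colon> funs \<sigma>s (Nat\<^sub>t \<rightarrow> \<tau>)" "[] \<turnstile> F' \<Colon> funs \<sigma>s (Nat\<^sub>t \<rightarrow> \<tau>)"
    "iapprox (funs \<sigma>s (Nat\<^sub>t \<rightarrow> \<tau>)) j1 F F'" "j2 \<le> j1" "env \<sigma>s j2 Xs Xs'" "j \<le> j2"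
    "[] \<turnstile> N \<Colon> Nat\<^sub>t" "[] \<turnstile> N' \<Colon> Nat\<^sub>t" "iapprox Nat\<^sub>t j N N'"
  note len = env_length[OF *(5)]
  show "iapprox \<tau> j (apps (Const (ByvalC \<sigma>s \<tau>) \<cdot> F) Xs \<cdot> N) (apps (Const (ByvalC \<sigma>s \<tau>) \<cdot> F') Xs' \<cdot> N')"
  proof (rule iapprox_strict2[OF evctx_Byval[OF evctx_id len(1)] evctx_Byval[OF evctx_id len(2)] *(7,9)])
    fix i m assume "i \<le> j"
    then have "i \<le> j1" "i \<le> j2" using * by simp_all
    then have "iapprox (Nat\<^sub>t \<rightarrow> \<tau>) i (apps F Xs) (apps F' Xs')"
      using * by (blast intro: iapprox_funsD iapprox_mono env_mono)
    moreover have "iapprox Nat\<^sub>t i (num m) (num m)" "[] \<turnstile> num m \<Colon> Nat\<^sub>t"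
      by (simp_all add: typing_simps)
    ultimately have "iapprox \<tau> i (apps F Xs \<cdot> num m) (apps F' Xs' \<cdot> num m)"
      by (blast intro: iapprox_AppD)
    then show "iapprox \<tau> i (apps (Const (ByvalC \<sigma>s \<tau>) \<cdot> F) Xs \<cdot> num m)
        (apps (Const (ByvalC \<sigma>s \<tau>) \<cdot> F') Xs' \<cdot> num m)"
      by (rule iapprox_eval_stepI[OF step_Byval[OF len(1)] step_Byval[OF len(2)]])
  qed
qed

lemma iapprox_cst: "iapprox (cst_ty c) k (Const c) (Const c)"
  by (cases c)
     (simp_all only: iapprox_cst_Num iapprox_cst_Suc iapprox_cst_Pre iapprox_cst_Ifzero iapprox_cst_Y iapprox_cst_While iapprox_cst_Rec
       iapprox_cst_Min iapprox_cst_Byval)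

lemma approx_refl: "\<Gamma> \<turnstile> M \<Colon> \<tau> \<Longrightarrow> approx \<Gamma> M M \<tau>"
  using approx_replace_csts[of \<Gamma> M \<tau> Const Const] iapprox_cst by (simp add: approx_closed typing_simps)

subsection \<open>The induced equational theory\<close>

lemma approx_plug_closed: "ctx_typing \<rho> [] C \<tau> \<Longrightarrow> approx [] M M' \<rho> \<Longrightarrow> approx [] (plug C M) (plug C M') \<tau>"
  by (rule approx_plug) (auto intro: approx_refl)

text \<open>The second approximation must hold at every index since the run of \<open>M'\<close> has
  unknown length. At arrow types the right argument is related to itself by reflexivity, which is
  why this comes after the constants.\<close>

lemma iapprox_approx_trans: "iapprox \<tau> k M M' \<Longrightarrow> approx [] M' M'' \<tau> \<Longrightarrow> iapprox \<tau> k M M''"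
proof (induction \<tau> arbitrary: k M M' M'')
  case Nat\<^sub>t
  show ?case
  proof (unfold iapprox.simps, intro allI impI)
    fix j n assume "j \<le> k" "(step ^^ j) M (num n)"
    then have "M' \<leadsto>* num n" using Nat\<^sub>t(1) by simp
    then show "M'' \<leadsto>* num n" using Nat\<^sub>t(2) by (auto simp: approx_closed steps_relpowp)
  qed
next
  case (Fun \<sigma> \<tau>)
  show ?case
  proof (rule iapprox_funI)
    fix j X X' assume X: "j \<le> k" "[] \<turnstile> X \<Colon> \<sigma>" "[] \<turnstile> X' \<Colon> \<sigma>" "iapprox \<sigma> j X X'"
    then have "iapprox \<tau> j (M \<cdot> X) (M' \<cdot> X')" using Fun.prems(1) by simp
    then show "iapprox \<tau> j (M \<cdot> X) (M'' \<cdot> X')"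
      using Fun.IH(2) approx_App[OF Fun.prems(2) approx_refl[OF X(3)]] by blast
  qed
next
  case (Prod \<sigma> \<tau>)
  then show ?case using approx_Fst[OF Prod.prems(2)] approx_Snd[OF Prod.prems(2)] by auto
qed

lemma approx_trans: "approx [] M M' \<tau> \<Longrightarrow> approx [] M' M'' \<tau> \<Longrightarrow> approx [] M M'' \<tau>"
  using iapprox_approx_trans[of \<tau> _ M M' M''] by (simp add: approx_closed)

text \<open>The relation feeds two different arguments, the hypothesis only one: first move from
  \<open>X\<close> to \<open>X'\<close> under \<open>F\<close> by reflexivity of \<open>F\<close>,
  then from \<open>F\<close> to \<open>F'\<close> at \<open>X'\<close>.\<close>

lemma approx_funI:
  assumes F: "[] \<turnstile> F \<Colon> \<sigma> \<rightarrow> \<tau>" "[] \<turnstile> F' \<Colon> \<sigma> \<rightarrow> \<tau>"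
    and "\<And>X. [] \<turnstile> X \<Colon> \<sigma> \<Longrightarrow> approx [] (F \<cdot> X) (F' \<cdot> X) \<tau>"
  shows "approx [] F F' (\<sigma> \<rightarrow> \<tau>)"
proof -
  have "iapprox (\<sigma> \<rightarrow> \<tau>) k F F'" for k
  proof (rule iapprox_funI)
    fix j X X' assume X: "[] \<turnstile> X \<Colon> \<sigma>" "[] \<turnstile> X' \<Colon> \<sigma>" "iapprox \<sigma> j X X'"
    then have "iapprox \<tau> j (F \<cdot> X) (F \<cdot> X')"
      using approx_refl[OF F(1)] by (auto simp only: approx_closed intro: iapprox_AppD)
    then show "iapprox \<tau> j (F \<cdot> X) (F' \<cdot> X')"
      using assms(3)[OF X(2)] by (rule iapprox_approx_trans)
  qed
  then show ?thesis using F by (simp add: approx_closed)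
qed

lemma approx_prodI:
  assumes "[] \<turnstile> M \<Colon> \<sigma> \<otimes> \<tau>" "[] \<turnstile> M' \<Colon> \<sigma> \<otimes> \<tau>"
    and "approx [] (Fst M) (Fst M') \<sigma>" "approx [] (Snd M) (Snd M') \<tau>"
  shows "approx [] M M' (\<sigma> \<otimes> \<tau>)"
  using assms by (simp add: approx_closed)

definition equiv_tm :: "tm \<Rightarrow> ty \<Rightarrow> tm \<Rightarrow> bool"  ("_ \<approx>\<^bsub>_\<^esub> _" [51, 0, 51] 50) where
  "M \<approx>\<^bsub>\<tau>\<^esub> M' \<longleftrightarrow> approx [] M M' \<tau> \<and> approx [] M' M \<tau>"

lemma equiv_typing: "M \<approx>\<^bsub>\<tau>\<^esub> M' \<Longrightarrow> [] \<turnstile> M \<Colon> \<tau>" "M \<approx>\<^bsub>\<tau>\<^esub> M' \<Longrightarrow> [] \<turnstile> M' \<Colon> \<tau>"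
  by (simp_all add: equiv_tm_def approx_closed)

lemma equiv_refl: "[] \<turnstile> M \<Colon> \<tau> \<Longrightarrow> M \<approx>\<^bsub>\<tau>\<^esub> M"
  by (simp add: equiv_tm_def approx_refl)

lemma equiv_sym: "M \<approx>\<^bsub>\<tau>\<^esub> M' \<Longrightarrow> M' \<approx>\<^bsub>\<tau>\<^esub> M"
  by (simp add: equiv_tm_def)

lemma equiv_trans [trans]: "M \<approx>\<^bsub>\<tau>\<^esub> M' \<Longrightarrow> M' \<approx>\<^bsub>\<tau>\<^esub> M'' \<Longrightarrow> M \<approx>\<^bsub>\<tau>\<^esub> M''"
  by (auto simp: equiv_tm_def intro: approx_trans)

lemma equiv_App: "M \<approx>\<^bsub>\<sigma> \<rightarrow> \<tau>\<^esub> M' \<Longrightarrow> N \<approx>\<^bsub>\<sigma>\<^esub> N' \<Longrightarrow> M \<cdot> N \<approx>\<^bsub>\<tau>\<^esub> M' \<cdot> N'"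
  by (auto simp: equiv_tm_def intro: approx_App)

lemma equiv_AppR: "[] \<turnstile> M \<Colon> \<sigma> \<rightarrow> \<tau> \<Longrightarrow> N \<approx>\<^bsub>\<sigma>\<^esub> N' \<Longrightarrow> M \<cdot> N \<approx>\<^bsub>\<tau>\<^esub> M \<cdot> N'"
  by (rule equiv_App[OF equiv_refl])

lemma equiv_AppL: "M \<approx>\<^bsub>\<sigma> \<rightarrow> \<tau>\<^esub> M' \<Longrightarrow> [] \<turnstile> N \<Colon> \<sigma> \<Longrightarrow> M \<cdot> N \<approx>\<^bsub>\<tau>\<^esub> M' \<cdot> N"
  by (rule equiv_App[OF _ equiv_refl])

lemma equiv_Pair: "M \<approx>\<^bsub>\<sigma>\<^esub> M' \<Longrightarrow> N \<approx>\<^bsub>\<tau>\<^esub> N' \<Longrightarrow> Pair M N \<approx>\<^bsub>\<sigma> \<otimes> \<tau>\<^esub> Pair M' N'"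
  by (auto simp: equiv_tm_def intro: approx_Pair)

lemma equiv_Snd: "M \<approx>\<^bsub>\<sigma> \<otimes> \<tau>\<^esub> M' \<Longrightarrow> Snd M \<approx>\<^bsub>\<tau>\<^esub> Snd M'"
  by (auto simp: equiv_tm_def intro: approx_Snd)

lemma equiv_funI:
  assumes "[] \<turnstile> F \<Colon> \<sigma> \<rightarrow> \<tau>" "[] \<turnstile> F' \<Colon> \<sigma> \<rightarrow> \<tau>"
    and "\<And>X. [] \<turnstile> X \<Colon> \<sigma> \<Longrightarrow> F \<cdot> X \<approx>\<^bsub>\<tau>\<^esub> F' \<cdot> X"
  shows "F \<approx>\<^bsub>\<sigma> \<rightarrow> \<tau>\<^esub> F'"
  using assms by (auto simp: equiv_tm_def intro: approx_funI)

lemma equiv_prodI: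
  assumes "[] \<turnstile> M \<Colon> \<sigma> \<otimes> \<tau>" "[] \<turnstile> M' \<Colon> \<sigma> \<otimes> \<tau>"
    and "Fst M \<approx>\<^bsub>\<sigma>\<^esub> Fst M'" "Snd M \<approx>\<^bsub>\<tau>\<^esub> Snd M'"
  shows "M \<approx>\<^bsub>\<sigma> \<otimes> \<tau>\<^esub> M'"
  using assms by (auto simp: equiv_tm_def intro: approx_prodI)

lemma equiv_steps:
  assumes "M \<leadsto>* M'" "[] \<turnstile> M \<Colon> \<tau>"
  shows "M \<approx>\<^bsub>\<tau>\<^esub> M'"
proof -
  have ty: "[] \<turnstile> M' \<Colon> \<tau>" using assms by (rule preservation_steps)
  then have "iapprox \<tau> k M' M'" for k using approx_refl[OF ty] by (simp add: approx_closed)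
  then show ?thesis
    using assms ty by (auto simp: equiv_tm_def approx_closed intro: iapprox_steps_left iapprox_steps_right)
qed

lemma equiv_steps_rev: "M \<leadsto>* M' \<Longrightarrow> [] \<turnstile> M \<Colon> \<tau> \<Longrightarrow> M' \<approx>\<^bsub>\<tau>\<^esub> M"
  by (rule equiv_sym[OF equiv_steps])

lemma approx_Nat_iff:
  "approx [] M M' Nat\<^sub>t \<longleftrightarrow> [] \<turnstile> M \<Colon> Nat\<^sub>t \<and> [] \<turnstile> M' \<Colon> Nat\<^sub>t \<and> (\<forall>n. M \<leadsto>* num n \<longrightarrow> M' \<leadsto>* num n)"
  unfolding approx_closed iapprox.simps steps_relpowp[of M] by blast

lemma equiv_Nat_iff:
  "M \<approx>\<^bsub>Nat\<^sub>t\<^esub> M' \<longleftrightarrow> [] \<turnstile> M \<Colon> Nat\<^sub>t \<and> [] \<turnstile> M' \<Colon> Nat\<^sub>t \<and> (\<forall>n. M \<leadsto>* num n \<longleftrightarrow> M' \<leadsto>* num n)"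
  by (auto simp: equiv_tm_def approx_Nat_iff)

lemma equiv_replace_csts:
  assumes "[] \<turnstile> M \<Colon> \<tau>" "\<And>c. c \<in> csts_of M \<Longrightarrow> \<theta> c \<approx>\<^bsub>cst_ty c\<^esub> \<theta>' c"
  shows "replace_csts \<theta> M \<approx>\<^bsub>\<tau>\<^esub> replace_csts \<theta>' M"
  using assms approx_replace_csts[of "[]" M \<tau>] by (auto simp: equiv_tm_def)

lemma obs_eqI:
  assumes "closed_term lang_PCF_byval M \<sigma>" "closed_term lang_PCF_byval M' \<sigma>" "M \<approx>\<^bsub>\<sigma>\<^esub> M'"
  shows "M \<simeq>\<^bsub>\<sigma>\<^esub> M'"
proof -
  have "plug C M \<approx>\<^bsub>Nat\<^sub>t\<^esub> plug C M'" if "ctx_typing \<sigma> [] C Nat\<^sub>t" for C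
    using assms(3) approx_plug_closed[OF that] by (auto simp: equiv_tm_def)
  then show ?thesis using assms by (auto simp: obs_eq_def equiv_Nat_iff)
qed

subsection \<open>Divergence\<close>

text \<open>A least element instead of divergence, which speaks of numbers only;
  \<open>bottom_Nat_iff\<close> shows that the two agree at type \<open>Nat\<^sub>t\<close>.\<close>

definition bottom :: "ty \<Rightarrow> tm \<Rightarrow> bool" where
  "bottom \<tau> M \<longleftrightarrow> [] \<turnstile> M \<Colon> \<tau> \<and> (\<forall>Q. [] \<turnstile> Q \<Colon> \<tau> \<longrightarrow> approx [] M Q \<tau>)"

lemma bottom_equiv: "bottom \<tau> M \<Longrightarrow> bottom \<tau> M' \<Longrightarrow> M \<approx>\<^bsub>\<tau>\<^esub> M'"
  by (simp add: bottom_def equiv_tm_def)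

lemma equiv_bottom: "M \<approx>\<^bsub>\<tau>\<^esub> M' \<Longrightarrow> bottom \<tau> M' \<Longrightarrow> bottom \<tau> M"
  unfolding bottom_def using equiv_typing(1) by (auto simp: equiv_tm_def intro: approx_trans)

lemma bottomI:
  assumes "[] \<turnstile> M \<Colon> \<tau>" "\<And>k Q. [] \<turnstile> Q \<Colon> \<tau> \<Longrightarrow> iapprox \<tau> k M Q"
  shows "bottom \<tau> M"
  using assms by (simp add: bottom_def approx_closed)

lemma bottom_lr: "bottom \<tau> M \<Longrightarrow> [] \<turnstile> Q \<Colon> \<tau> \<Longrightarrow> iapprox \<tau> k M Q"
  by (simp add: bottom_def approx_closed)

lemma bottom_strict:
  assumes "evctx E" "[] \<turnstile> M \<Colon> Nat\<^sub>t" "diverges M" "[] \<turnstile> E M \<Colon> \<tau>"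
  shows "bottom \<tau> (E M)"
proof (rule bottomI[OF assms(4)], rule iapprox_strict[OF assms(1,2)])
  fix k i m Q assume "(step ^^ i) M (num m)"
  then show "iapprox \<tau> (k - i) (E (num m)) Q"
    using assms(3) by (auto simp: diverges_def steps_relpowp)
qed

lemma bottom_Nat_iff: "bottom Nat\<^sub>t M \<longleftrightarrow> [] \<turnstile> M \<Colon> Nat\<^sub>t \<and> diverges M"
proof
  assume M: "bottom Nat\<^sub>t M"
  \<comment> \<open>A bottom term with value \<open>n\<close> approximates every numeral
    \<open>num m\<close>, which forces all \<open>m\<close> to equal \<open>n\<close>.\<close>
  have "n = m" if n: "M \<leadsto>* num n" for n m
  proof -
    obtain j where j: "(step ^^ j) M (num n)" using n by (auto simp: steps_relpowp)
    have "[] \<turnstile> num m \<Colon> Nat\<^sub>t" by (simp add: typing_simps)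
    from bottom_lr[OF M this, of j] j show ?thesis by auto
  qed
  then have "diverges M" by (metis diverges_def n_not_Suc_n)
  with M show "[] \<turnstile> M \<Colon> Nat\<^sub>t \<and> diverges M" by (simp add: bottom_def)
qed (auto intro: bottom_strict[OF evctx_id])

lemma bottom_Snd: "bottom (\<sigma> \<otimes> \<tau>) M \<Longrightarrow> bottom \<tau> (Snd M)"
  unfolding bottom_def
proof (elim conjE, intro conjI allI impI)
  fix Q assume M: "[] \<turnstile> M \<Colon> \<sigma> \<otimes> \<tau>" "\<forall>Q. [] \<turnstile> Q \<Colon> \<sigma> \<otimes> \<tau> \<longrightarrow> approx [] M Q (\<sigma> \<otimes> \<tau>)"
    and Q: "[] \<turnstile> Q \<Colon> \<tau>"
  \<comment> \<open>Every \<open>Q\<close> is a second projection of some pair above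
    \<open>M\<close>; \<open>Fst M\<close> is a term of the right type at hand for the other
    component.\<close>
  have "[] \<turnstile> Pair (Fst M) Q \<Colon> \<sigma> \<otimes> \<tau>"
    using M(1) Q by (auto intro: typing_Pair typing_Fst)
  then have "approx [] (Snd M) (Snd (Pair (Fst M) Q)) \<tau>" and "Snd (Pair (Fst M) Q) \<approx>\<^bsub>\<tau>\<^esub> Q"
    using M(2) by (auto intro: approx_Snd equiv_steps step_steps step_SndPair typing_Snd)
  then show "approx [] (Snd M) Q \<tau>"
    by (auto simp: equiv_tm_def intro: approx_trans)
qed (rule typing_Snd)

lemma bottom_funI:
  assumes "[] \<turnstile> F \<Colon> \<sigma> \<rightarrow> \<tau>" "\<And>X. [] \<turnstile> X \<Colon> \<sigma> \<Longrightarrow> bottom \<tau> (F \<cdot> X)"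
  shows "bottom (\<sigma> \<rightarrow> \<tau>) F"
  using assms by (auto simp: bottom_def intro!: approx_funI intro: typing_App)

lemma bottom_prodI:
  assumes "[] \<turnstile> M \<Colon> \<sigma> \<otimes> \<tau>" "bottom \<sigma> (Fst M)" "bottom \<tau> (Snd M)"
  shows "bottom (\<sigma> \<otimes> \<tau>) M"
  using assms by (auto simp: bottom_def intro!: approx_prodI intro: typing_Fst typing_Snd)

lemma Nat_cases:
  obtains n where "M \<leadsto>* num n" | "diverges M"
  by (auto simp: diverges_def)

subsection \<open>Reduction of programs\<close>

lemma beta_close:
  assumes "closed N" "\<forall>V \<in> set Vs. closed V"
  shows "close Vs 0 (Lam \<sigma> M) \<cdot> N \<leadsto> close (N # Vs) 0 M"
  using step_beta[of \<sigma> "close Vs 1 M" N] subst_close[OF assms, of 0 M] by simp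

text \<open>The reduct is tied to a variable \<open>R\<close> by an equation, so that
  \<open>simp\<close> computes the simultaneous substitution for a concrete body and matches the
  displayed result.\<close>

lemma beta1: "closed X \<Longrightarrow> close [X] 0 M = R \<Longrightarrow> Lam \<sigma> M \<cdot> X \<leadsto>* R"
  using beta_close[of X "[]" \<sigma> M] by (auto intro: step_steps)

lemma beta2:
  "closed X \<Longrightarrow> closed Y \<Longrightarrow> close [Y, X] 0 M = R \<Longrightarrow> Lam \<sigma> (Lam \<rho> M) \<cdot> X \<cdot> Y \<leadsto>* R"
  using steps_AppL[OF beta1[of X "Lam \<rho> M" _ \<sigma>, OF _ refl], of Y] beta_close[of Y "[X]" \<rho> M]
  by (auto simp del: close.simps intro: rtranclp.rtrancl_into_rtrancl)

lemma beta3: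
  "closed X \<Longrightarrow> closed Y \<Longrightarrow> closed Z \<Longrightarrow> close [Z, Y, X] 0 M = R \<Longrightarrow>
   Lam \<sigma> (Lam \<rho> (Lam \<mu> M)) \<cdot> X \<cdot> Y \<cdot> Z \<leadsto>* R"
  using steps_AppL[OF beta2[of X Y "Lam \<mu> M" _ \<sigma> \<rho>, OF _ _ refl], of Z] beta_close[of Z "[Y, X]" \<mu> M]
  by (auto simp del: close.simps intro: rtranclp.rtrancl_into_rtrancl)

lemma beta4:
  "closed X \<Longrightarrow> closed Y \<Longrightarrow> closed Z \<Longrightarrow> closed W \<Longrightarrow> close [W, Z, Y, X] 0 M = R \<Longrightarrow>
   Lam \<sigma> (Lam \<rho> (Lam \<mu> (Lam \<nu> M))) \<cdot> X \<cdot> Y \<cdot> Z \<cdot> W \<leadsto>* R"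
  using steps_AppL[OF beta3[of X Y Z "Lam \<nu> M" _ \<sigma> \<rho> \<mu>, OF _ _ _ refl], of W]
    beta_close[of W "[Z, Y, X]" \<nu> M]
  by (auto simp del: close.simps intro: rtranclp.rtrancl_into_rtrancl)

lemma ifzero_Fun_steps:
  assumes "closed D" "closed A" "closed B" "closed X"
  shows "ifzero (\<sigma> \<rightarrow> \<tau>) \<cdot> D \<cdot> A \<cdot> B \<cdot> X \<leadsto>* ifzero \<tau> \<cdot> D \<cdot> (A \<cdot> X) \<cdot> (B \<cdot> X)"
  unfolding ifzero.simps by (rule beta4) (simp_all add: assms)

lemma ifzero_Prod_steps:
  assumes "closed D" "closed A" "closed B"
  shows "ifzero (\<sigma> \<otimes> \<tau>) \<cdot> D \<cdot> A \<cdot> B \<leadsto>*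
    Pair (ifzero \<sigma> \<cdot> D \<cdot> Fst A \<cdot> Fst B) (ifzero \<tau> \<cdot> D \<cdot> Snd A \<cdot> Snd B)"
  unfolding ifzero.simps by (rule beta3) (simp_all add: assms)

lemma typing_ifzero_apps:
  "[] \<turnstile> D \<Colon> Nat\<^sub>t \<Longrightarrow> [] \<turnstile> A \<Colon> \<sigma> \<Longrightarrow> [] \<turnstile> B \<Colon> \<sigma> \<Longrightarrow> [] \<turnstile> ifzero \<sigma> \<cdot> D \<cdot> A \<cdot> B \<Colon> \<sigma>"
  by (rule typing_App[OF typing_App[OF typing_App[OF typing_ifzero]]])

lemma ifzero_Fst_equiv:
  assumes "[] \<turnstile> D \<Colon> Nat\<^sub>t" "[] \<turnstile> A \<Colon> \<sigma> \<otimes> \<tau>" "[] \<turnstile> B \<Colon> \<sigma> \<otimes> \<tau>"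
  shows "Fst (ifzero (\<sigma> \<otimes> \<tau>) \<cdot> D \<cdot> A \<cdot> B) \<approx>\<^bsub>\<sigma>\<^esub> ifzero \<sigma> \<cdot> D \<cdot> Fst A \<cdot> Fst B"
    and "Snd (ifzero (\<sigma> \<otimes> \<tau>) \<cdot> D \<cdot> A \<cdot> B) \<approx>\<^bsub>\<tau>\<^esub> ifzero \<tau> \<cdot> D \<cdot> Snd A \<cdot> Snd B"
proof -
  note steps = ifzero_Prod_steps[OF assms[THEN closedI], of \<sigma> \<tau>]
  note ty = typing_ifzero_apps[OF assms]
  show "Fst (ifzero (\<sigma> \<otimes> \<tau>) \<cdot> D \<cdot> A \<cdot> B) \<approx>\<^bsub>\<sigma>\<^esub> ifzero \<sigma> \<cdot> D \<cdot> Fst A \<cdot> Fst B"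
    by (rule equiv_steps[OF rtranclp_trans[OF steps_Fst[OF steps] step_steps[OF step_FstPair]] typing_Fst[OF ty]])
  show "Snd (ifzero (\<sigma> \<otimes> \<tau>) \<cdot> D \<cdot> A \<cdot> B) \<approx>\<^bsub>\<tau>\<^esub> ifzero \<tau> \<cdot> D \<cdot> Snd A \<cdot> Snd B"
    by (rule equiv_steps[OF rtranclp_trans[OF steps_Snd[OF steps] step_steps[OF step_SndPair]] typing_Snd[OF ty]])
qed

lemma ifzero_Fun_equiv:
  assumes "[] \<turnstile> D \<Colon> Nat\<^sub>t" "[] \<turnstile> A \<Colon> \<sigma> \<rightarrow> \<tau>" "[] \<turnstile> B \<Colon> \<sigma> \<rightarrow> \<tau>" "[] \<turnstile> X \<Colon> \<sigma>"
  shows "ifzero (\<sigma> \<rightarrow> \<tau>) \<cdot> D \<cdot> A \<cdot> B \<cdot> X \<approx>\<^bsub>\<tau>\<^esub> ifzero \<tau> \<cdot> D \<cdot> (A \<cdot> X) \<cdot> (B \<cdot> X)"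
  by (rule equiv_steps[OF ifzero_Fun_steps[OF assms[THEN closedI]]
        typing_App[OF typing_ifzero_apps[OF assms(1-3)] assms(4)]])

text \<open>At arrow and product types \<open>ifzero\<close> is a plain abstraction that forces
  nothing by itself; applying or projecting it leads, by induction on the type, to the strict test
  at type \<open>Nat\<^sub>t\<close>.\<close>

lemma bottom_ifzero:
  assumes "[] \<turnstile> D \<Colon> Nat\<^sub>t" "diverges D" "[] \<turnstile> A \<Colon> \<sigma>" "[] \<turnstile> B \<Colon> \<sigma>"
  shows "bottom \<sigma> (ifzero \<sigma> \<cdot> D \<cdot> A \<cdot> B)"
  using assms(3,4)
proof (induction \<sigma> arbitrary: A B rule: ty.induct)
  case Nat\<^sub>t
  then show ?case
    using bottom_strict[OF evctx_App[OF evctx_App[OF evctx_Ifzero[OF evctx_id]]] assms(1,2)]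
      typing_ifzero_apps[OF assms(1)] by force
next
  case (Fun \<sigma> \<tau>)
  show ?case
  proof (rule bottom_funI[OF typing_ifzero_apps[OF assms(1) Fun.prems]])
    fix X assume X: "[] \<turnstile> X \<Colon> \<sigma>"
    show "bottom \<tau> (ifzero (\<sigma> \<rightarrow> \<tau>) \<cdot> D \<cdot> A \<cdot> B \<cdot> X)"
      by (rule equiv_bottom[OF ifzero_Fun_equiv[OF assms(1) Fun.prems X] Fun.IH(2)])
         (use Fun.prems X in \<open>auto intro: typing_App\<close>)
  qed
next
  case (Prod \<sigma> \<tau>)
  note eq = ifzero_Fst_equiv[OF assms(1) Prod.prems]
  show ?case
    by (rule bottom_prodI[OF typing_ifzero_apps[OF assms(1) Prod.prems]
          equiv_bottom[OF eq(1) Prod.IH(1)] equiv_bottom[OF eq(2) Prod.IH(2)]])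
       (use Prod.prems in \<open>auto intro: typing_Fst typing_Snd\<close>)
qed

lemma Ifzero_0_steps: "closed A \<Longrightarrow> closed B \<Longrightarrow> D \<leadsto>* num 0 \<Longrightarrow> Const IfzeroC \<cdot> D \<cdot> A \<cdot> B \<leadsto>* A"
  using rtranclp_trans[OF evctx_steps[OF evctx_App[OF evctx_App[OF evctx_Ifzero[OF evctx_id]]], of D "num 0" A B]
      rtranclp_trans[OF step_steps[OF step_AppL[OF step_AppL[OF step_Ifzero_0]]] beta2[of A B "Var 1" A "Nat\<^sub>t" "Nat\<^sub>t"]]]
  by simp

lemma Ifzero_Suc_steps: "closed A \<Longrightarrow> closed B \<Longrightarrow> D \<leadsto>* num (Suc n) \<Longrightarrow> Const IfzeroC \<cdot> D \<cdot> A \<cdot> B \<leadsto>* B"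
  using rtranclp_trans[OF evctx_steps[OF evctx_App[OF evctx_App[OF evctx_Ifzero[OF evctx_id]]], of D "num (n + 1)" A B]
      rtranclp_trans[OF step_steps[OF step_AppL[OF step_AppL[OF step_Ifzero_Suc]]] beta2[of A B "Var 0" B "Nat\<^sub>t" "Nat\<^sub>t"]]]
  by simp

text \<open>At higher types the conditional does not reduce to its branch, so only equivalence is
  claimed. The chosen branch is a variable \<open>C\<close> of its own, which lets the induction on
  the type pass to \<open>C \<cdot> X\<close> or to its projections.\<close>

lemma ifzero_equiv:
  assumes "[] \<turnstile> D \<Colon> Nat\<^sub>t" "[] \<turnstile> A \<Colon> \<sigma>" "[] \<turnstile> B \<Colon> \<sigma>"
    and D: "D \<leadsto>* num m" "C = (if m = 0 then A else B)"
  shows "ifzero \<sigma> \<cdot> D \<cdot> A \<cdot> B \<approx>\<^bsub>\<sigma>\<^esub> C"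
  using assms(2-3) D(2)
proof (induction \<sigma> arbitrary: A B C rule: ty.induct)
  case Nat\<^sub>t
  then have "Const IfzeroC \<cdot> D \<cdot> A \<cdot> B \<leadsto>* C"
    using D(1) by (cases m) (simp_all add: Ifzero_0_steps Ifzero_Suc_steps closedI)
  then show ?case
    using equiv_steps typing_ifzero_apps[OF assms(1) Nat\<^sub>t(1,2)] by simp
next
  case (Fun \<sigma> \<tau>)
  show ?case
  proof (rule equiv_funI[OF typing_ifzero_apps[OF assms(1) Fun.prems(1,2)]])
    fix X assume X: "[] \<turnstile> X \<Colon> \<sigma>"
    show "ifzero (\<sigma> \<rightarrow> \<tau>) \<cdot> D \<cdot> A \<cdot> B \<cdot> X \<approx>\<^bsub>\<tau>\<^esub> C \<cdot> X"
      by (rule equiv_trans[OF ifzero_Fun_equiv[OF assms(1) Fun.prems(1,2) X] Fun.IH(2)])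
         (use Fun.prems X in \<open>auto intro: typing_App\<close>)
  qed (use Fun.prems in simp)
next
  case (Prod \<sigma> \<tau>)
  note eq = ifzero_Fst_equiv[OF assms(1) Prod.prems(1,2)]
  show ?case
    by (rule equiv_prodI[OF typing_ifzero_apps[OF assms(1) Prod.prems(1,2)] _
          equiv_trans[OF eq(1) Prod.IH(1)] equiv_trans[OF eq(2) Prod.IH(2)]])
       (use Prod.prems in \<open>auto intro: typing_Fst typing_Snd\<close>)
qed

subsection \<open>The PCF programs agree with the constants\<close>

definition while_fun :: "ty \<Rightarrow> tm \<Rightarrow> tm \<Rightarrow> tm" where
  "while_fun \<sigma> C F = Lam (\<sigma> \<rightarrow> \<sigma>) (Lam \<sigma>
     (ifzero \<sigma> \<cdot> (C \<cdot> Var 0) \<cdot> (Var 1 \<cdot> (F \<cdot> Var 0)) \<cdot> Var 0))"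

lemma typing_while_fun:
  "[] \<turnstile> C \<Colon> \<sigma> \<rightarrow> Nat\<^sub>t \<Longrightarrow> [] \<turnstile> F \<Colon> \<sigma> \<rightarrow> \<sigma> \<Longrightarrow>
   [] \<turnstile> Const (YC (\<sigma> \<rightarrow> \<sigma>)) \<cdot> while_fun \<sigma> C F \<Colon> \<sigma> \<rightarrow> \<sigma>"
  by (simp add: typing_iff_infer[of "[]" "_ \<cdot> _"] while_fun_def infer_closed)

lemma while_fun_steps:
  "closed C \<Longrightarrow> closed F \<Longrightarrow> closed W \<Longrightarrow> closed X \<Longrightarrow>
   while_fun \<sigma> C F \<cdot> W \<cdot> X \<leadsto>* ifzero \<sigma> \<cdot> (C \<cdot> X) \<cdot> (W \<cdot> (F \<cdot> X)) \<cdot> X"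
  unfolding while_fun_def by (rule beta2) simp_all

lemma typing_While_prog: "[] \<turnstile> While_prog \<sigma> \<Colon> cst_ty (WhileC \<sigma>)"
  by (simp add: typing_iff_infer While_prog_def nth_Cons' numeral_eq_Suc)

lemma While_prog_equiv: "While_prog \<sigma> \<approx>\<^bsub>cst_ty (WhileC \<sigma>)\<^esub> Const (WhileC \<sigma>)"
  unfolding cst_ty.simps
proof (intro equiv_funI)
  fix C X F
  assume C: "[] \<turnstile> C \<Colon> \<sigma> \<rightarrow> Nat\<^sub>t" and X: "[] \<turnstile> X \<Colon> \<sigma>" and F: "[] \<turnstile> F \<Colon> \<sigma> \<rightarrow> \<sigma>"
  note [simp] = closedI[OF C] closedI[OF X] closedI[OF F]
  \<comment> \<open>\<open>While_prog\<close> reduces to \<open>?A\<close>, and \<open>?A\<close>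
    and the constant \<open>?B\<close> satisfy the same unfolding equation; comparing them in both
    directions gives the equivalence.\<close>
  let ?A = "\<lambda>C X F. Const (YC (\<sigma> \<rightarrow> \<sigma>)) \<cdot> while_fun \<sigma> C F \<cdot> X"
  let ?B = "\<lambda>C X F. Const (WhileC \<sigma>) \<cdot> C \<cdot> X \<cdot> F"
  have A: "[] \<turnstile> ?A C X F \<Colon> \<sigma> \<and> (\<exists>M. ?A C X F \<leadsto> M \<and> M \<leadsto>* ifzero \<sigma> \<cdot> (C \<cdot> X) \<cdot> ?A C (F \<cdot> X) F \<cdot> X)"
    if "[] \<turnstile> C \<Colon> \<sigma> \<rightarrow> Nat\<^sub>t" "[] \<turnstile> X \<Colon> \<sigma>" "[] \<turnstile> F \<Colon> \<sigma> \<rightarrow> \<sigma>" for C X F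
  proof -
    let ?w = "Const (YC (\<sigma> \<rightarrow> \<sigma>)) \<cdot> while_fun \<sigma> C F"
    note ty = typing_while_fun[OF that(1,3)]
    have "while_fun \<sigma> C F \<cdot> ?w \<cdot> X \<leadsto>* ifzero \<sigma> \<cdot> (C \<cdot> X) \<cdot> ?A C (F \<cdot> X) F \<cdot> X"
      by (rule while_fun_steps) (use closedI[OF ty] that[THEN closedI] in simp_all)
    then show ?thesis
      using typing_App[OF ty that(2)] step_AppL[OF step_Y] by blast
  qed
  have B: "[] \<turnstile> ?B C X F \<Colon> \<sigma> \<and> (\<exists>M. ?B C X F \<leadsto> M \<and> M \<leadsto>* ifzero \<sigma> \<cdot> (C \<cdot> X) \<cdot> ?B C (F \<cdot> X) F \<cdot> X)"
    if "[] \<turnstile> C \<Colon> \<sigma> \<rightarrow> Nat\<^sub>t" "[] \<turnstile> X \<Colon> \<sigma>" "[] \<turnstile> F \<Colon> \<sigma> \<rightarrow> \<sigma>" for C X F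
  proof -
    have "[] \<turnstile> ?B C X F \<Colon> \<sigma>" using that by (simp add: typing_simps)
    then show ?thesis using step_While by blast
  qed
  note refl = approx_refl[OF C] approx_refl[OF X] approx_refl[OF F]
  have A': "[] \<turnstile> ?A C X F \<Colon> \<sigma> \<and> ?A C X F \<leadsto>* ifzero \<sigma> \<cdot> (C \<cdot> X) \<cdot> ?A C (F \<cdot> X) F \<cdot> X"
    and B': "[] \<turnstile> ?B C X F \<Colon> \<sigma> \<and> ?B C X F \<leadsto>* ifzero \<sigma> \<cdot> (C \<cdot> X) \<cdot> ?B C (F \<cdot> X) F \<cdot> X"
    if "[] \<turnstile> C \<Colon> \<sigma> \<rightarrow> Nat\<^sub>t" "[] \<turnstile> X \<Colon> \<sigma>" "[] \<turnstile> F \<Colon> \<sigma> \<rightarrow> \<sigma>" for C X F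
    using A[OF that] B[OF that] by (blast intro: converse_rtranclp_into_rtranclp)+
  have "iapprox \<sigma> k (?A C X F) (?B C X F)" and "iapprox \<sigma> k (?B C X F) (?A C X F)" for k
    by (rule iapprox_while_unfolding[where A = ?A and A' = ?B, OF A B' C C _ F F _ X X]
          iapprox_while_unfolding[where A = ?B and A' = ?A, OF B A' C C _ F F _ X X];
        use refl in \<open>simp only: approx_closed\<close>)+
  then have "?A C X F \<approx>\<^bsub>\<sigma>\<^esub> ?B C X F"
    using A[OF C X F] B[OF C X F] by (simp add: equiv_tm_def approx_closed)
  moreover have "While_prog \<sigma> \<cdot> C \<cdot> X \<cdot> F \<leadsto>* ?A C X F"
    unfolding While_prog_def by (rule beta3) (simp_all add: while_fun_def)
  moreover have "[] \<turnstile> While_prog \<sigma> \<cdot> C \<cdot> X \<cdot> F \<Colon> \<sigma>"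
    using C X F typing_While_prog by (auto intro!: typing_App)
  ultimately show "While_prog \<sigma> \<cdot> C \<cdot> X \<cdot> F \<approx>\<^bsub>\<sigma>\<^esub> ?B C X F"
    by (blast intro: equiv_trans equiv_steps)
qed (use typing_While_prog[of \<sigma>] in \<open>auto intro: typing_App simp: typing_simps\<close>)

definition rec_fun :: "ty \<Rightarrow> tm" where
  "rec_fun \<sigma> = Lam (ty_of_rec \<sigma>) (Lam \<sigma> (Lam (\<sigma> \<rightarrow> Nat\<^sub>t \<rightarrow> \<sigma>) (Lam Nat\<^sub>t
     (ifzero \<sigma> \<cdot> Var 0 \<cdot> Var 2 \<cdot>
       (Const (ByvalC [] \<sigma>) \<cdot>
          Lam Nat\<^sub>t (Var 2 \<cdot> (byval_plus \<sigma> \<cdot> Var 4 \<cdot> Var 3 \<cdot> Var 2 \<cdot> Var 0) \<cdot> Var 0) \<cdot>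
        (Const PreC \<cdot> Var 0))))))"

lemma rec_fun_steps:
  "closed X \<Longrightarrow> closed F \<Longrightarrow> closed R \<Longrightarrow> closed N \<Longrightarrow> rec_fun \<sigma> \<cdot> R \<cdot> X \<cdot> F \<cdot> N \<leadsto>* ifzero \<sigma> \<cdot> N \<cdot> X \<cdot>
     (Const (ByvalC [] \<sigma>) \<cdot> Lam Nat\<^sub>t (F \<cdot> (byval_plus \<sigma> \<cdot> R \<cdot> X \<cdot> F \<cdot> Var 0) \<cdot> Var 0) \<cdot> (Const PreC \<cdot> N))"
  unfolding rec_fun_def by (rule beta4) (simp_all add: numeral_eq_Suc)

lemma Rec_prog_fold: "Rec_prog \<sigma> = byval_plus \<sigma> \<cdot> (Const (YC (ty_of_rec \<sigma>)) \<cdot> rec_fun \<sigma>)"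
  by (simp add: Rec_prog_def rec_fun_def)

lemma typing_rec_fun: "[] \<turnstile> Const (YC (ty_of_rec \<sigma>)) \<cdot> rec_fun \<sigma> \<Colon> ty_of_rec \<sigma>"
  by (simp add: typing_iff_infer rec_fun_def nth_Cons' numeral_eq_Suc)

lemma typing_Rec_prog: "[] \<turnstile> Rec_prog \<sigma> \<Colon> cst_ty (RecC \<sigma>)"
  using typing_rec_fun[of \<sigma>] by (simp add: Rec_prog_fold typing_simps(1,3))

text \<open>The outer \<open>byval_plus\<close> is what makes the program force its number, as the
  constant does.\<close>

lemma evctx_Rec_prog: "evctx (\<lambda>N. Rec_prog \<sigma> \<cdot> X \<cdot> F \<cdot> N)"
  using evctx_Byval[OF evctx_id, of "[X, F]" "[\<sigma>, \<sigma> \<rightarrow> Nat\<^sub>t \<rightarrow> \<sigma>]"] by (simp add: Rec_prog_fold)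

lemma Rec_prog_unfold:
  assumes X: "[] \<turnstile> X \<Colon> \<sigma>" and F: "[] \<turnstile> F \<Colon> \<sigma> \<rightarrow> Nat\<^sub>t \<rightarrow> \<sigma>"
  shows "Rec_prog \<sigma> \<cdot> X \<cdot> F \<cdot> num n \<leadsto>* ifzero \<sigma> \<cdot> num n \<cdot> X \<cdot>
    (Const (ByvalC [] \<sigma>) \<cdot> Lam Nat\<^sub>t (F \<cdot> (Rec_prog \<sigma> \<cdot> X \<cdot> F \<cdot> Var 0) \<cdot> Var 0) \<cdot> (Const PreC \<cdot> num n))"
    (is "_ \<leadsto>* ?R")
proof -
  let ?r = "Const (YC (ty_of_rec \<sigma>)) \<cdot> rec_fun \<sigma>"
  have num: "closed (num n)" by (rule closedI[OF typing.intros(2)])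
  have "Rec_prog \<sigma> \<cdot> X \<cdot> F \<cdot> num n \<leadsto> ?r \<cdot> X \<cdot> F \<cdot> num n"
    using step_Byval[of "[X, F]" "[\<sigma>, \<sigma> \<rightarrow> Nat\<^sub>t \<rightarrow> \<sigma>]"] by (simp add: Rec_prog_fold)
  moreover have "?r \<cdot> X \<cdot> F \<cdot> num n \<leadsto> rec_fun \<sigma> \<cdot> ?r \<cdot> X \<cdot> F \<cdot> num n"
    by (intro step_AppL step_Y)
  moreover have "rec_fun \<sigma> \<cdot> ?r \<cdot> X \<cdot> F \<cdot> num n \<leadsto>* ?R"
    unfolding Rec_prog_fold
    by (rule rec_fun_steps[OF closedI[OF X] closedI[OF F] closedI[OF typing_rec_fun] num])
  ultimately show ?thesis by (blast intro: converse_rtranclp_into_rtranclp)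
qed

lemma Rec_prog_equiv: "Rec_prog \<sigma> \<approx>\<^bsub>cst_ty (RecC \<sigma>)\<^esub> Const (RecC \<sigma>)"
  unfolding cst_ty.simps
proof (intro equiv_funI)
  fix X F N
  assume X: "[] \<turnstile> X \<Colon> \<sigma>" and F: "[] \<turnstile> F \<Colon> \<sigma> \<rightarrow> Nat\<^sub>t \<rightarrow> \<sigma>" and N: "[] \<turnstile> N \<Colon> Nat\<^sub>t"
  have ty: "[] \<turnstile> Rec_prog \<sigma> \<cdot> X \<cdot> F \<cdot> N \<Colon> \<sigma>" "[] \<turnstile> Const (RecC \<sigma>) \<cdot> X \<cdot> F \<cdot> N \<Colon> \<sigma>" if "[] \<turnstile> N \<Colon> Nat\<^sub>t" for N
    using X F that typing_Rec_prog[of \<sigma>] by (auto intro!: typing_App simp: typing_simps(1))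
  have num: "[] \<turnstile> num n \<Colon> Nat\<^sub>t" for n by (simp add: typing_simps)
  note [simp] = closedI[OF X] closedI[OF F]
  have Rec_num: "Rec_prog \<sigma> \<cdot> X \<cdot> F \<cdot> num n \<approx>\<^bsub>\<sigma>\<^esub> Const (RecC \<sigma>) \<cdot> X \<cdot> F \<cdot> num n" for n
  proof (induction n)
    case (Suc n)
    let ?L = "Lam Nat\<^sub>t (F \<cdot> (Rec_prog \<sigma> \<cdot> X \<cdot> F \<cdot> Var 0) \<cdot> Var 0)"
    let ?B = "Const (ByvalC [] \<sigma>) \<cdot> ?L \<cdot> (Const PreC \<cdot> num (Suc n))"
    have L: "[] \<turnstile> ?B \<Colon> \<sigma>"
      using X F typing_Rec_prog[of \<sigma>] by (simp add: typing_iff_infer[of "[]" "_ \<cdot> _"] infer_closed)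
    have "Rec_prog \<sigma> \<cdot> X \<cdot> F \<cdot> num (Suc n) \<approx>\<^bsub>\<sigma>\<^esub> ifzero \<sigma> \<cdot> num (Suc n) \<cdot> X \<cdot> ?B"
      by (rule equiv_steps[OF Rec_prog_unfold[OF X F] ty(1)[OF num]])
    also have "\<dots> \<approx>\<^bsub>\<sigma>\<^esub> ?B"
      by (rule ifzero_equiv[OF num X L rtranclp.rtrancl_refl]) simp
    also have "?B \<approx>\<^bsub>\<sigma>\<^esub> F \<cdot> (Rec_prog \<sigma> \<cdot> X \<cdot> F \<cdot> num n) \<cdot> num n"
    proof (rule equiv_steps[OF _ L])
      \<comment> \<open>\<open>byval\<close> with the empty list evaluates the predecessor before
        the abstraction receives it, so the recursive call is on a numeral and the induction
        hypothesis fits.\<close>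
      have "?B \<leadsto>* Const (ByvalC [] \<sigma>) \<cdot> ?L \<cdot> num n"
        using evctx_step[OF evctx_Byval[OF evctx_id, of "[]" "[]"] step_Pre_Suc] by (simp add: step_steps)
      also have "\<dots> \<leadsto>* ?L \<cdot> num n"
        using step_Byval[of "[]" "[]"] by (simp add: step_steps)
      also have "\<dots> \<leadsto>* F \<cdot> (Rec_prog \<sigma> \<cdot> X \<cdot> F \<cdot> num n) \<cdot> num n"
        by (rule beta1) (simp_all add: closedI[OF num] closedI[OF typing_Rec_prog])
      finally show "?B \<leadsto>* F \<cdot> (Rec_prog \<sigma> \<cdot> X \<cdot> F \<cdot> num n) \<cdot> num n" .
    qed
    also have "\<dots> \<approx>\<^bsub>\<sigma>\<^esub> F \<cdot> (Const (RecC \<sigma>) \<cdot> X \<cdot> F \<cdot> num n) \<cdot> num n"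
      by (rule equiv_AppL[OF equiv_AppR[OF F Suc] num])
    also have "\<dots> \<approx>\<^bsub>\<sigma>\<^esub> Const (RecC \<sigma>) \<cdot> X \<cdot> F \<cdot> num (Suc n)"
      using equiv_steps_rev[OF step_steps[OF step_Rec_Suc] ty(2)[OF num]] by simp
    finally show ?case .
  next
    case 0
    let ?B = "Const (ByvalC [] \<sigma>) \<cdot> Lam Nat\<^sub>t (F \<cdot> (Rec_prog \<sigma> \<cdot> X \<cdot> F \<cdot> Var 0) \<cdot> Var 0) \<cdot> (Const PreC \<cdot> num 0)"
    have L: "[] \<turnstile> ?B \<Colon> \<sigma>"
      using X F typing_Rec_prog[of \<sigma>] by (simp add: typing_iff_infer[of "[]" "_ \<cdot> _"] infer_closed)
    have "Rec_prog \<sigma> \<cdot> X \<cdot> F \<cdot> num 0 \<approx>\<^bsub>\<sigma>\<^esub> ifzero \<sigma> \<cdot> num 0 \<cdot> X \<cdot> ?B"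
      by (rule equiv_steps[OF Rec_prog_unfold[OF X F] ty(1)[OF num]])
    also have "\<dots> \<approx>\<^bsub>\<sigma>\<^esub> X"
      by (rule ifzero_equiv[OF num X L rtranclp.rtrancl_refl]) simp
    also have "X \<approx>\<^bsub>\<sigma>\<^esub> Const (RecC \<sigma>) \<cdot> X \<cdot> F \<cdot> num 0"
      by (rule equiv_steps_rev[OF step_steps[OF step_Rec_0] ty(2)[OF num]])
    finally show ?case .
  qed
  note strict = evctx_Rec_prog[of \<sigma> X F] evctx_Rec[OF evctx_id, of \<sigma> X F]
  show "Rec_prog \<sigma> \<cdot> X \<cdot> F \<cdot> N \<approx>\<^bsub>\<sigma>\<^esub> Const (RecC \<sigma>) \<cdot> X \<cdot> F \<cdot> N"
  proof (cases rule: Nat_cases[of N])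
    case (1 n)
    show ?thesis
      using equiv_trans[OF equiv_steps[OF evctx_steps[OF strict(1) 1] ty(1)[OF N]]
          equiv_trans[OF Rec_num equiv_steps_rev[OF evctx_steps[OF strict(2) 1] ty(2)[OF N]]]] .
  next
    case 2
    show ?thesis
      by (rule bottom_equiv[OF bottom_strict[OF strict(1) N 2 ty(1)[OF N]]
            bottom_strict[OF strict(2) N 2 ty(2)[OF N]]])
  qed
qed (use typing_Rec_prog[of \<sigma>] in \<open>auto intro: typing_App simp: typing_simps\<close>)

definition min_fun :: tm where
  "min_fun = Lam ty_of_min (Lam (Nat\<^sub>t \<rightarrow> Nat\<^sub>t) (Lam Nat\<^sub>t
     (Const IfzeroC \<cdot> (Var 1 \<cdot> Var 0) \<cdot> Var 0 \<cdot>
       (Const (ByvalC [Nat\<^sub>t \<rightarrow> Nat\<^sub>t] Nat\<^sub>t) \<cdot> Var 2 \<cdot> Var 1 \<cdot> (Const SucC \<cdot> Var 0)))))"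

lemma min_fun_steps:
  "closed F \<Longrightarrow> closed R \<Longrightarrow> closed N \<Longrightarrow> min_fun \<cdot> R \<cdot> F \<cdot> N \<leadsto>*
     Const IfzeroC \<cdot> (F \<cdot> N) \<cdot> N \<cdot> (Const (ByvalC [Nat\<^sub>t \<rightarrow> Nat\<^sub>t] Nat\<^sub>t) \<cdot> R \<cdot> F \<cdot> (Const SucC \<cdot> N))"
  unfolding min_fun_def by (rule beta3) (simp_all add: numeral_eq_Suc)

lemma Min_prog_fold:
  "Min_prog = Const (ByvalC [Nat\<^sub>t \<rightarrow> Nat\<^sub>t] Nat\<^sub>t) \<cdot> (Const (YC ty_of_min) \<cdot> min_fun)"
  by (simp add: Min_prog_def min_fun_def)

lemma typing_min_fun: "[] \<turnstile> Const (YC ty_of_min) \<cdot> min_fun \<Colon> ty_of_min"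
  by (simp add: typing_iff_infer min_fun_def nth_Cons' numeral_eq_Suc)

lemma typing_Min_prog: "[] \<turnstile> Min_prog \<Colon> cst_ty MinC"
  using typing_min_fun by (simp add: Min_prog_fold typing_simps(1,3))

lemma evctx_Min_prog: "evctx (\<lambda>N. Min_prog \<cdot> F \<cdot> N)"
  using evctx_Byval[OF evctx_id, of "[F]" "[Nat\<^sub>t \<rightarrow> Nat\<^sub>t]"] by (simp add: Min_prog_fold)

text \<open>In contrast to \<open>rec\<close>, the upward search has no bound to induct on, so the
  index carries the induction, once in each direction.\<close>

lemma Min_prog_equiv: "Min_prog \<approx>\<^bsub>cst_ty MinC\<^esub> Const MinC"
  unfolding cst_ty.simps
proof (intro equiv_funI)
  fix F N assume F: "[] \<turnstile> F \<Colon> Nat\<^sub>t \<rightarrow> Nat\<^sub>t" and N: "[] \<turnstile> N \<Colon> Nat\<^sub>t"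
  let ?A = "\<lambda>F N. Min_prog \<cdot> F \<cdot> N" and ?B = "\<lambda>F N. Const MinC \<cdot> F \<cdot> N"
  have ty: "[] \<turnstile> Min_prog \<cdot> F \<cdot> N \<Colon> Nat\<^sub>t" "[] \<turnstile> Const MinC \<cdot> F \<cdot> N \<Colon> Nat\<^sub>t"
    if "[] \<turnstile> F \<Colon> Nat\<^sub>t \<rightarrow> Nat\<^sub>t" "[] \<turnstile> N \<Colon> Nat\<^sub>t" for F N
    using that typing_Min_prog by (auto intro!: typing_App simp: typing_simps(1))
  have suc: "[] \<turnstile> Const SucC \<cdot> num n \<Colon> Nat\<^sub>t" for n by (simp add: typing_simps)
  have A: "[] \<turnstile> ?A F (Const SucC \<cdot> num n) \<Colon> Nat\<^sub>t \<and>
      (\<exists>M. ?A F (num n) \<leadsto> M \<and> M \<leadsto>* Const IfzeroC \<cdot> (F \<cdot> num n) \<cdot> num n \<cdot> ?A F (Const SucC \<cdot> num n))"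
    if F: "[] \<turnstile> F \<Colon> Nat\<^sub>t \<rightarrow> Nat\<^sub>t" for F n
  proof -
    let ?m = "Const (YC ty_of_min) \<cdot> min_fun"
    have num: "closed (num n)" by (rule closedI[OF typing.intros(2)])
    have "?A F (num n) \<leadsto> ?m \<cdot> F \<cdot> num n"
      using step_Byval[of "[F]" "[Nat\<^sub>t \<rightarrow> Nat\<^sub>t]"] by (simp add: Min_prog_fold)
    moreover have "?m \<cdot> F \<cdot> num n \<leadsto> min_fun \<cdot> ?m \<cdot> F \<cdot> num n"
      by (intro step_AppL step_Y)
    moreover have "min_fun \<cdot> ?m \<cdot> F \<cdot> num n \<leadsto>*
        Const IfzeroC \<cdot> (F \<cdot> num n) \<cdot> num n \<cdot> ?A F (Const SucC \<cdot> num n)"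
      unfolding Min_prog_fold by (rule min_fun_steps[OF closedI[OF F] closedI[OF typing_min_fun] num])
    ultimately show ?thesis
      using ty(1)[OF F suc] by (blast intro: converse_rtranclp_into_rtranclp)
  qed
  have B: "[] \<turnstile> ?B F (Const SucC \<cdot> num n) \<Colon> Nat\<^sub>t \<and>
      (\<exists>M. ?B F (num n) \<leadsto> M \<and> M \<leadsto>* Const IfzeroC \<cdot> (F \<cdot> num n) \<cdot> num n \<cdot> ?B F (Const SucC \<cdot> num n))"
    if "[] \<turnstile> F \<Colon> Nat\<^sub>t \<rightarrow> Nat\<^sub>t" for F n
    using that ty(2)[OF that suc] step_Min by blast
  have A': "[] \<turnstile> ?A F (Const SucC \<cdot> num n) \<Colon> Nat\<^sub>t \<and>
      ?A F (num n) \<leadsto>* Const IfzeroC \<cdot> (F \<cdot> num n) \<cdot> num n \<cdot> ?A F (Const SucC \<cdot> num n)"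
    and B': "[] \<turnstile> ?B F (Const SucC \<cdot> num n) \<Colon> Nat\<^sub>t \<and>
      ?B F (num n) \<leadsto>* Const IfzeroC \<cdot> (F \<cdot> num n) \<cdot> num n \<cdot> ?B F (Const SucC \<cdot> num n)"
    if "[] \<turnstile> F \<Colon> Nat\<^sub>t \<rightarrow> Nat\<^sub>t" for F n
    using A[OF that] B[OF that] by (blast intro: converse_rtranclp_into_rtranclp)+
  note strict = evctx_Min_prog evctx_Min[OF evctx_id]
  note refl = approx_refl[OF F] approx_refl[OF N]
  have "iapprox Nat\<^sub>t k (?A F N) (?B F N)" and "iapprox Nat\<^sub>t k (?B F N) (?A F N)" for k
    by (rule iapprox_min_unfolding[where A = ?A and A' = ?B, OF strict(1) A strict(2) B' F F _ N N]
          iapprox_min_unfolding[where A = ?B and A' = ?A, OF strict(2) B strict(1) A' F F _ N N];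
        use refl in \<open>simp only: approx_closed\<close>)+
  then show "?A F N \<approx>\<^bsub>Nat\<^sub>t\<^esub> ?B F N"
    using ty[OF F N] by (simp add: equiv_tm_def approx_closed del: iapprox.simps)
qed (use typing_Min_prog in \<open>auto intro: typing_App simp: typing_simps\<close>)

lemma circ_cst_equiv: "circ_cst c \<approx>\<^bsub>cst_ty c\<^esub> Const c"
  by (cases c) (simp_all add: While_prog_equiv[unfolded cst_ty.simps] Rec_prog_equiv[unfolded cst_ty.simps]
      Min_prog_equiv[unfolded cst_ty.simps] equiv_refl typing_simps)

text \<open>\<open>Const\<close> is the identity interpretation, so a whole term is equivalent to
  its translation, although the two may belong to different languages.\<close>

lemma circ_equiv: "[] \<turnstile> M \<Colon> \<tau> \<Longrightarrow> M\<^sup>\<circ> \<approx>\<^bsub>\<tau>\<^esub> M"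
  using equiv_replace_csts[of M \<tau> circ_cst Const] circ_cst_equiv by (simp add: circ_def)

subsection \<open>The inequality program on all closed terms\<close>

text \<open>A diverging term inside \<open>W\<close>: the test is constantly \<open>0\<close>, which
  means true, so the loop never stops.\<close>

definition omega :: tm where
  "omega = Const (WhileC Nat\<^sub>t) \<cdot> Lam Nat\<^sub>t (num 0) \<cdot> num 0 \<cdot> Const SucC"

lemma typing_num [simp]: "[] \<turnstile> num n \<Colon> Nat\<^sub>t"
  by (simp add: typing_simps)

lemma closed_num [simp]: "closed (num n)"
  by (rule closedI[OF typing_num])

lemma bottom_omega: "bottom Nat\<^sub>t omega"
proof -
  let ?W = "\<lambda>X. Const (WhileC Nat\<^sub>t) \<cdot> Lam Nat\<^sub>t (num 0) \<cdot> X \<cdot> Const SucC"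
  have ty: "[] \<turnstile> ?W X \<Colon> Nat\<^sub>t" if "[] \<turnstile> X \<Colon> Nat\<^sub>t" for X
    using that by (simp add: typing_simps)
  \<comment> \<open>Each round replaces the state by its successor, so the claim is proved for every
    state.\<close>
  have "iapprox Nat\<^sub>t k (?W X) Q" if "[] \<turnstile> X \<Colon> Nat\<^sub>t" for k X Q
    using that
  proof (induction k arbitrary: X)
    case 0
    show ?case by (rule iapprox_0[OF step_While])
  next
    case (Suc k)
    have SX: "[] \<turnstile> Const SucC \<cdot> X \<Colon> Nat\<^sub>t" using Suc.prems by (simp add: typing_simps)
    have "ifzero Nat\<^sub>t \<cdot> (Lam Nat\<^sub>t (num 0) \<cdot> X) \<cdot> ?W (Const SucC \<cdot> X) \<cdot> X \<leadsto>* ?W (Const SucC \<cdot> X)"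
      unfolding ifzero.simps
      by (rule Ifzero_0_steps[OF closedI[OF ty[OF SX]] closedI[OF Suc.prems] beta1])
         (use closedI[OF Suc.prems] in simp_all)
    then show ?case
      by (rule iapprox_step_steps_left[OF step_While]) (rule Suc.IH[OF SX])
  qed
  then show ?thesis
    using ty[OF typing_num] by (auto simp: omega_def simp del: iapprox.simps intro: bottomI)
qed

lemma equiv_W_term:
  assumes "[] \<turnstile> M \<Colon> Nat\<^sub>t"
  obtains M' where "closed_term lang_W M' Nat\<^sub>t" "M \<approx>\<^bsub>Nat\<^sub>t\<^esub> M'"
proof (cases rule: Nat_cases[of M])
  case (1 n)
  then show ?thesis
    using that[of "num n"] equiv_steps[OF 1 assms] by (auto simp: closed_term_def lang_W_def lang_B_def)
next
  case 2
  then have "M \<approx>\<^bsub>Nat\<^sub>t\<^esub> omega"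
    using assms bottom_omega by (auto intro: bottom_equiv simp: bottom_Nat_iff)
  then show ?thesis
    using that[of omega] bottom_omega
    by (auto simp: closed_term_def bottom_Nat_iff omega_def lang_W_def lang_B_def)
qed

text \<open>Both arguments are replaced by equivalent \<open>W\<close> terms, where the hypothesis
  applies, and congruence carries the outcome back. The loops below run on arbitrary closed
  arguments and rely on this.\<close>

lemma implements_neq_all_csts:
  assumes "[] \<turnstile> neq \<Colon> Nat\<^sub>t \<rightarrow> Nat\<^sub>t \<rightarrow> Nat\<^sub>t" "implements_neq lang_W neq"
  shows "implements_neq UNIV neq"
  unfolding implements_neq_def
proof (intro allI impI, elim conjE)
  fix M N assume "closed_term UNIV M Nat\<^sub>t" "closed_term UNIV N Nat\<^sub>t"
  then obtain M' N' where W: "closed_term lang_W M' Nat\<^sub>t" "closed_term lang_W N' Nat\<^sub>t"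
    and eq: "M \<approx>\<^bsub>Nat\<^sub>t\<^esub> M'" "N \<approx>\<^bsub>Nat\<^sub>t\<^esub> N'"
    by (metis closed_term_def equiv_W_term)
  have "neq \<cdot> M \<cdot> N \<approx>\<^bsub>Nat\<^sub>t\<^esub> neq \<cdot> M' \<cdot> N'"
    by (rule equiv_App[OF equiv_AppR[OF assms(1) eq(1)] eq(2)])
  then show "(\<forall>m n. M \<leadsto>* num m \<and> N \<leadsto>* num n \<longrightarrow>
      (m \<noteq> n \<longrightarrow> neq \<cdot> M \<cdot> N \<leadsto>* num 0) \<and> (m = n \<longrightarrow> (\<exists>k. k \<noteq> 0 \<and> neq \<cdot> M \<cdot> N \<leadsto>* num k))) \<and>
    (diverges M \<or> diverges N \<longrightarrow> diverges (neq \<cdot> M \<cdot> N))"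
    using assms(2) W eq unfolding implements_neq_def equiv_Nat_iff diverges_def by metis
qed

subsection \<open>Recursion and minimization by while loops\<close>

locale inequality =
  fixes neq :: tm
  assumes typing_neq: "[] \<turnstile> neq \<Colon> Nat\<^sub>t \<rightarrow> Nat\<^sub>t \<rightarrow> Nat\<^sub>t"
    and implements: "implements_neq UNIV neq"
begin

lemma closed_neq [simp]: "closed neq"
  by (rule closedI[OF typing_neq])

lemma neq_steps:
  assumes "[] \<turnstile> M \<Colon> Nat\<^sub>t" "[] \<turnstile> N \<Colon> Nat\<^sub>t"
  shows neq_distinct: "M \<leadsto>* num m \<Longrightarrow> N \<leadsto>* num n \<Longrightarrow> m \<noteq> n \<Longrightarrow> neq \<cdot> M \<cdot> N \<leadsto>* num 0"
    and neq_same: "M \<leadsto>* num n \<Longrightarrow> N \<leadsto>* num n \<Longrightarrow> \<exists>k. neq \<cdot> M \<cdot> N \<leadsto>* num (Suc k)"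
    and neq_diverges: "diverges M \<or> diverges N \<Longrightarrow> diverges (neq \<cdot> M \<cdot> N)"
proof -
  have "closed_term UNIV M Nat\<^sub>t" "closed_term UNIV N Nat\<^sub>t" using assms by (simp_all add: closed_term_def)
  note * = implements[unfolded implements_neq_def, rule_format, OF conjI[OF this]]
  show "M \<leadsto>* num m \<Longrightarrow> N \<leadsto>* num n \<Longrightarrow> m \<noteq> n \<Longrightarrow> neq \<cdot> M \<cdot> N \<leadsto>* num 0" using * by blast
  show "M \<leadsto>* num n \<Longrightarrow> N \<leadsto>* num n \<Longrightarrow> \<exists>k. neq \<cdot> M \<cdot> N \<leadsto>* num (Suc k)" using * by (metis not0_implies_Suc)
  show "diverges M \<or> diverges N \<Longrightarrow> diverges (neq \<cdot> M \<cdot> N)" using * by blast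
qed

lemma typing_Rec'_prog: "[] \<turnstile> Rec'_prog neq \<sigma> \<Colon> cst_ty (RecC \<sigma>)"
  by (simp add: typing_iff_infer Rec'_prog_def nth_Cons' numeral_eq_Suc infer_closed[OF typing_neq])

lemma typing_Min'_prog: "[] \<turnstile> Min'_prog neq \<Colon> cst_ty MinC"
  by (simp add: typing_iff_infer Min'_prog_def nth_Cons' numeral_eq_Suc infer_closed[OF typing_neq])

text \<open>Loop invariant: after \<open>i\<close> rounds the state is equivalent to the pair of
  \<open>i\<close> and \<open>rec X F i\<close>. A diverging bound \<open>N\<close> makes already
  the first test diverge.\<close>

lemma Rec'_prog_equiv: "Rec'_prog neq \<sigma> \<approx>\<^bsub>cst_ty (RecC \<sigma>)\<^esub> Const (RecC \<sigma>)"
  unfolding cst_ty.simps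
proof (intro equiv_funI)
  fix X F N
  assume X: "[] \<turnstile> X \<Colon> \<sigma>" and F: "[] \<turnstile> F \<Colon> \<sigma> \<rightarrow> Nat\<^sub>t \<rightarrow> \<sigma>" and N: "[] \<turnstile> N \<Colon> Nat\<^sub>t"
  note [simp] = closedI[OF X] closedI[OF F] closedI[OF N]
  let ?c = "Lam (Nat\<^sub>t \<otimes> \<sigma>) (neq \<cdot> Fst (Var 0) \<cdot> N)"
  let ?g = "Lam (Nat\<^sub>t \<otimes> \<sigma>) (Pair (Const SucC \<cdot> Fst (Var 0)) (F \<cdot> Snd (Var 0) \<cdot> Fst (Var 0)))"
  let ?W = "\<lambda>P. Const (WhileC (Nat\<^sub>t \<otimes> \<sigma>)) \<cdot> ?c \<cdot> P \<cdot> ?g"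
  let ?rec = "\<lambda>N. Const (RecC \<sigma>) \<cdot> X \<cdot> F \<cdot> N"
  have ty_rec: "[] \<turnstile> ?rec N \<Colon> \<sigma>" if "[] \<turnstile> N \<Colon> Nat\<^sub>t" for N
    using X F that by (simp add: typing_simps)
  have ty_c: "[] \<turnstile> ?c \<Colon> Nat\<^sub>t \<otimes> \<sigma> \<rightarrow> Nat\<^sub>t"
    using N by (simp add: typing_iff_infer[of "[]" "Lam _ _"] infer_closed infer_closed[OF typing_neq])
  have ty_g: "[] \<turnstile> ?g \<Colon> Nat\<^sub>t \<otimes> \<sigma> \<rightarrow> Nat\<^sub>t \<otimes> \<sigma>"
    using F by (simp add: typing_iff_infer[of "[]" "Lam _ _"] infer_closed)
  have ty_W_fun: "[] \<turnstile> Const (WhileC (Nat\<^sub>t \<otimes> \<sigma>)) \<cdot> ?c \<Colon> Nat\<^sub>t \<otimes> \<sigma> \<rightarrow> (Nat\<^sub>t \<otimes> \<sigma> \<rightarrow> Nat\<^sub>t \<otimes> \<sigma>) \<rightarrow> Nat\<^sub>t \<otimes> \<sigma>"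
    by (rule typing_App[OF _ ty_c]) (simp add: typing_simps)
  have ty_W: "[] \<turnstile> ?W P \<Colon> Nat\<^sub>t \<otimes> \<sigma>" if "[] \<turnstile> P \<Colon> Nat\<^sub>t \<otimes> \<sigma>" for P
    by (rule typing_App[OF typing_App[OF ty_W_fun that] ty_g])
  have W_cong: "?W P \<approx>\<^bsub>Nat\<^sub>t \<otimes> \<sigma>\<^esub> ?W P'" if "P \<approx>\<^bsub>Nat\<^sub>t \<otimes> \<sigma>\<^esub> P'" for P P'
    by (rule equiv_AppL[OF equiv_AppR[OF ty_W_fun that] ty_g])
  have W_unfold: "?W P \<approx>\<^bsub>Nat\<^sub>t \<otimes> \<sigma>\<^esub> ifzero (Nat\<^sub>t \<otimes> \<sigma>) \<cdot> (?c \<cdot> P) \<cdot> ?W (?g \<cdot> P) \<cdot> P"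
    if "[] \<turnstile> P \<Colon> Nat\<^sub>t \<otimes> \<sigma>" for P
    by (rule equiv_steps[OF step_steps[OF step_While] ty_W[OF that]])
  have c: "?c \<cdot> P \<leadsto>* neq \<cdot> Fst P \<cdot> N" if "[] \<turnstile> P \<Colon> Nat\<^sub>t \<otimes> \<sigma>" for P
    by (rule beta1) (use closedI[OF that] in simp_all)
  have g: "?g \<cdot> P \<leadsto>* Pair (Const SucC \<cdot> Fst P) (F \<cdot> Snd P \<cdot> Fst P)" if "[] \<turnstile> P \<Colon> Nat\<^sub>t \<otimes> \<sigma>" for P
    by (rule beta1) (use closedI[OF that] in simp_all)
  have P0: "[] \<turnstile> Pair (num 0) X \<Colon> Nat\<^sub>t \<otimes> \<sigma>" by (rule typing_Pair[OF typing_num X])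
  have "Rec'_prog neq \<sigma> \<cdot> X \<cdot> F \<cdot> N \<leadsto>* Snd (?W (Pair (num 0) X))"
    unfolding Rec'_prog_def by (rule beta3) (simp_all add: numeral_eq_Suc)
  moreover have "[] \<turnstile> Rec'_prog neq \<sigma> \<cdot> X \<cdot> F \<cdot> N \<Colon> \<sigma>"
    using X F N typing_Rec'_prog[of \<sigma>] by (auto intro!: typing_App)
  ultimately have start: "Rec'_prog neq \<sigma> \<cdot> X \<cdot> F \<cdot> N \<approx>\<^bsub>\<sigma>\<^esub> Snd (?W (Pair (num 0) X))"
    by (rule equiv_steps)
  have loop: "Snd (?W (Pair (num 0) X)) \<approx>\<^bsub>\<sigma>\<^esub> ?rec N"
  proof (cases rule: Nat_cases[of N])
    case 2
    let ?P = "Pair (num 0) X"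
    have "diverges (neq \<cdot> Fst ?P \<cdot> N)"
      using neq_diverges[OF typing_Fst[OF P0] N] 2 by blast
    then have "diverges (?c \<cdot> ?P)"
      using steps_num_confluent[OF _ c[OF P0]] by (auto simp: diverges_def)
    from bottom_ifzero[OF typing_App[OF ty_c P0] this ty_W[OF typing_App[OF ty_g P0]] P0]
    have "bottom \<sigma> (Snd (?W ?P))"
      by (rule bottom_Snd[OF equiv_bottom[OF W_unfold[OF P0]]])
    then show ?thesis
      using bottom_strict[OF evctx_Rec[OF evctx_id] N 2 ty_rec[OF N]] by (rule bottom_equiv)
  next
    case (1 n)
    let ?P = "\<lambda>i. Pair (num i) (?rec (num i))"
    have P: "[] \<turnstile> ?P i \<Colon> Nat\<^sub>t \<otimes> \<sigma>" for i
      by (rule typing_Pair[OF typing_num ty_rec[OF typing_num]])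
    have test: "?c \<cdot> ?P i \<leadsto>* num m" if "neq \<cdot> Fst (?P i) \<cdot> N \<leadsto>* num m" for i m
      using c[OF P] that by (rule rtranclp_trans)
    note branch = ifzero_equiv[OF typing_App[OF ty_c P] ty_W[OF typing_App[OF ty_g P]] P _ refl]
    \<comment> \<open>\<open>d\<close> counts the rounds still to run; the counter \<open>i\<close>
      rises as \<open>d\<close> falls.\<close>
    have iter: "Snd (?W (?P i)) \<approx>\<^bsub>\<sigma>\<^esub> ?rec (num n)" if "i + d = n" for i d
      using that
    proof (induction d arbitrary: i)
      case 0
      then have "\<exists>k. neq \<cdot> Fst (?P i) \<cdot> N \<leadsto>* num (Suc k)"
        using neq_same[OF typing_Fst[OF P] N step_steps[OF step_FstPair] ] 1 by simp
      then obtain k where "?c \<cdot> ?P i \<leadsto>* num (Suc k)" using test by blast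
      from equiv_trans[OF W_unfold[OF P] branch[OF this]] have "?W (?P i) \<approx>\<^bsub>Nat\<^sub>t \<otimes> \<sigma>\<^esub> ?P i"
        by simp
      then have "Snd (?W (?P i)) \<approx>\<^bsub>\<sigma>\<^esub> Snd (?P i)" by (rule equiv_Snd)
      also have "\<dots> \<approx>\<^bsub>\<sigma>\<^esub> ?rec (num i)"
        by (rule equiv_steps[OF step_steps[OF step_SndPair] typing_Snd[OF P]])
      finally show ?case using 0 by simp
    next
      case (Suc d)
      then have "neq \<cdot> Fst (?P i) \<cdot> N \<leadsto>* num 0"
        using neq_distinct[OF typing_Fst[OF P] N step_steps[OF step_FstPair] 1] by simp
      from equiv_trans[OF W_unfold[OF P] branch[OF test[OF this]]]
      have unfold: "?W (?P i) \<approx>\<^bsub>Nat\<^sub>t \<otimes> \<sigma>\<^esub> ?W (?g \<cdot> ?P i)" by simp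
      have fst: "Fst (?P i) \<approx>\<^bsub>Nat\<^sub>t\<^esub> num i"
        by (rule equiv_steps[OF step_steps[OF step_FstPair] typing_Fst[OF P]])
      have snd: "Snd (?P i) \<approx>\<^bsub>\<sigma>\<^esub> ?rec (num i)"
        by (rule equiv_steps[OF step_steps[OF step_SndPair] typing_Snd[OF P]])
      \<comment> \<open>The loop body builds unevaluated components; congruence replaces them by the
        numeral and the recursor before the next round.\<close>
      have "Const SucC \<cdot> Fst (?P i) \<approx>\<^bsub>Nat\<^sub>t\<^esub> Const SucC \<cdot> num i"
        by (rule equiv_AppR[OF _ fst]) (simp add: typing_simps)
      also have "Const SucC \<cdot> num i \<approx>\<^bsub>Nat\<^sub>t\<^esub> num (Suc i)"
        using equiv_steps[OF step_steps[OF step_Suc]] by (simp add: typing_simps)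
      finally have suc: "Const SucC \<cdot> Fst (?P i) \<approx>\<^bsub>Nat\<^sub>t\<^esub> num (Suc i)" .
      have "F \<cdot> Snd (?P i) \<cdot> Fst (?P i) \<approx>\<^bsub>\<sigma>\<^esub> F \<cdot> ?rec (num i) \<cdot> num i"
        by (rule equiv_App[OF equiv_AppR[OF F snd] fst])
      also have "\<dots> \<approx>\<^bsub>\<sigma>\<^esub> ?rec (num (Suc i))"
        using equiv_steps_rev[OF step_steps[OF step_Rec_Suc] ty_rec[OF typing_num]] by simp
      finally have "Pair (Const SucC \<cdot> Fst (?P i)) (F \<cdot> Snd (?P i) \<cdot> Fst (?P i)) \<approx>\<^bsub>Nat\<^sub>t \<otimes> \<sigma>\<^esub> ?P (Suc i)"
        using suc by (rule equiv_Pair[rotated])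
      with equiv_steps[OF g[OF P] typing_App[OF ty_g P]]
      have "?g \<cdot> ?P i \<approx>\<^bsub>Nat\<^sub>t \<otimes> \<sigma>\<^esub> ?P (Suc i)" by (rule equiv_trans)
      from equiv_Snd[OF equiv_trans[OF unfold W_cong[OF this]]]
      show ?case by (rule equiv_trans) (rule Suc.IH, use Suc.prems in simp)
    qed
    \<comment> \<open>The initial pair is the invariant at \<open>i = 0\<close>, since
      \<open>?rec (num 0)\<close> reduces to \<open>X\<close>.\<close>
    have "Pair (num 0) X \<approx>\<^bsub>Nat\<^sub>t \<otimes> \<sigma>\<^esub> ?P 0"
      by (rule equiv_Pair[OF equiv_refl[OF typing_num] equiv_steps_rev[OF step_steps[OF step_Rec_0] ty_rec[OF typing_num]]])
    from equiv_Snd[OF W_cong[OF this]] have "Snd (?W (Pair (num 0) X)) \<approx>\<^bsub>\<sigma>\<^esub> Snd (?W (?P 0))" .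
    also have "\<dots> \<approx>\<^bsub>\<sigma>\<^esub> ?rec (num n)" by (rule iter) simp
    also have "\<dots> \<approx>\<^bsub>\<sigma>\<^esub> ?rec N"
      by (rule equiv_steps_rev[OF evctx_steps[OF evctx_Rec[OF evctx_id] 1] ty_rec[OF N]])
    finally show ?thesis .
  qed
  show "Rec'_prog neq \<sigma> \<cdot> X \<cdot> F \<cdot> N \<approx>\<^bsub>\<sigma>\<^esub> Const (RecC \<sigma>) \<cdot> X \<cdot> F \<cdot> N"
    using start loop by (rule equiv_trans)
qed (use typing_Rec'_prog[of \<sigma>] in \<open>auto intro: typing_App simp: typing_simps\<close>)

text \<open>The two loops differ in what they carry: \<open>while\<close> an unevaluated iterated
  successor of \<open>N\<close>, \<open>min\<close> its value. Hence the comparison is between a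
  term with value \<open>n\<close> on one side and the numeral on the other.\<close>

lemma Min'_prog_loop:
  assumes F: "[] \<turnstile> F \<Colon> Nat\<^sub>t \<rightarrow> Nat\<^sub>t" and N: "[] \<turnstile> N \<Colon> Nat\<^sub>t"
  defines "W \<equiv> \<lambda>N. Const (WhileC Nat\<^sub>t) \<cdot> Lam Nat\<^sub>t (neq \<cdot> (F \<cdot> Var 0) \<cdot> num 0) \<cdot> N \<cdot> Const SucC"
  shows "W N \<approx>\<^bsub>Nat\<^sub>t\<^esub> Const MinC \<cdot> F \<cdot> N"
proof -
  note [simp] = closedI[OF F]
  let ?c = "Lam Nat\<^sub>t (neq \<cdot> (F \<cdot> Var 0) \<cdot> num 0)"
  let ?E = "\<lambda>N. Const IfzeroC \<cdot> (?c \<cdot> N) \<cdot> W (Const SucC \<cdot> N) \<cdot> N"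
  let ?M = "\<lambda>n. Const IfzeroC \<cdot> (F \<cdot> num n) \<cdot> num n \<cdot> (Const MinC \<cdot> F \<cdot> (Const SucC \<cdot> num n))"
  have ty_S: "[] \<turnstile> Const SucC \<cdot> N \<Colon> Nat\<^sub>t" if "[] \<turnstile> N \<Colon> Nat\<^sub>t" for N
    using that by (simp add: typing_simps)
  have ty_c: "[] \<turnstile> ?c \<Colon> Nat\<^sub>t \<rightarrow> Nat\<^sub>t"
    using F by (simp add: typing_iff_infer[of "[]" "Lam _ _"] infer_closed infer_closed[OF typing_neq])
  have ty_W: "[] \<turnstile> W N \<Colon> Nat\<^sub>t" if "[] \<turnstile> N \<Colon> Nat\<^sub>t" for N
    unfolding W_def using ty_c that by (auto intro!: typing_App simp: typing_simps(1))
  have ty_M: "[] \<turnstile> Const MinC \<cdot> F \<cdot> N \<Colon> Nat\<^sub>t" if "[] \<turnstile> N \<Colon> Nat\<^sub>t" for N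
    using F that by (simp add: typing_simps)
  have ty_E: "[] \<turnstile> ?E N \<Colon> Nat\<^sub>t" if "[] \<turnstile> N \<Colon> Nat\<^sub>t" for N
    using typing_ifzero_apps[OF typing_App[OF ty_c that] ty_W[OF ty_S[OF that]] that] by simp
  have ty_E': "[] \<turnstile> ?M n \<Colon> Nat\<^sub>t" for n
    using typing_ifzero_apps[OF typing_App[OF F typing_num] typing_num ty_M[OF ty_S[OF typing_num]]] by simp
  have W_step: "W N \<leadsto> ?E N" for N
    using step_While[of "Nat\<^sub>t"] by (simp add: W_def)
  have c: "?c \<cdot> N \<leadsto>* neq \<cdot> (F \<cdot> N) \<cdot> num 0" if "[] \<turnstile> N \<Colon> Nat\<^sub>t" for N
    by (rule beta1) (use closedI[OF that] in simp_all)
  have strict_E: "evctx (\<lambda>D. Const IfzeroC \<cdot> D \<cdot> A \<cdot> B)" for A B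
    by (intro evctx_App evctx_Ifzero evctx_id)

  \<comment> \<open>A diverging state makes the whole loop bottom whatever the test yields, which
    matches \<open>min\<close> forcing its argument.\<close>
  have W_bottom: "iapprox Nat\<^sub>t k (W N) Q" if "[] \<turnstile> N \<Colon> Nat\<^sub>t" "diverges N" for k N Q
    using that
  proof (induction k arbitrary: N)
    case 0
    show ?case by (rule iapprox_0[OF W_step])
  next
    case (Suc k)
    note cl = closedI[OF ty_W[OF ty_S[OF Suc.prems(1)]]] closedI[OF Suc.prems(1)]
    have "iapprox Nat\<^sub>t k (?E N) Q"
    proof (rule iapprox_strict[OF strict_E typing_App[OF ty_c Suc.prems(1)]])
      fix i m
      show "iapprox Nat\<^sub>t (k - i) (Const IfzeroC \<cdot> num m \<cdot> W (Const SucC \<cdot> N) \<cdot> N) Q"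
      proof (cases m)
        case 0
        \<comment> \<open>The loop goes on, but the next state diverges as well, so the induction
          hypothesis applies to it.\<close>
        have "bottom Nat\<^sub>t (Const SucC \<cdot> N)"
          by (rule bottom_strict[OF evctx_Suc[OF evctx_id] Suc.prems ty_S[OF Suc.prems(1)]])
        then have "iapprox Nat\<^sub>t k (W (Const SucC \<cdot> N)) Q"
          using Suc.IH by (simp only: bottom_Nat_iff)
        then have "iapprox Nat\<^sub>t (k - i) (W (Const SucC \<cdot> N)) Q"
          by (rule iapprox_mono) simp
        then show ?thesis
          unfolding 0 by (rule iapprox_steps_left[OF Ifzero_0_steps[OF cl rtranclp.rtrancl_refl]])
      next
        case (Suc j)
        \<comment> \<open>Here the loop ends and returns the diverging \<open>N\<close>.\<close>
        have "diverges N" by fact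
        then have "iapprox Nat\<^sub>t (k - i) N Q"
          by (auto simp: diverges_def steps_relpowp)
        then show ?thesis
          unfolding Suc by (rule iapprox_steps_left[OF Ifzero_Suc_steps[OF cl rtranclp.rtrancl_refl]])
      qed
    qed
    then show ?case by (rule iapprox_step_left[OF W_step])
  qed

  \<comment> \<open>One round of both loops at a common value \<open>n\<close>: both tests diverge,
    or both loops return \<open>n\<close>, or both go on from \<open>n + 1\<close>.\<close>
  have iteration:
    "(diverges (?c \<cdot> N) \<and> diverges (F \<cdot> num n)) \<or> (?E N \<leadsto>* num n \<and> ?M n \<leadsto>* num n) \<or>
     (?E N \<leadsto>* W (Const SucC \<cdot> N) \<and> ?M n \<leadsto>* Const MinC \<cdot> F \<cdot> num (Suc n))"
    if N: "[] \<turnstile> N \<Colon> Nat\<^sub>t" and n: "N \<leadsto>* num n" for N n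
  proof -
    note cl = closedI[OF ty_W[OF ty_S[OF N]]] closedI[OF N]
    note cl' = closed_num closedI[OF ty_M[OF ty_S[OF typing_num]]]
    have FN: "F \<cdot> N \<approx>\<^bsub>Nat\<^sub>t\<^esub> F \<cdot> num n"
      by (rule equiv_AppR[OF F equiv_steps[OF n N]])
    note ty_FN = equiv_typing(1)[OF FN]
    show ?thesis
    proof (cases rule: Nat_cases[of "F \<cdot> num n"])
      case 2
      then have "diverges (F \<cdot> N)" using FN by (simp add: equiv_Nat_iff diverges_def)
      then have "diverges (neq \<cdot> (F \<cdot> N) \<cdot> num 0)"
        using neq_diverges[OF ty_FN typing_num] by blast
      then have "diverges (?c \<cdot> N)"
        using steps_num_confluent[OF _ c[OF N]] by (auto simp: diverges_def)
      then show ?thesis using 2 by blast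
    next
      case (1 m)
      then have Fm: "F \<cdot> N \<leadsto>* num m" using FN by (simp add: equiv_Nat_iff)
      show ?thesis
      proof (cases m)
        case 0
        \<comment> \<open>The branches are swapped: value \<open>0\<close> of \<open>F\<close> is
          what \<open>min\<close> stops on through its first branch, while inequality with
          \<open>0\<close> is then false and its nonzero result selects the state in the last
          branch.\<close>
        obtain k where "neq \<cdot> (F \<cdot> N) \<cdot> num 0 \<leadsto>* num (Suc k)"
          using neq_same[OF ty_FN typing_num Fm[unfolded 0]] by auto
        from Ifzero_Suc_steps[OF cl rtranclp_trans[OF c[OF N] this]] n have "?E N \<leadsto>* num n"
          by (rule rtranclp_trans)
        moreover have "?M n \<leadsto>* num n"
          using Ifzero_0_steps[OF cl' 1[unfolded 0]] .
        ultimately show ?thesis by blast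
      next
        case (Suc j)
        have "neq \<cdot> (F \<cdot> N) \<cdot> num 0 \<leadsto>* num 0"
          using neq_distinct[OF ty_FN typing_num Fm, of 0 0] Suc by simp
        from Ifzero_0_steps[OF cl rtranclp_trans[OF c[OF N] this]]
        have "?E N \<leadsto>* W (Const SucC \<cdot> N)" .
        \<comment> \<open>\<open>min\<close> forces its new argument to a numeral; the
          \<open>while\<close> side keeps \<open>suc N\<close> unevaluated.\<close>
        moreover have "Const MinC \<cdot> F \<cdot> (Const SucC \<cdot> num n) \<leadsto>* Const MinC \<cdot> F \<cdot> num (Suc n)"
          using evctx_step[OF evctx_Min[OF evctx_id] step_Suc] by (simp add: step_steps)
        from Ifzero_Suc_steps[OF cl' 1[unfolded Suc]] this
        have "?M n \<leadsto>* Const MinC \<cdot> F \<cdot> num (Suc n)" by (rule rtranclp_trans)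
        ultimately show ?thesis by blast
      qed
    qed
  qed

  have Suc_steps: "Const SucC \<cdot> N \<leadsto>* num (Suc n)" if "N \<leadsto>* num n" for N n
    using rtranclp_trans[OF evctx_steps[OF evctx_Suc[OF evctx_id] that] step_steps[OF step_Suc]] by simp
  have num: "iapprox Nat\<^sub>t k (num n) (num n)" for k n by simp

  have le: "iapprox Nat\<^sub>t k (W N) (Const MinC \<cdot> F \<cdot> num n)" if "[] \<turnstile> N \<Colon> Nat\<^sub>t" "N \<leadsto>* num n" for k N n
    using that
  proof (induction k arbitrary: N n)
    case 0
    show ?case by (rule iapprox_0[OF W_step])
  next
    case (Suc k)
    note IH = Suc.IH[OF ty_S[OF Suc.prems(1)] Suc_steps[OF Suc.prems(2)]]
    have "iapprox Nat\<^sub>t k (?E N) (?M n)"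
      using iteration[OF Suc.prems]
    proof (elim disjE conjE)
      assume "diverges (?c \<cdot> N)"
      then have "bottom Nat\<^sub>t (?E N)"
        using bottom_strict[OF strict_E typing_App[OF ty_c Suc.prems(1)] _ ty_E[OF Suc.prems(1)]] by blast
      then show ?thesis
        by (rule bottom_lr) (rule ty_E')
    \<comment> \<open>In the other two cases both sides reach \<open>num n\<close>, or they reach
      the two terms related by \<open>IH\<close>.\<close>
    qed (auto simp only: intro: iapprox_evalI[OF _ _ num] iapprox_evalI[OF _ _ IH])
    then show ?case
      by (rule iapprox_step_left[OF W_step iapprox_steps_right[OF step_steps[OF step_Min]]])
  qed

  have ge: "iapprox Nat\<^sub>t k (Const MinC \<cdot> F \<cdot> num n) (W N)" if "[] \<turnstile> N \<Colon> Nat\<^sub>t" "N \<leadsto>* num n" for k N n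
    using that
  proof (induction k arbitrary: N n)
    case 0
    show ?case by (rule iapprox_0[OF step_Min])
  next
    case (Suc k)
    note IH = Suc.IH[OF ty_S[OF Suc.prems(1)] Suc_steps[OF Suc.prems(2)]]
    have "iapprox Nat\<^sub>t k (?M n) (?E N)"
      using iteration[OF Suc.prems]
    proof (elim disjE conjE)
      assume "diverges (F \<cdot> num n)"
      then have "bottom Nat\<^sub>t (?M n)"
        using bottom_strict[OF strict_E typing_App[OF F typing_num] _ ty_E'] by blast
      then show ?thesis
        by (rule bottom_lr) (rule ty_E[OF Suc.prems(1)])
    qed (auto simp only: intro: iapprox_evalI[OF _ _ num] iapprox_evalI[OF _ _ IH])
    then show ?case
      by (rule iapprox_step_left[OF step_Min iapprox_steps_right[OF step_steps[OF W_step]]])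
  qed
  show ?thesis
  proof (cases rule: Nat_cases[of N])
    case (1 n)
    have "W N \<approx>\<^bsub>Nat\<^sub>t\<^esub> Const MinC \<cdot> F \<cdot> num n"
      using le[OF N 1] ge[OF N 1] ty_W[OF N] ty_M[OF typing_num]
      by (simp add: equiv_tm_def approx_closed del: iapprox.simps)
    then show ?thesis
      using equiv_steps_rev[OF evctx_steps[OF evctx_Min[OF evctx_id] 1] ty_M[OF N]] by (rule equiv_trans)
  next
    case 2
    show ?thesis
      by (rule bottom_equiv[OF bottomI[OF ty_W[OF N] W_bottom[OF N 2]]
            bottom_strict[OF evctx_Min[OF evctx_id] N 2 ty_M[OF N]]])
  qed
qed

lemma Min'_prog_equiv: "Min'_prog neq \<approx>\<^bsub>cst_ty MinC\<^esub> Const MinC"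
  unfolding cst_ty.simps
proof (intro equiv_funI)
  fix F N assume F: "[] \<turnstile> F \<Colon> Nat\<^sub>t \<rightarrow> Nat\<^sub>t" and N: "[] \<turnstile> N \<Colon> Nat\<^sub>t"
  have "[] \<turnstile> Min'_prog neq \<cdot> F \<cdot> N \<Colon> Nat\<^sub>t"
    using F N typing_Min'_prog by (auto intro!: typing_App)
  moreover have "Min'_prog neq \<cdot> F \<cdot> N \<leadsto>*
      Const (WhileC Nat\<^sub>t) \<cdot> Lam Nat\<^sub>t (neq \<cdot> (F \<cdot> Var 0) \<cdot> num 0) \<cdot> N \<cdot> Const SucC"
    unfolding Min'_prog_def by (rule beta2) (simp_all add: closedI[OF F] closedI[OF N] numeral_eq_Suc)
  ultimately show "Min'_prog neq \<cdot> F \<cdot> N \<approx>\<^bsub>Nat\<^sub>t\<^esub> Const MinC \<cdot> F \<cdot> N"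
    using Min'_prog_loop[OF F N] by (blast intro: equiv_trans equiv_steps)
qed (use typing_Min'_prog in \<open>auto intro: typing_App simp: typing_simps\<close>)

lemma dagger_cst_equiv: "dagger_cst neq c \<approx>\<^bsub>cst_ty c\<^esub> Const c"
  by (cases c) (simp_all add: Rec'_prog_equiv[unfolded cst_ty.simps] Min'_prog_equiv[unfolded cst_ty.simps]
      equiv_refl typing_simps)

lemma dagger_equiv: "[] \<turnstile> M \<Colon> \<tau> \<Longrightarrow> dagger neq M \<approx>\<^bsub>\<tau>\<^esub> M"
  using equiv_replace_csts[of M \<tau> "dagger_cst neq" Const] dagger_cst_equiv by (simp add: dagger_def)

end

subsection \<open>The translations stay within their languages\<close>

lemma csts_of_replace_csts: "csts_of (replace_csts \<theta> M) = (\<Union>c \<in> csts_of M. csts_of (\<theta> c))"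
  by (induction M) auto

lemma csts_of_ifzero: "csts_of (ifzero \<sigma>) = {IfzeroC}"
  by (induction \<sigma>) auto

lemma circ_cst_lang: "c \<in> lang_W \<union> lang_T_min \<Longrightarrow> csts_of (circ_cst c) \<subseteq> lang_PCF_byval"
  by (cases c)
     (auto simp: lang_W_def lang_T_min_def lang_B_def lang_PCF_byval_def While_prog_def Rec_prog_def
       Min_prog_def csts_of_ifzero)

lemma circ_lang: "csts_of M \<subseteq> lang_W \<union> lang_T_min \<Longrightarrow> csts_of (M\<^sup>\<circ>) \<subseteq> lang_PCF_byval"
  using circ_cst_lang by (fastforce simp: circ_def csts_of_replace_csts)

lemma dagger_cst_lang:
  "csts_of neq \<subseteq> lang_W \<Longrightarrow> c \<in> lang_T_min \<Longrightarrow> csts_of (dagger_cst neq c) \<subseteq> lang_W"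
  by (cases c) (auto simp: lang_W_def lang_T_min_def lang_B_def Rec'_prog_def Min'_prog_def)

lemma dagger_lang:
  "csts_of neq \<subseteq> lang_W \<Longrightarrow> csts_of M \<subseteq> lang_T_min \<Longrightarrow> csts_of (dagger neq M) \<subseteq> lang_W"
  using dagger_cst_lang by (fastforce simp: dagger_def csts_of_replace_csts)

lemma circ_closed_term:
  assumes "[] \<turnstile> M \<Colon> \<sigma>" "csts_of M \<subseteq> lang_W \<union> lang_T_min"
  shows "closed_term lang_PCF_byval (M\<^sup>\<circ>) \<sigma>"
  using equiv_typing(1)[OF circ_equiv[OF assms(1)]] circ_lang[OF assms(2)] by (simp add: closed_term_def)

text \<open>The chain of equivalences passes through \<open>M\<close> and \<open>N\<close>, which
  belong to other languages; only its two ends have to lie in PCF with \<open>byval\<close>.\<close>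

lemma circ_obs_eq:
  assumes "M \<approx>\<^bsub>\<sigma>\<^esub> N" "csts_of M \<subseteq> lang_W" "csts_of N \<subseteq> lang_T_min"
  shows "M\<^sup>\<circ> \<simeq>\<^bsub>\<sigma>\<^esub> N\<^sup>\<circ>"
proof (rule obs_eqI)
  note ty = equiv_typing[OF assms(1)]
  show "closed_term lang_PCF_byval (M\<^sup>\<circ>) \<sigma>" "closed_term lang_PCF_byval (N\<^sup>\<circ>) \<sigma>"
    using assms(2,3) by (auto intro!: circ_closed_term ty)
  show "M\<^sup>\<circ> \<approx>\<^bsub>\<sigma>\<^esub> N\<^sup>\<circ>"
    by (rule equiv_trans[OF circ_equiv[OF ty(1)] equiv_trans[OF assms(1) equiv_sym[OF circ_equiv[OF ty(2)]]]])
qed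

theorem proposition3:
  fixes neq :: tm
  assumes "closed_term lang_W neq (Nat\<^sub>t \<rightarrow> Nat\<^sub>t \<rightarrow> Nat\<^sub>t)"
    and "implements_neq lang_W neq"
    and "implements_neq lang_PCF_byval (neq\<^sup>\<circ>)"
  shows
    "((\<forall>\<sigma>. (Rec'_prog neq \<sigma>)\<^sup>\<circ> \<simeq>\<^bsub>ty_of_rec \<sigma>\<^esub> Rec_prog \<sigma>) \<and>
      (Min'_prog neq)\<^sup>\<circ> \<simeq>\<^bsub>ty_of_min\<^esub> Min_prog) \<and>
     (\<forall>M \<sigma>. closed_term lang_T_min M \<sigma> \<longrightarrow> (dagger neq M)\<^sup>\<circ> \<simeq>\<^bsub>\<sigma>\<^esub> M\<^sup>\<circ>) \<and>
     (\<forall>M n. closed_term lang_T_min M Nat\<^sub>t \<longrightarrow> (M \<leadsto>* num n \<longleftrightarrow> dagger neq M \<leadsto>* num n))"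
proof -
  have *: "[] \<turnstile> neq \<Colon> Nat\<^sub>t \<rightarrow> Nat\<^sub>t \<rightarrow> Nat\<^sub>t" "csts_of neq \<subseteq> lang_W"
    using assms(1) by (simp_all add: closed_term_def)
  interpret inequality neq
    using *(1) implements_neq_all_csts[OF *(1) assms(2)] by unfold_locales
  have obs: "(dagger neq M)\<^sup>\<circ> \<simeq>\<^bsub>\<sigma>\<^esub> M\<^sup>\<circ>" if "closed_term lang_T_min M \<sigma>" for M \<sigma>
    using that dagger_lang[OF *(2)] by (intro circ_obs_eq dagger_equiv) (simp_all add: closed_term_def)
  \<comment> \<open>Part (i) is part (ii) at the constants themselves: \<open>dagger\<close> turns
    \<open>Const (RecC \<sigma>)\<close> into \<open>Rec'_prog neq \<sigma>\<close>, and
    \<open>circ\<close> turns it into \<open>Rec_prog \<sigma>\<close>.\<close>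
  have "(Rec'_prog neq \<sigma>)\<^sup>\<circ> \<simeq>\<^bsub>ty_of_rec \<sigma>\<^esub> Rec_prog \<sigma>" for \<sigma>
    using obs[of "Const (RecC \<sigma>)" "ty_of_rec \<sigma>"]
    by (simp add: closed_term_def typing_simps lang_T_min_def dagger_def circ_def)
  moreover have "(Min'_prog neq)\<^sup>\<circ> \<simeq>\<^bsub>ty_of_min\<^esub> Min_prog"
    using obs[of "Const MinC" ty_of_min]
    by (simp add: closed_term_def typing_simps lang_T_min_def dagger_def circ_def)
  \<comment> \<open>At type \<open>Nat\<^sub>t\<close> equivalence means having the same values, so
    \<open>dagger_equiv\<close> gives (iii) directly, without passing through the translation into
    PCF.\<close>
  moreover have "M \<leadsto>* num n \<longleftrightarrow> dagger neq M \<leadsto>* num n" if "closed_term lang_T_min M Nat\<^sub>t" for M n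
    using dagger_equiv[of M "Nat\<^sub>t"] that by (simp add: closed_term_def equiv_Nat_iff)
  ultimately show ?thesis using obs by blast
qed

end
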